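(* Let $m,n$ be positive integers and let $\rho$ be the sum of $m$ standard representations of $\mathfrak{so}(n)$ or of $\mathfrak{sp}(n)$ (over $\mathbb{C}$, with $n$ even in the case of $\mathfrak{sp}(n)$). Put $\varepsilon=+1$ for $\mathfrak{sp}(n)$ and $\varepsilon=-1$ for $\mathfrak{so}(n)$. 1. Assume $m<n$. Write $m=q(n-m)+r$ with $q,r\in\mathbb{Z}$, $0\le r<n-m$. Then the Jordan--Kronecker invariants of $\rho$ are - $\frac{(n-m)(n-m+\varepsilon)}{2}$ horizontal indices: $2q+1$ taken $\frac{(n-m-r)(n-m-r+\varepsilon)}{2}$ times, $2q+2$ taken $(n-m-r)r$ times, and $2q+3$ taken $\frac{r(r+\varepsilon)}{2}$ times; - $\frac{m(m-\varepsilon)}{2}$ vertical indices $\mathrm{v}_i=2$. 2. Assume $m=n$. In the $\mathfrak{so}(n)$ case the Jordan--Kronecker invariants of $\rho$ consist of $\frac{n(n+1)}{2}$ vertical indices: $1$ taken $n$ times and $2$ taken $\frac{n(n-1)}{2}$ times. In the $\mathfrak{sp}(n)$ case they are $\frac{n(n-1)}{2}$ vertical indices $\mathrm{v}_i=2$ and $n$ Jordan $1\times1$ blocks with different eigenvalues. 3. Assume $m>n$. Then the Jordan--Kronecker invariants of $\rho$ are $n(m-n)+\frac{n(n-\varepsilon)}{2}$ vertical indices: $1$ taken $(m-n-\varepsilon)n$ times and $2$ taken $\frac{n(n+\varepsilon)}{2}$ times. In each case there are no other blocks.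
   Context: Everything is over $\mathbb{C}$ and finite-dimensional. Pencils. For linear maps $A,B:U\to V$ there are bases of $U$ and $V$ (Kronecker's theorem) in which all matrices $A+\lambda B$ are simultaneously block-diagonal, each pair of diagonal blocks $(A_i,B_i)$ being one of: (i) a $k\times k$ Jordan block with eigenvalue $\lambda_0\in\mathbb{C}$: $A_i=J_k(\lambda_0)$ (the upper triangular Jordan block), $B_i=I_k$; (ii) a $k\times k$ Jordan block with eigenvalue $\infty$: $A_i=I_k$, $B_i=J_k(0)$; (iii) a horizontal Kronecker block of size $(h-1)\times h$, $h\ge 1$: $A_i=(0\,|\,I_{h-1})$, $B_i=(I_{h-1}\,|\,0)$; (iv) a vertical Kronecker block of size $v\times(v-1)$, $v\ge1$: the transposes of the matrices in (iii) with $h=v$. A $0\times 1$ horizontal block ($h=1$) is a zero column and a $1\times 0$ vertical block ($v=1$) is a zero row. The blocks are unique up to permutation. The numbers $h$ (widths of horizontal blocks) are the horizontal indices, the numbers $v$ (heights of vertical blocks) are the vertical indices. Representations. For a representation $\rho:\mathfrak{g}\to\mathfrak{gl}(V)$ and $x\in V$ put $R_x:\mathfrak{g}\to V$, $R_x(\xi)=\rho(\xi)x$. The algebraic type of the pencil $R_a+\lambda R_b=R_{a+\lambda b}$ is the collection: number of distinct eigenvalues of Jordan blocks, number and sizes of the Jordan blocks for each eigenvalue, horizontal and vertical indices (with multiplicity). The Jordan--Kronecker (JK) invariants of $\rho$ are the algebraic type of $R_{a+\lambda b}$ for a generic pair $(a,b)\in V\times V$ (i.e. for all pairs in some non-empty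 Zariski open subset). The sum of $m$ standard representations of a matrix Lie algebra $\mathfrak{g}\subset\mathfrak{gl}(n)$ is the representation on $n\times m$ matrices given by $\rho(Y)X=YX$, $Y\in\mathfrak{g}$, $X\in\mathrm{Mat}_{n\times m}$. Here $\mathfrak{so}(n)$ is the Lie algebra of skew-symmetric $n\times n$ matrices; $\mathfrak{sp}(n)$, for $n$ even, is the Lie algebra of $n\times n$ matrices $Y$ with $Y^T\Omega+\Omega Y=0$, $\Omega=\begin{pmatrix}0&I_{n/2}\\-I_{n/2}&0\end{pmatrix}$ (so $n$ is the dimension of the underlying space). *)

theory Defs
  imports
    "Jordan_Normal_Form.Jordan_Normal_Form"
    "Jordan_Normal_Form.VS_Connect"
    "HOL-Library.Multiset"
begin

section \<open>Pencils of linear maps and their algebraic type\<close>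

text \<open>Finite-dimensional complex vector spaces are module records over \<^term>\<open>class_ring\<close>.
  A pencil is handled as the pair of linear maps generating it.\<close>

datatype eigenvalue = Finite_ev complex | Infinite_ev

datatype kblock = Jordan_block eigenvalue nat | Horizontal_block nat | Vertical_block nat

text \<open>Indices count from 0 and a matrix may have no rows or no columns, so that
  \<^term>\<open>Horizontal_block 1\<close> is a zero column and \<^term>\<open>Vertical_block 1\<close> a zero row.\<close>

fun block_pair :: "kblock \<Rightarrow> complex mat \<times> complex mat" where
  "block_pair (Jordan_block (Finite_ev c) k) = (jordan_block k c, 1\<^sub>m k)"
| "block_pair (Jordan_block Infinite_ev k) = (1\<^sub>m k, jordan_block k 0)"
| "block_pair (Horizontal_block h) =
     (mat (h - 1) h (\<lambda>(i, j). if j = i + 1 then 1 else 0),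
      mat (h - 1) h (\<lambda>(i, j). if j = i then 1 else 0))"
| "block_pair (Vertical_block v) =
     (transpose_mat (mat (v - 1) v (\<lambda>(i, j). if j = i + 1 then 1 else 0)),
      transpose_mat (mat (v - 1) v (\<lambda>(i, j). if j = i then 1 else 0)))"

fun block_size :: "kblock \<Rightarrow> nat" where
  "block_size (Jordan_block e k) = k"
| "block_size (Horizontal_block h) = h"
| "block_size (Vertical_block v) = v"

definition is_matrix_of ::
  "(complex, 'u) module \<Rightarrow> (complex, 'v) module \<Rightarrow> 'u list \<Rightarrow> 'v list \<Rightarrow> ('u \<Rightarrow> 'v) \<Rightarrow> complex mat \<Rightarrow> bool"
where
  "is_matrix_of U V us vs f M \<longleftrightarrow>
     M \<in> carrier_mat (length vs) (length us) \<and>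
     (\<forall>j < length us. f (us ! j) = finsum V (\<lambda>i. M $$ (i, j) \<odot>\<^bsub>V\<^esub> vs ! i) {..<length vs})"

definition ordered_basis :: "(complex, 'u) module \<Rightarrow> 'u list \<Rightarrow> bool" where
  "ordered_basis U us \<longleftrightarrow> distinct us \<and> vectorspace.basis class_ring U (set us)"

definition has_kronecker_form ::
  "(complex, 'u) module \<Rightarrow> (complex, 'v) module \<Rightarrow> ('u \<Rightarrow> 'v) \<Rightarrow> ('u \<Rightarrow> 'v) \<Rightarrow> kblock list \<Rightarrow> bool"
where
  "has_kronecker_form U V A B bs \<longleftrightarrow>
     A \<in> module_hom class_ring U V \<and> B \<in> module_hom class_ring U V \<and>
     (\<forall>b \<in> set bs. block_size b \<ge> 1) \<and>
     (\<exists>us vs. ordered_basis U us \<and> ordered_basis V vs \<and>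
        is_matrix_of U V us vs A (diag_block_mat (map (fst \<circ> block_pair) bs)) \<and>
        is_matrix_of U V us vs B (diag_block_mat (map (snd \<circ> block_pair) bs)))"

text \<open>The field \<open>jordan_sizes\<close> has one element for each distinct eigenvalue, namely the multiset
  of the sizes of the Jordan blocks with that eigenvalue; the eigenvalues themselves are
  forgotten.\<close>

record algebraic_type =
  jordan_sizes :: "nat multiset multiset"
  horizontal_indices :: "nat multiset"
  vertical_indices :: "nat multiset"

definition type_of_blocks :: "kblock list \<Rightarrow> algebraic_type" where
  "type_of_blocks bs =
     \<lparr> jordan_sizes = image_mset (\<lambda>e. mset [k. Jordan_block e' k \<leftarrow> bs, e' = e])
                        (mset_set {e. \<exists>k. Jordan_block e k \<in> set bs}),
       horizontal_indices = mset [h. Horizontal_block h \<leftarrow> bs],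
       vertical_indices = mset [v. Vertical_block v \<leftarrow> bs] \<rparr>"

text \<open>Stated as a relation; the blocks are unique up to permutation by Kronecker's theorem.\<close>

definition has_algebraic_type ::
  "(complex, 'u) module \<Rightarrow> (complex, 'v) module \<Rightarrow> ('u \<Rightarrow> 'v) \<Rightarrow> ('u \<Rightarrow> 'v) \<Rightarrow> algebraic_type \<Rightarrow> bool"
where
  "has_algebraic_type U V A B T \<longleftrightarrow>
     (\<exists>bs. has_kronecker_form U V A B bs \<and> type_of_blocks bs = T)"

section \<open>Jordan--Kronecker invariants of a representation\<close>

definition scalar_module :: "(complex, complex) module" where
  "scalar_module =
     \<lparr> carrier = UNIV, mult = (*), one = 1, zero = 0, add = (+), smult = (*) \<rparr>"

text \<open>Polynomial functions on a vector space form the algebra generated by the linear functionals.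
  Only their values on the carrier matter.\<close>

inductive_set polynomial_functions :: "(complex, 'w) module \<Rightarrow> ('w \<Rightarrow> complex) set"
  for W :: "(complex, 'w) module"
where
  const: "(\<lambda>_. c) \<in> polynomial_functions W"
| linear: "f \<in> module_hom class_ring W scalar_module \<Longrightarrow> f \<in> polynomial_functions W"
| add: "p \<in> polynomial_functions W \<Longrightarrow> p' \<in> polynomial_functions W \<Longrightarrow>
          (\<lambda>x. p x + p' x) \<in> polynomial_functions W"
| mult: "p \<in> polynomial_functions W \<Longrightarrow> p' \<in> polynomial_functions W \<Longrightarrow>
          (\<lambda>x. p x * p' x) \<in> polynomial_functions W"

definition zariski_open :: "(complex, 'w) module \<Rightarrow> 'w set \<Rightarrow> bool" where
  "zariski_open W S \<longleftrightarrow>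
     (\<exists>P \<subseteq> polynomial_functions W. S = {x \<in> carrier W. \<exists>p \<in> P. p x \<noteq> 0})"

text \<open>For a representation \<open>\<rho>\<close> of \<open>G\<close> on \<open>V\<close>, the map \<open>\<lambda>\<xi>. \<rho> \<xi> a\<close> is \<open>R\<^sub>a\<close>.\<close>

definition has_JK_invariants ::
  "(complex, 'g) module \<Rightarrow> (complex, 'v) module \<Rightarrow> ('g \<Rightarrow> 'v \<Rightarrow> 'v) \<Rightarrow> algebraic_type \<Rightarrow> bool"
where
  "has_JK_invariants G V \<rho> T \<longleftrightarrow>
     (\<exists>S. zariski_open (direct_sum V V) S \<and> S \<noteq> {} \<and>
        (\<forall>(a, b) \<in> S. has_algebraic_type G V (\<lambda>\<xi>. \<rho> \<xi> a) (\<lambda>\<xi>. \<rho> \<xi> b) T))"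

section \<open>Sums of standard representations\<close>

definition so_algebra :: "nat \<Rightarrow> complex mat set" where
  "so_algebra n = {Y \<in> carrier_mat n n. transpose_mat Y = - Y}"

definition symplectic_form :: "nat \<Rightarrow> complex mat" where
  "symplectic_form n =
     (let k = n div 2 in four_block_mat (0\<^sub>m k k) (1\<^sub>m k) (- 1\<^sub>m k) (0\<^sub>m k k))"

definition sp_algebra :: "nat \<Rightarrow> complex mat set" where
  "sp_algebra n =
     {Y \<in> carrier_mat n n. transpose_mat Y * symplectic_form n + symplectic_form n * Y = 0\<^sub>m n n}"

definition standard_sum_has_JK_invariants ::
  "complex mat set \<Rightarrow> nat \<Rightarrow> nat \<Rightarrow> algebraic_type \<Rightarrow> bool"
where
  "standard_sum_has_JK_invariants \<gg> n m T \<longleftrightarrow>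
     has_JK_invariants ((module_mat TYPE(complex) n n)\<lparr>carrier := \<gg>\<rparr>) (module_mat TYPE(complex) n m)
       (\<lambda>Y X. Y * X) T"

end

theory Submission
  imports
    Defs
    "HOL-Library.Function_Algebras"
    "Jordan_Normal_Form.Schur_Decomposition"
begin

text \<open>Let \<open>J\<close> be the Gram matrix of the invariant form, so that \<open>Y \<mapsto> J Y\<close> identifies the Lie algebra
  with the space of bilinear forms \<open>S\<close> on \<open>\<complex>\<^sup>n\<close> with \<open>S\<^sup>T = \<epsilon> S\<close>. The map \<open>R\<^sub>a\<close> becomes \<open>S \<mapsto> S a\<close>, and
  replacing \<open>(a, b)\<close> by \<open>(P a Q, P b Q)\<close> does not change the pencil up to isomorphism, so that only
  the strict equivalence class of the generic pair of \<open>n \<times> m\<close> matrices matters.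

  If \<open>S a + T b = 0\<close> implies that \<open>S\<close> and \<open>T\<close> lie in a subspace \<open>H\<close>, then a complement of \<open>H\<close> contributes
  only vertical indices 2, and what is left of the target contributes vertical indices 1.
  For \<open>m > n\<close>, and for \<open>m = n\<close> and skew forms, \<open>H = 0\<close>.
  For \<open>m = n\<close> and symmetric forms the generic pair is \<open>(diag \<mu>, 1)\<close> with distinct \<open>\<mu>\<^sub>i\<close>,
  and \<open>H\<close> consists of the diagonal forms.
  For \<open>m < n\<close> and \<open>d = n - m\<close> the generic pair consists of the two embeddings \<open>e\<^sub>k \<mapsto> e\<^sub>k\<close> and \<open>e\<^sub>k \<mapsto> e\<^bsub>k+d\<^esub>\<close>,
  and \<open>H\<close> consists of the forms with \<open>S\<^bsub>p,k+d\<^esub> = S\<^bsub>p+d,k\<^esub>\<close>: for each pair of residue classes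
  modulo \<open>d\<close> they are Hankel matrices, whose antidiagonals form one horizontal block.\<close>

section \<open>Vector spaces of functions\<close>

text \<open>A genericity claim needs one explicit polynomial whose non-vanishing forces the normal
  form, hence transformations that depend polynomially on the pair. For m < n they come from a
  linear system solvable at the pair of shifts; Cramer's rule extends the solution to all pairs, and
  the polynomial is the determinant of the resulting change of basis. For injective pencils it is a
  determinant comparing a pair with one injective pair, for square pairs and symmetric forms it is
  det b times a discriminant. The horizontal indices come from n = (q + 1) d + r: r residue classes
  modulo d have q + 2 members, the others q + 1. A block joining classes with s and t members has s
  + t - 1 antidiagonals, that is 2q + 3, 2q + 2 or 2q + 1. Only unordered pairs of classes count,
  and a class pairs with itself only for \<epsilon> = 1; this gives the multiplicities. Vectors are
  functions into the complex numbers, so that bases live in one global vector space; only finished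
  bases are transported to the module records of the definitions.\<close>

definition fscale :: "complex \<Rightarrow> ('a \<Rightarrow> complex) \<Rightarrow> 'a \<Rightarrow> complex" where
  "fscale c f = (\<lambda>x. c * f x)"

lemma fscale_apply [simp]: "fscale c f x = c * f x"
  by (simp add: fscale_def)

lemma sum_fun_apply: "(\<Sum>i\<in>I. f i) x = (\<Sum>i\<in>I. f i x)"
  for f :: "'i \<Rightarrow> 'a \<Rightarrow> complex"
  by (induction I rule: infinite_finite_induct) auto

interpretation fs: vector_space "fscale :: complex \<Rightarrow> ('a \<Rightarrow> complex) \<Rightarrow> _"
  by unfold_locales (auto simp: fun_eq_iff algebra_simps)

text \<open>Evaluation at \<open>pos y\<close> is a functional dual to \<open>b y\<close>, so
  evaluating a linear relation there isolates one coefficient.\<close>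

lemma dual_family_independent:
  fixes b :: "'x \<Rightarrow> 'a \<Rightarrow> complex"
  assumes "finite X"
    and dual: "\<And>x y. x \<in> X \<Longrightarrow> y \<in> X \<Longrightarrow> b x (pos y) = (if x = y then 1 else 0)"
  shows "inj_on b X" "fs.independent (b ` X)"
proof -
  show inj: "inj_on b X"
  proof (rule inj_onI)
    fix x y assume "x \<in> X" "y \<in> X" "b x = b y"
    then show "x = y" using dual[of x y] dual[of y y] by (cases "x = y") auto
  qed
  show "fs.independent (b ` X)"
  proof (rule fs.independent_if_scalars_zero)
    fix f x assume sum0: "(\<Sum>v\<in>b ` X. fscale (f v) v) = 0" and x: "x \<in> b ` X"
    then obtain y where y: "y \<in> X" "x = b y" by auto
    have "0 = (\<Sum>v\<in>X. fscale (f (b v)) (b v)) (pos y)"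
      using sum0 by (simp add: sum.reindex[OF inj])
    also have "\<dots> = (\<Sum>v\<in>X. if v = y then f (b v) else 0)"
      unfolding sum_fun_apply by (rule sum.cong) (use dual y in auto)
    also have "\<dots> = f x" using y assms(1) by simp
    finally show "f x = 0" ..
  qed (use assms in auto)
qed

text \<open>Subtracting from \<open>f\<close> its interpolation with coefficients
  \<open>f (pos x)\<close> leaves a member of \<open>G\<close> that vanishes at all positions;
  \<open>sep\<close> kills it.\<close>

lemma dual_family_span:
  fixes b :: "'x \<Rightarrow> 'a \<Rightarrow> complex"
  assumes "finite X"
    and dual: "\<And>x y. x \<in> X \<Longrightarrow> y \<in> X \<Longrightarrow> b x (pos y) = (if x = y then 1 else 0)"
    and G: "fs.subspace G" "\<And>x. x \<in> X \<Longrightarrow> b x \<in> G"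
    and sep: "\<And>f. f \<in> G \<Longrightarrow> (\<And>x. x \<in> X \<Longrightarrow> f (pos x) = 0) \<Longrightarrow> f = 0"
  shows "fs.span (b ` X) = G"
proof
  show "fs.span (b ` X) \<subseteq> G"
    using G by (intro fs.span_minimal) auto
  show "G \<subseteq> fs.span (b ` X)"
  proof
    fix f assume f: "f \<in> G"
    let ?g = "\<Sum>x\<in>X. fscale (f (pos x)) (b x)"
    have "?g \<in> G" using G by (intro fs.subspace_sum fs.subspace_scale)
    then have "f - ?g \<in> G" using G f by (simp add: fs.subspace_diff)
    moreover have "(f - ?g) (pos y) = 0" if "y \<in> X" for y
    proof -
      have "?g (pos y) = (\<Sum>v\<in>X. if v = y then f (pos v) else 0)"
        unfolding sum_fun_apply by (rule sum.cong) (use dual that in auto)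
      then show ?thesis using that assms(1) by simp
    qed
    ultimately have "f - ?g = 0" by (rule sep)
    then have "f = ?g" by simp
    moreover have "?g \<in> fs.span (b ` X)"
      by (intro fs.span_sum fs.span_scale fs.span_base imageI)
    ultimately show "f \<in> fs.span (b ` X)" by simp
  qed
qed

lemma dual_family_dim:
  fixes b :: "'x \<Rightarrow> 'a \<Rightarrow> complex"
  assumes "finite X"
    and "\<And>x y. x \<in> X \<Longrightarrow> y \<in> X \<Longrightarrow> b x (pos y) = (if x = y then 1 else 0)"
    and "fs.subspace G" "\<And>x. x \<in> X \<Longrightarrow> b x \<in> G"
    and "\<And>f. f \<in> G \<Longrightarrow> (\<And>x. x \<in> X \<Longrightarrow> f (pos x) = 0) \<Longrightarrow> f = 0"
  shows "\<exists>B. finite B \<and> fs.independent B \<and> fs.span B = G \<and> card B = card X"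
proof (intro exI conjI)
  show "fs.independent (b ` X)" by (rule dual_family_independent(2)[where pos = pos]) (use assms in auto)
  show "fs.span (b ` X) = G" by (rule dual_family_span[where pos = pos]) (use assms in auto)
  show "card (b ` X) = card X"
    by (rule card_image[OF dual_family_independent(1)[where pos = pos]]) (use assms in auto)
qed (use assms in auto)

section \<open>Block matrices in lists of vectors\<close>

text \<open>The counterpart of \<open>is_matrix_of\<close> in function spaces. Nothing is required
  of the lists, so that pieces of a basis can be treated separately and concatenated.\<close>

definition matrix_rel ::
  "('a \<Rightarrow> complex) list \<Rightarrow> ('b \<Rightarrow> complex) list \<Rightarrow> (('a \<Rightarrow> complex) \<Rightarrow> 'b \<Rightarrow> complex) \<Rightarrow> complex mat \<Rightarrow> bool"
where
  "matrix_rel us vs f M \<longleftrightarrow> M \<in> carrier_mat (length vs) (length us) \<and>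
     (\<forall>j < length us. f (us ! j) = (\<Sum>i<length vs. fscale (M $$ (i, j)) (vs ! i)))"

definition block_rel where
  "block_rel A B us vs bs \<longleftrightarrow>
     matrix_rel us vs A (diag_block_mat (map (fst \<circ> block_pair) bs)) \<and>
     matrix_rel us vs B (diag_block_mat (map (snd \<circ> block_pair) bs))"

lemma sum_lessThan_add: "(\<Sum>i<a + b. g i) = (\<Sum>i<a. g i) + (\<Sum>i<b. g (a + i))"
  for g :: "nat \<Rightarrow> 'c::comm_monoid_add"
  by (induction b) (simp_all add: add.assoc)

lemma matrix_rel_append:
  assumes 1: "matrix_rel us1 vs1 f M1" and 2: "matrix_rel us2 vs2 f M2"
  shows "matrix_rel (us1 @ us2) (vs1 @ vs2) f
     (four_block_mat M1 (0\<^sub>m (dim_row M1) (dim_col M2)) (0\<^sub>m (dim_row M2) (dim_col M1)) M2)"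
    (is "matrix_rel ?us ?vs f ?M")
proof -
  have M: "M1 \<in> carrier_mat (length vs1) (length us1)" "M2 \<in> carrier_mat (length vs2) (length us2)"
    using 1 2 by (auto simp: matrix_rel_def)
  have f1: "f (us1 ! j) = (\<Sum>i<length vs1. fscale (M1 $$ (i, j)) (vs1 ! i))" if "j < length us1" for j
    using 1 that by (auto simp: matrix_rel_def)
  have f2: "f (us2 ! j) = (\<Sum>i<length vs2. fscale (M2 $$ (i, j)) (vs2 ! i))" if "j < length us2" for j
    using 2 that by (auto simp: matrix_rel_def)
  have "f (?us ! j) = (\<Sum>i<length ?vs. fscale (?M $$ (i, j)) (?vs ! i))" if j: "j < length ?us" for j
  proof -
    have split: "(\<Sum>i<length ?vs. fscale (?M $$ (i, j)) (?vs ! i)) =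
       (\<Sum>i<length vs1. fscale (?M $$ (i, j)) (vs1 ! i)) +
       (\<Sum>i<length vs2. fscale (?M $$ (length vs1 + i, j)) (vs2 ! i))"
      unfolding length_append sum_lessThan_add by (simp add: nth_append)
    show ?thesis
    proof (cases "j < length us1")
      case True
      have "(\<Sum>i<length vs2. fscale (?M $$ (length vs1 + i, j)) (vs2 ! i)) = (\<Sum>i<length vs2. 0)"
        by (rule sum.cong) (use True M in \<open>auto simp: fun_eq_iff\<close>)
      moreover have "(\<Sum>i<length vs1. fscale (?M $$ (i, j)) (vs1 ! i)) =
          (\<Sum>i<length vs1. fscale (M1 $$ (i, j)) (vs1 ! i))"
        by (rule sum.cong) (use True M in auto)
      ultimately show ?thesis unfolding split using True f1 by (simp add: nth_append)
    next
      case False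
      then have j': "j - length us1 < length us2" using j by auto
      have "(\<Sum>i<length vs1. fscale (?M $$ (i, j)) (vs1 ! i)) = (\<Sum>i<length vs1. 0)"
        by (rule sum.cong) (use False j M in \<open>auto simp: fun_eq_iff\<close>)
      moreover have "(\<Sum>i<length vs2. fscale (?M $$ (length vs1 + i, j)) (vs2 ! i)) =
          (\<Sum>i<length vs2. fscale (M2 $$ (i, j - length us1)) (vs2 ! i))"
        by (rule sum.cong) (use False j M in auto)
      ultimately show ?thesis unfolding split using False f2[OF j'] by (simp add: nth_append)
    qed
  qed
  moreover have "?M \<in> carrier_mat (length ?vs) (length ?us)" using M by auto
  ultimately show ?thesis unfolding matrix_rel_def by blast
qed

lemma block_rel_Nil: "block_rel A B [] [] []"
  by (auto simp: block_rel_def matrix_rel_def)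

lemma block_rel_Cons:
  assumes "matrix_rel us1 vs1 A (fst (block_pair b))" "matrix_rel us1 vs1 B (snd (block_pair b))"
    and "block_rel A B us2 vs2 bs"
  shows "block_rel A B (us1 @ us2) (vs1 @ vs2) (b # bs)"
  using assms unfolding block_rel_def by (auto intro!: matrix_rel_append simp: Let_def)

lemma block_rel_append:
  assumes "block_rel A B us1 vs1 bs1" "block_rel A B us2 vs2 bs2"
  shows "block_rel A B (us1 @ us2) (vs1 @ vs2) (bs1 @ bs2)"
proof -
  have *: "matrix_rel (us1 @ us2) (vs1 @ vs2) f (diag_block_mat (Ms1 @ Ms2))"
    if "matrix_rel us1 vs1 f (diag_block_mat Ms1)" "matrix_rel us2 vs2 f (diag_block_mat Ms2)"
    for Ms1 Ms2 f
    using matrix_rel_append[OF that] diag_block_mat_append[of Ms1 Ms2] by (simp add: Let_def)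
  show ?thesis using assms *[of A] *[of B] unfolding block_rel_def map_append by simp
qed

lemma block_rel_concat:
  assumes "\<And>x. x \<in> set xs \<Longrightarrow> matrix_rel (u x) (v x) A (fst (block_pair (b x)))"
    and "\<And>x. x \<in> set xs \<Longrightarrow> matrix_rel (u x) (v x) B (snd (block_pair (b x)))"
  shows "block_rel A B (concat (map u xs)) (concat (map v xs)) (map b xs)"
  using assms by (induction xs) (auto simp: block_rel_Nil intro!: block_rel_Cons)

lemma sum_lessThan_2: "(\<Sum>i<2. g i) = g 0 + g (1 :: nat)"
  for g :: "nat \<Rightarrow> 'c::comm_monoid_add"
  by (simp add: numeral_2_eq_2)

lemma matrix_rel_singleton:
  assumes "M \<in> carrier_mat 2 1" and "(\<Sum>i<2. fscale (M $$ (i, 0)) ([y, z] ! i)) = f x"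
  shows "matrix_rel [x] [y, z] f M"
proof -
  have len: "length [y, z] = 2" "length [x] = 1" by simp_all
  show ?thesis unfolding matrix_rel_def len less_one
  proof (intro conjI assms(1) allI impI)
    fix j :: nat assume "j = 0"
    then show "f ([x] ! j) = (\<Sum>i<2. fscale (M $$ (i, j)) ([y, z] ! i))"
      by (metis assms(2) nth_Cons_0)
  qed
qed

text \<open>The order of the targets is forced: for v = 2 the two matrices are the columns (0, 1)
  and (1, 0), so the first map of the pencil hits the second target.\<close>

lemma matrix_rel_vertical_two:
  "matrix_rel [x] [B x, A x] A (fst (block_pair (Vertical_block 2)))"
  "matrix_rel [x] [B x, A x] B (snd (block_pair (Vertical_block 2)))"
  by (intro matrix_rel_singleton carrier_matI;
      simp add: sum_lessThan_2 fscale_def fun_eq_iff)+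

lemma block_rel_vertical_two:
  "block_rel A B cs (concat (map (\<lambda>c. [B c, A c]) cs)) (replicate (length cs) (Vertical_block 2))"
proof -
  have "block_rel A B (concat (map (\<lambda>c. [c]) cs)) (concat (map (\<lambda>c. [B c, A c]) cs))
          (map (\<lambda>_. Vertical_block 2) cs)"
    using matrix_rel_vertical_two by (intro block_rel_concat) auto
  then show ?thesis by (simp add: map_replicate_const)
qed

text \<open>A block with one row and no column consumes a target vector and no source vector, hence
  the empty source list.\<close>

lemma block_rel_vertical_one:
  "block_rel A B [] vs (replicate (length vs) (Vertical_block 1))"
proof -
  have "block_rel A B (concat (map (\<lambda>_. []) vs)) (concat (map (\<lambda>v. [v]) vs))
          (map (\<lambda>_. Vertical_block 1) vs)"
    by (rule block_rel_concat) (auto simp: matrix_rel_def)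
  then show ?thesis by (simp add: map_replicate_const)
qed

section \<open>Splitting off vertical blocks\<close>

lemma independent_nth_scalars:
  fixes ws :: "('a \<Rightarrow> complex) list"
  assumes "distinct ws" "fs.independent (set ws)"
    and sum0: "(\<Sum>i<length ws. fscale (c i) (ws ! i)) = 0" and i: "i < length ws"
  shows "c i = 0"
proof -
  have bij: "bij_betw ((!) ws) {..<length ws} (set ws)"
    using assms(1) by (rule bij_betw_nth) auto
  let ?u = "\<lambda>v. c (the_inv_into {..<length ws} ((!) ws) v)"
  have "(\<Sum>v\<in>set ws. fscale (?u v) v) = (\<Sum>i<length ws. fscale (?u (ws ! i)) (ws ! i))"
    by (rule sum.reindex_bij_betw[OF bij, symmetric])
  also have "\<dots> = (\<Sum>i<length ws. fscale (c i) (ws ! i))"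
    by (rule sum.cong) (use bij in \<open>auto simp: the_inv_into_f_f bij_betw_def\<close>)
  finally have "(\<Sum>v\<in>set ws. fscale (?u v) v) = 0" using sum0 by simp
  then have "?u (ws ! i) = 0"
    using fs.independentD[OF assms(2), of "set ws" ?u "ws ! i"] i by auto
  then show ?thesis using i bij by (auto simp: the_inv_into_f_f bij_betw_def)
qed

text \<open>Coefficients are indexed by positions because entries of a concatenated list may a
  priori coincide; distinctness is part of the conclusion.\<close>

lemma nth_scalars_independent:
  fixes ws :: "('a \<Rightarrow> complex) list"
  assumes zero: "\<And>c i. (\<Sum>i<length ws. fscale (c i) (ws ! i)) = 0 \<Longrightarrow> i < length ws \<Longrightarrow> c i = 0"
  shows "distinct ws" "fs.independent (set ws)"
proof -
  show dist: "distinct ws"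
    unfolding distinct_conv_nth
  proof (intro allI impI notI)
    fix i j assume ij: "i < length ws" "j < length ws" "i \<noteq> j" "ws ! i = ws ! j"
    \<comment> \<open>A repeated entry gives the nontrivial relation with coefficients 1 and
      -1.\<close>
    let ?c = "\<lambda>k. (if k = i then 1 else 0) - (if k = j then 1 else 0) :: complex"
    have "(\<Sum>k<length ws. fscale (?c k) (ws ! k)) x = 0" for x
      using ij by (simp add: sum_fun_apply left_diff_distrib sum_subtractf if_distrib[of "\<lambda>z. z * _"] cong: if_cong)
    then have "(\<Sum>k<length ws. fscale (?c k) (ws ! k)) = 0" by (intro ext) simp
    from zero[OF this ij(1)] ij show False by simp
  qed
  have bij: "bij_betw ((!) ws) {..<length ws} (set ws)"
    using dist by (rule bij_betw_nth) auto
  show "fs.independent (set ws)"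
  proof (rule fs.independent_if_scalars_zero)
    fix f x assume s: "(\<Sum>v\<in>set ws. fscale (f v) v) = 0" and "x \<in> set ws"
    then obtain i where i: "i < length ws" "x = ws ! i" by (auto simp: in_set_conv_nth)
    have "(\<Sum>i<length ws. fscale (f (ws ! i)) (ws ! i)) = 0"
      using s sum.reindex_bij_betw[OF bij, of "\<lambda>v. fscale (f v) v"] by simp
    from zero[OF this i(1)] i(2) show "f x = 0" by simp
  qed simp
qed

text \<open>Two expansions of \<open>z\<close>, one over \<open>S\<close> and one over
  \<open>T\<close>, differ by a relation on the union, with coefficients \<open>u\<close> on
  \<open>S\<close> and \<open>- v\<close> on \<open>T\<close>.\<close>

lemma span_Int_span_eq_0:
  fixes S T :: "('a \<Rightarrow> complex) set"
  assumes "fs.independent (S \<union> T)" "S \<inter> T = {}" "finite S" "finite T"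
    and "z \<in> fs.span S" "z \<in> fs.span T"
  shows "z = 0"
proof -
  obtain u where u: "z = (\<Sum>x\<in>S. fscale (u x) x)"
    using assms(5) unfolding fs.span_finite[OF assms(3)] by (rule rangeE)
  obtain v where v: "z = (\<Sum>x\<in>T. fscale (v x) x)"
    using assms(6) unfolding fs.span_finite[OF assms(4)] by (rule rangeE)
  let ?w = "\<lambda>x. if x \<in> S then u x else - v x"
  have "(\<Sum>x\<in>S \<union> T. fscale (?w x) x) = (\<Sum>x\<in>S. fscale (?w x) x) + (\<Sum>x\<in>T. fscale (?w x) x)"
    using assms by (intro sum.union_disjoint) auto
  also have "(\<Sum>x\<in>S. fscale (?w x) x) = z" unfolding u by (rule sum.cong) auto
  also have "(\<Sum>x\<in>T. fscale (?w x) x) = (\<Sum>x\<in>T. - fscale (v x) x)"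
    by (rule sum.cong) (use assms(2) in \<open>auto simp: fun_eq_iff\<close>)
  also have "\<dots> = - z" unfolding v by (rule sum_negf)
  finally have "(\<Sum>x\<in>S \<union> T. fscale (?w x) x) = 0" unfolding add.right_inverse .
  then have "?w x = 0" if "x \<in> S" for x
    using fs.independentD[OF assms(1), of "S \<union> T" ?w x] assms that by auto
  then have "u x = 0" if "x \<in> S" for x using that by fastforce
  then have "fscale (u x) x = 0" if "x \<in> S" for x using that by (simp add: fun_eq_iff)
  then show ?thesis unfolding u by (rule sum.neutral[OF ballI])
qed

lemma span_nth: "(\<Sum>i<length cs. fscale (c i) (cs ! i)) \<in> fs.span (set cs)"
  by (intro fs.span_sum fs.span_scale fs.span_base) auto

lemma mset_interleave: "mset (concat (map (\<lambda>c. [f c, g c]) cs)) = mset (map f cs) + mset (map g cs)"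
  by (induction cs) auto

lemma card_independent_spanning:
  assumes "finite T" "fs.independent T" "fs.independent S" "fs.span S = fs.span T"
  shows "finite S" "card S = card T"
proof -
  have "S \<subseteq> fs.span T" "T \<subseteq> fs.span S" using assms fs.span_superset by blast+
  with assms fs.independent_span_bound[of T S] fs.independent_span_bound[of S T]
  show "finite S" "card S = card T" by (meson antisym)+
qed

text \<open>The counterpart of \<open>has_kronecker_form\<close> in function spaces, with the
  subspaces \<open>G\<close> and \<open>V\<close> in place of modules.\<close>

definition kronecker_realizable ::
  "(('a \<Rightarrow> complex) \<Rightarrow> 'b \<Rightarrow> complex) \<Rightarrow> (('a \<Rightarrow> complex) \<Rightarrow> 'b \<Rightarrow> complex) \<Rightarrow>
   ('a \<Rightarrow> complex) set \<Rightarrow> ('b \<Rightarrow> complex) set \<Rightarrow> kblock list \<Rightarrow> bool" where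
  "kronecker_realizable A B G V bs \<longleftrightarrow> (\<exists>us vs.
     distinct us \<and> fs.independent (set us) \<and> fs.span (set us) = G \<and>
     distinct vs \<and> fs.independent (set vs) \<and> fs.span (set vs) = V \<and> block_rel A B us vs bs)"

text \<open>The vectors \<open>ys\<close>, \<open>A c\<close> and \<open>B c\<close>, for \<open>c\<close> in a basis of a complement of the span of \<open>xs\<close>,
  are independent: by the last hypothesis a relation between them only involves the span of \<open>xs\<close>.\<close>

lemma kronecker_decomposition:
  fixes A B :: "('a \<Rightarrow> complex) \<Rightarrow> 'b \<Rightarrow> complex"
  assumes lin: "Vector_Spaces.linear fscale fscale A" "Vector_Spaces.linear fscale fscale B"
    and BG: "finite BG" "fs.independent BG" "fs.span BG = G"
    and BV: "finite BV" "fs.independent BV" "fs.span BV = V"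
    and maps: "A ` G \<subseteq> V" "B ` G \<subseteq> V"
    and xs: "distinct xs" "fs.independent (set xs)" "set xs \<subseteq> G"
    and ys: "distinct ys" "fs.independent (set ys)"
      "\<And>y. y \<in> set ys \<Longrightarrow> \<exists>h\<in>fs.span (set xs). \<exists>h'\<in>fs.span (set xs). y = A h + B h'"
    and rel: "block_rel A B xs ys bs"
    and key: "\<And>Y Z. Y \<in> G \<Longrightarrow> Z \<in> G \<Longrightarrow> A Y + B Z = 0 \<Longrightarrow>
                Y \<in> fs.span (set xs) \<and> Z \<in> fs.span (set xs)"
  shows "kronecker_realizable A B G V
     (bs @ replicate (card BG - length xs) (Vertical_block 2) @
        replicate (card BV - length ys - 2 * (card BG - length xs)) (Vertical_block 1))"
proof -
  interpret LA: Vector_Spaces.linear fscale fscale A by (rule lin)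
  interpret LB: Vector_Spaces.linear fscale fscale B by (rule lin)
  have subG: "fs.subspace G" and subV: "fs.subspace V" using BG BV fs.subspace_span by blast+
  have spanG: "fs.span S \<subseteq> G" if "S \<subseteq> G" for S using that subG by (rule fs.span_minimal)
  \<comment> \<open>\<open>BX\<close> extends \<open>xs\<close> to a basis of \<open>G\<close>; the
    added vectors \<open>cs\<close> span the complement that yields the vertical indices 2.\<close>
  obtain BX where BX: "set xs \<subseteq> BX" "BX \<subseteq> G" "fs.independent BX" "G \<subseteq> fs.span BX"
    using fs.maximal_independent_subset_extend[OF xs(3,2)] by blast
  have spanBX: "fs.span BX = G" using BX spanG[of BX] by blast
  have finBX: "finite BX" and cardBX: "card BX = card BG"
    using card_independent_spanning[of BG BX] BG BX spanBX by auto
  obtain cs where cs: "set cs = BX - set xs" "distinct cs"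
    using finite_distinct_list[of "BX - set xs"] finBX by auto
  have lcs: "length cs = card BG - length xs"
    using cs distinct_card[OF xs(1)] distinct_card[OF cs(2)] BX(1) cardBX
    by (simp add: card_Diff_subset)
  have indU: "fs.independent (set xs \<union> set cs)" using BX(1,3) cs by (simp add: Un_absorb1)
  have indC: "fs.independent (set cs)"
    using BX(3) cs fs.independent_mono by blast
  have csG: "set cs \<subseteq> G" using cs BX by auto
  obtain h h' where h: "\<And>y. y \<in> set ys \<Longrightarrow> h y \<in> fs.span (set xs)"
     "\<And>y. y \<in> set ys \<Longrightarrow> h' y \<in> fs.span (set xs)" "\<And>y. y \<in> set ys \<Longrightarrow> y = A (h y) + B (h' y)"
    using ys(3) by metis
  \<comment> \<open>Grouped by origin, the coefficients of a relation split into three index ranges.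
    The interleaved order that the blocks demand appears only in \<open>vs\<close>.\<close>
  define ws where "ws = ys @ map B cs @ map A cs"
  have indw: "c i = 0" if sum0: "(\<Sum>i<length ws. fscale (c i) (ws ! i)) = 0" and i: "i < length ws" for c i
  proof -
    define ly lc where "ly = length ys" and "lc = length cs"
    define Z where "Z = (\<Sum>i<lc. fscale (c (ly + i)) (cs ! i))"
    define Y where "Y = (\<Sum>i<lc. fscale (c (ly + (lc + i))) (cs ! i))"
    define S where "S = (\<Sum>i<ly. fscale (c i) (ys ! i))"
    define H where "H = (\<Sum>i<ly. fscale (c i) (h (ys ! i)))"
    define H' where "H' = (\<Sum>i<ly. fscale (c i) (h' (ys ! i)))"
    have "(\<Sum>i<length ws. fscale (c i) (ws ! i)) = S + (B Z + A Y)"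
      unfolding ws_def length_append length_map sum_lessThan_add S_def Y_def Z_def ly_def lc_def
      by (simp add: nth_append LA.sum LB.sum LA.scale LB.scale)
    moreover have "S = A H + B H'"
    proof -
      have "fscale (c i) (ys ! i) = A (fscale (c i) (h (ys ! i))) + B (fscale (c i) (h' (ys ! i)))"
        if "i < ly" for i
      proof -
        have "ys ! i = A (h (ys ! i)) + B (h' (ys ! i))" using h(3) that by (simp add: ly_def)
        then show ?thesis
          by (metis LA.scale LB.scale fs.scale_right_distrib)
      qed
      then show ?thesis unfolding S_def H_def H'_def LA.sum LB.sum sum.distrib[symmetric]
        by (intro sum.cong) auto
    qed
    \<comment> \<open>The relation is gathered under the two maps, in the form to which
      \<open>key\<close> applies. \<open>Y\<close> and \<open>Z\<close> are the parts in the
      complement, so they must vanish.\<close>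
    ultimately have "A (Y + H) + B (Z + H') = 0"
      using sum0 by (simp add: LA.add LB.add algebra_simps)
    moreover have HX: "H \<in> fs.span (set xs)" "H' \<in> fs.span (set xs)"
      unfolding H_def H'_def by (intro fs.span_sum fs.span_scale h; simp add: ly_def)+
    moreover have YC: "Y \<in> fs.span (set cs)" "Z \<in> fs.span (set cs)"
      unfolding Y_def Z_def lc_def by (rule span_nth)+
    moreover have "Y + H \<in> G" "Z + H' \<in> G"
      using HX YC spanG csG xs(3) subG by (meson fs.subspace_add subsetD)+
    ultimately have "Y + H \<in> fs.span (set xs)" "Z + H' \<in> fs.span (set xs)"
      using key by blast+
    then have "Y \<in> fs.span (set xs)" "Z \<in> fs.span (set xs)"
      using HX by (metis add_diff_cancel_right' fs.span_diff)+
    then have YZ0: "Y = 0" "Z = 0"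
      by (auto intro!: span_Int_span_eq_0[OF indU _ finite_set finite_set] YC simp: cs(1))
    have cZ: "c (ly + i) = 0" if "i < lc" for i
      using independent_nth_scalars[OF cs(2) indC, of "\<lambda>i. c (ly + i)" i] YZ0 that
      by (simp add: Z_def lc_def)
    have cY: "c (ly + (lc + i)) = 0" if "i < lc" for i
      using independent_nth_scalars[OF cs(2) indC, of "\<lambda>i. c (ly + (lc + i))" i] YZ0 that
      by (simp add: Y_def lc_def)
    have "S = 0" using YZ0 \<open>_ = S + (B Z + A Y)\<close> sum0 by (simp add: LA.zero LB.zero)
    then have cS: "c i = 0" if "i < ly" for i
      using independent_nth_scalars[OF ys(1,2), of c i] that by (simp add: S_def ly_def)
    have "i < ly + (lc + lc)" using i by (simp add: ws_def ly_def lc_def)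
    then consider "i < ly" | "i - ly < lc" "i = ly + (i - ly)"
      | "i - ly - lc < lc" "i = ly + (lc + (i - ly - lc))" by linarith
    then show ?thesis using cS cZ cY by cases metis+
  qed
  have dw: "distinct ws" "fs.independent (set ws)"
    using indw by (auto intro!: nth_scalars_independent)
  have ysV: "set ys \<subseteq> V"
  proof
    fix y assume "y \<in> set ys"
    then have "h y \<in> G" "h' y \<in> G" "y = A (h y) + B (h' y)" using h spanG[OF xs(3)] by auto
    then show "y \<in> V" using maps subV by (metis fs.subspace_add image_subset_iff)
  qed
  then have wsV: "set ws \<subseteq> V" using subset_trans[OF image_mono[OF csG] maps(1)] subset_trans[OF image_mono[OF csG] maps(2)]
    by (simp add: ws_def)
  \<comment> \<open>The vectors added to \<open>ws\<close> occur in no image of a source basis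
    vector, so each is a zero row, that is a vertical index 1.\<close>
  obtain BW where BW: "set ws \<subseteq> BW" "BW \<subseteq> V" "fs.independent BW" "V \<subseteq> fs.span BW"
    using fs.maximal_independent_subset_extend[OF wsV dw(2)] by blast
  have spanBW: "fs.span BW = V" using BW fs.span_minimal[OF BW(2) subV] by blast
  have finBW: "finite BW" and cardBW: "card BW = card BV"
    using card_independent_spanning[of BV BW] BV BW spanBW by auto
  obtain es where es: "set es = BW - set ws" "distinct es"
    using finite_distinct_list[of "BW - set ws"] finBW by auto
  have lws: "length ws = length ys + 2 * length cs" by (simp add: ws_def)
  have les: "length es = card BV - length ys - 2 * (card BG - length xs)"
    using es distinct_card[OF dw(1)] distinct_card[OF es(2)] BW(1) cardBW lws lcs
    by (simp add: card_Diff_subset)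
  define vs where "vs = ys @ concat (map (\<lambda>c. [B c, A c]) cs) @ es"
  have mvs: "mset vs = mset (ws @ es)" by (simp add: vs_def ws_def mset_interleave)
  then have set_vs: "set vs = BW"
    using es BW(1) mset_eq_setD[OF mvs] by auto
  have "distinct (ws @ es)" using dw es by auto
  then have dist_vs: "distinct vs" using mset_eq_imp_distinct_iff[OF mvs] by simp
  have "block_rel A B (xs @ cs @ []) vs (bs @ replicate (length cs) (Vertical_block 2) @
          replicate (length es) (Vertical_block 1))"
    unfolding vs_def
    by (intro block_rel_append rel block_rel_vertical_two block_rel_vertical_one)
  then have "block_rel A B (xs @ cs) vs (bs @ replicate (card BG - length xs) (Vertical_block 2) @
        replicate (card BV - length ys - 2 * (card BG - length xs)) (Vertical_block 1))"
    by (simp add: lcs les)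
  moreover have "distinct (xs @ cs)" "set (xs @ cs) = BX" using xs cs BX(1) by auto
  ultimately show ?thesis
    unfolding kronecker_realizable_def using BX(3) spanBX dist_vs set_vs BW(3) spanBW by metis
qed

section \<open>Transfer to modules\<close>

text \<open>A coordinate isomorphism from a subspace of a function space onto a module given by its
  carrier: the bridge between the type-based vector space theory and the module records of the
  definitions.\<close>

locale linear_model = vectorspace "class_ring :: complex ring" U
  for U :: "(complex, 'u) module" +
  fixes G :: "('a \<Rightarrow> complex) set" and \<Phi> :: "('a \<Rightarrow> complex) \<Rightarrow> 'u"
  assumes subspace: "fs.subspace G"
    and bij: "bij_betw \<Phi> G (carrier U)"
    and add: "x \<in> G \<Longrightarrow> y \<in> G \<Longrightarrow> \<Phi> (x + y) = \<Phi> x \<oplus>\<^bsub>U\<^esub> \<Phi> y"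
    and smult: "x \<in> G \<Longrightarrow> \<Phi> (fscale c x) = c \<odot>\<^bsub>U\<^esub> \<Phi> x"
begin

lemma closed: "x \<in> G \<Longrightarrow> \<Phi> x \<in> carrier U"
  using bij by (auto simp: bij_betw_def)

lemma inj: "inj_on \<Phi> G"
  using bij by (auto simp: bij_betw_def)

lemma zero: "\<Phi> 0 = \<zero>\<^bsub>U\<^esub>"
proof -
  have 0: "(0 :: 'a \<Rightarrow> complex) \<in> G" using subspace by (rule fs.subspace_0)
  have "\<Phi> 0 = \<Phi> 0 \<oplus>\<^bsub>U\<^esub> \<Phi> 0" using add[OF 0 0] by (simp only: add_0_left)
  then show ?thesis using closed[OF 0] by (metis add.r_cancel_one)
qed

lemma sum: "finite I \<Longrightarrow> (\<And>i. i \<in> I \<Longrightarrow> f i \<in> G) \<Longrightarrow> \<Phi> (\<Sum>i\<in>I. f i) = finsum U (\<lambda>i. \<Phi> (f i)) I"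
proof (induction I rule: finite_induct)
  case empty
  show ?case unfolding sum.empty finsum_empty by (rule zero)
next
  case (insert i I)
  have fi: "f i \<in> G" and fI: "\<And>j. j \<in> I \<Longrightarrow> f j \<in> G" using insert.prems by blast+
  have sI: "(\<Sum>i\<in>I. f i) \<in> G" using subspace fI by (rule fs.subspace_sum)
  have "finsum U (\<lambda>i. \<Phi> (f i)) (insert i I) = \<Phi> (f i) \<oplus>\<^bsub>U\<^esub> finsum U (\<lambda>i. \<Phi> (f i)) I"
    by (rule finsum_insert) (use insert.hyps closed fi fI in blast)+
  also have "\<dots> = \<Phi> (f i + (\<Sum>i\<in>I. f i))"
    using insert.IH[OF fI] add[OF fi sI] by metis
  finally show ?case unfolding sum.insert[OF insert.hyps] ..
qed

lemma linear_combination: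
  assumes "finite I" "\<And>i. i \<in> I \<Longrightarrow> f i \<in> G"
  shows "\<Phi> (\<Sum>i\<in>I. fscale (c i) (f i)) = finsum U (\<lambda>i. c i \<odot>\<^bsub>U\<^esub> \<Phi> (f i)) I"
proof -
  have "\<Phi> (\<Sum>i\<in>I. fscale (c i) (f i)) = finsum U (\<lambda>i. \<Phi> (fscale (c i) (f i))) I"
    by (rule sum) (use assms fs.subspace_scale[OF subspace] in blast)+
  also have "\<dots> = finsum U (\<lambda>i. c i \<odot>\<^bsub>U\<^esub> \<Phi> (f i)) I"
    by (rule finsum_cong') (use assms closed smult in \<open>auto simp: class_ring_simps\<close>)
  finally show ?thesis .
qed

lemma lincomb_image:
  assumes "finite S" "S \<subseteq> G"
  shows "lincomb a (\<Phi> ` S) = \<Phi> (\<Sum>v\<in>S. fscale (a (\<Phi> v)) v)"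
proof -
  have injS: "inj_on \<Phi> S" using inj assms inj_on_subset by blast
  have "lincomb a (\<Phi> ` S) = finsum U (\<lambda>v. a (\<Phi> v) \<odot>\<^bsub>U\<^esub> \<Phi> v) S"
    unfolding lincomb_def
    by (rule finsum_reindex) (use assms injS closed in \<open>auto simp: class_ring_simps\<close>)
  also have "\<dots> = \<Phi> (\<Sum>v\<in>S. fscale (a (\<Phi> v)) v)"
    by (rule linear_combination[symmetric]) (use assms in blast)+
  finally show ?thesis .
qed

text \<open>Both a linear dependence and a vector of the module are pulled back along the bijection
  \<Phi>; \<open>lincomb_image\<close> turns combinations in the module into sums of
  functions.\<close>

lemma ordered_basis_image:
  assumes "distinct us" "fs.independent (set us)" "fs.span (set us) = G"
  shows "ordered_basis U (map \<Phi> us)"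
proof -
  have sub: "set us \<subseteq> G" using assms(3) fs.span_superset by blast
  have injS: "inj_on \<Phi> (set us)" using inj sub inj_on_subset by blast
  have subU: "\<Phi> ` set us \<subseteq> carrier U" using sub closed by blast
  have "\<not> lin_dep (\<Phi> ` set us)"
  proof
    assume "lin_dep (\<Phi> ` set us)"
    then obtain A a v where A: "finite A" "A \<subseteq> \<Phi> ` set us" "lincomb a A = \<zero>\<^bsub>U\<^esub>" "v \<in> A" "a v \<noteq> 0"
      unfolding lin_dep_def by (auto simp: class_ring_simps)
    then obtain S where S: "S \<subseteq> set us" "A = \<Phi> ` S" by (metis subset_imageE)
    have finS: "finite S" "S \<subseteq> G" using S sub finite_subset[of S "set us"] by auto
    let ?s = "\<Sum>v\<in>S. fscale (a (\<Phi> v)) v"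
    have sG: "?s \<in> G" using finS subspace by (intro fs.subspace_sum fs.subspace_scale) auto
    have "\<Phi> ?s = \<Phi> 0" using A(3) S(2) lincomb_image[OF finS] zero by metis
    then have "?s = 0" using inj sG fs.subspace_0[OF subspace] by (meson inj_onD)
    moreover obtain w where w: "w \<in> S" "v = \<Phi> w" using A(4) S(2) by blast
    ultimately have "a (\<Phi> w) = 0"
      using fs.independentD[OF assms(2) finS(1) S(1), of "\<lambda>v. a (\<Phi> v)" w] by blast
    then show False using A(5) w by simp
  qed
  moreover have "span (\<Phi> ` set us) = carrier U"
  proof
    show "span (\<Phi> ` set us) \<subseteq> carrier U" using subU by (rule span_is_subset2)
    show "carrier U \<subseteq> span (\<Phi> ` set us)"
    proof
      fix y assume "y \<in> carrier U"
      then obtain x where x: "x \<in> G" "y = \<Phi> x" using bij by (auto simp: bij_betw_def)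
      then obtain u where u: "x = (\<Sum>v\<in>set us. fscale (u v) v)"
        using assms(3) unfolding fs.span_finite[OF finite_set] by blast
      let ?a = "\<lambda>z. u (the_inv_into (set us) \<Phi> z)"
      have "x = (\<Sum>v\<in>set us. fscale (?a (\<Phi> v)) v)"
        unfolding u by (rule sum.cong) (use injS in \<open>auto simp: the_inv_into_f_f\<close>)
      then have "y = lincomb ?a (\<Phi> ` set us)"
        using lincomb_image[OF finite_set sub, of ?a] x(2) by metis
      then show "y \<in> span (\<Phi> ` set us)"
        unfolding span_def by (fastforce simp: class_ring_simps)
    qed
  qed
  moreover have "distinct (map \<Phi> us)" using assms(1) injS by (simp add: distinct_map)
  ultimately show ?thesis using subU unfolding ordered_basis_def basis_def by simp
qed

lemma is_matrix_of_image:
  fixes \<phi> :: "('b \<Rightarrow> complex) \<Rightarrow> 'v"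
  assumes "matrix_rel us ys f M" "set ys \<subseteq> G" and f: "\<And>u. u \<in> set us \<Longrightarrow> g (\<phi> u) = \<Phi> (f u)"
  shows "is_matrix_of U' U (map \<phi> us) (map \<Phi> ys) g M"
  unfolding is_matrix_of_def
proof (intro conjI allI impI)
  show "M \<in> carrier_mat (length (map \<Phi> ys)) (length (map \<phi> us))"
    using assms(1) by (simp add: matrix_rel_def)
  fix j assume j: "j < length (map \<phi> us)"
  have "g (map \<phi> us ! j) = \<Phi> (f (us ! j))" using f j by simp
  also have "f (us ! j) = (\<Sum>i<length ys. fscale (M $$ (i, j)) (ys ! i))"
    using assms(1) j by (simp add: matrix_rel_def)
  also have "\<Phi> \<dots> = finsum U (\<lambda>i. M $$ (i, j) \<odot>\<^bsub>U\<^esub> \<Phi> (ys ! i)) {..<length ys}"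
    by (rule linear_combination) (use assms(2) in auto)
  also have "\<dots> = finsum U (\<lambda>i. M $$ (i, j) \<odot>\<^bsub>U\<^esub> map \<Phi> ys ! i) {..<length (map \<Phi> ys)}"
    by (rule finsum_cong') (use subsetD[OF assms(2) nth_mem] closed in \<open>auto simp: class_ring_simps\<close>)
  finally show "g (map \<phi> us ! j) =
    finsum U (\<lambda>i. M $$ (i, j) \<odot>\<^bsub>U\<^esub> map \<Phi> ys ! i) {..<length (map \<Phi> ys)}" .
qed

end

text \<open>By \<open>comm\<close> the isomorphisms \<Phi> and \<Psi> intertwine the pencil of
  \<open>A\<close> and \<open>B\<close> with that of \<open>f\<close> and \<open>g\<close>, so the
  images of the bases give the same matrices.\<close>

lemma has_kronecker_form_transfer:
  assumes U: "linear_model U G \<Phi>" and V: "linear_model V H \<Psi>"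
    and hom: "f \<in> module_hom class_ring U V" "g \<in> module_hom class_ring U V"
    and comm: "\<And>x. x \<in> G \<Longrightarrow> f (\<Phi> x) = \<Psi> (A x)" "\<And>x. x \<in> G \<Longrightarrow> g (\<Phi> x) = \<Psi> (B x)"
    and us: "distinct us" "fs.independent (set us)" "fs.span (set us) = G"
    and vs: "distinct vs" "fs.independent (set vs)" "fs.span (set vs) = H"
    and rel: "block_rel A B us vs bs"
    and pos: "\<And>b. b \<in> set bs \<Longrightarrow> block_size b \<ge> 1"
  shows "has_kronecker_form U V f g bs"
proof -
  interpret U: linear_model U G \<Phi> by (rule U)
  interpret V: linear_model V H \<Psi> by (rule V)
  have sub: "set us \<subseteq> G" "set vs \<subseteq> H" using us(3) vs(3) fs.span_superset by blast+
  show ?thesis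
    unfolding has_kronecker_form_def
  proof (intro conjI hom ballI pos exI)
    show "ordered_basis U (map \<Phi> us)" using us by (rule U.ordered_basis_image)
    show "ordered_basis V (map \<Psi> vs)" using vs by (rule V.ordered_basis_image)
    show "is_matrix_of U V (map \<Phi> us) (map \<Psi> vs) f (diag_block_mat (map (fst \<circ> block_pair) bs))"
      by (rule V.is_matrix_of_image[of _ _ A]) (use rel sub comm in \<open>auto simp: block_rel_def\<close>)
    show "is_matrix_of U V (map \<Phi> us) (map \<Psi> vs) g (diag_block_mat (map (snd \<circ> block_pair) bs))"
      by (rule V.is_matrix_of_image[of _ _ B]) (use rel sub comm in \<open>auto simp: block_rel_def\<close>)
  qed
qed

section \<open>Generic properties\<close>

lemma polynomial_functions_sum:
  "(\<And>i. i \<in> I \<Longrightarrow> f i \<in> polynomial_functions W) \<Longrightarrow> (\<lambda>x. \<Sum>i\<in>I. f i x) \<in> polynomial_functions W"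
proof (induction I rule: infinite_finite_induct)
  case (insert i I)
  then show ?case
    unfolding sum.insert[OF insert.hyps] by (intro polynomial_functions.add) blast+
qed (simp_all add: polynomial_functions.const)

lemma polynomial_functions_prod:
  "(\<And>i. i \<in> I \<Longrightarrow> f i \<in> polynomial_functions W) \<Longrightarrow> (\<lambda>x. \<Prod>i\<in>I. f i x) \<in> polynomial_functions W"
proof (induction I rule: infinite_finite_induct)
  case (insert i I)
  then show ?case
    unfolding prod.insert[OF insert.hyps] by (intro polynomial_functions.mult) blast+
qed (simp_all add: polynomial_functions.const)

lemma polynomial_functions_diff:
  assumes "f \<in> polynomial_functions W" "g \<in> polynomial_functions W"
  shows "(\<lambda>x. f x - g x) \<in> polynomial_functions W"
proof -
  have "(\<lambda>x. f x + (- 1) * g x) \<in> polynomial_functions W"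
    by (intro polynomial_functions.intros assms)
  then show ?thesis by simp
qed

lemma polynomial_functions_det:
  assumes "\<And>x. M x \<in> carrier_mat N N"
    and "\<And>i j. i < N \<Longrightarrow> j < N \<Longrightarrow> (\<lambda>x. M x $$ (i, j)) \<in> polynomial_functions W"
  shows "(\<lambda>x. det (M x)) \<in> polynomial_functions W"
proof -
  have less: "p i < N" if "p permutes {0..<N}" "i < N" for p i
    using permutes_in_image[OF that(1), of i] that(2) by simp
  have "(\<lambda>x. det (M x)) =
      (\<lambda>x. \<Sum>p | p permutes {0..<N}. signof p * (\<Prod>i = 0..<N. M x $$ (i, p i)))"
    by (rule ext) (rule det_def'[OF assms(1)])
  also have "\<dots> \<in> polynomial_functions W"
    by (intro polynomial_functions_sum polynomial_functions.mult polynomial_functions.const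
        polynomial_functions_prod assms(2)) (auto simp: less)
  finally show ?thesis .
qed

text \<open>Up to sign the entry is a minor, the determinant of a matrix made of entries of
  \<open>M x\<close>.\<close>

lemma polynomial_functions_adj_mat:
  assumes M: "\<And>x. M x \<in> carrier_mat N N"
    and poly: "\<And>i j. i < N \<Longrightarrow> j < N \<Longrightarrow> (\<lambda>x. M x $$ (i, j)) \<in> polynomial_functions W"
    and ij: "i < N" "j < N"
  shows "(\<lambda>x. adj_mat (M x) $$ (i, j)) \<in> polynomial_functions W"
proof -
  have del: "mat_delete (M x) j i \<in> carrier_mat (N - 1) (N - 1)" for x
    using M[of x] by (rule mat_delete_carrier)
  have "(\<lambda>x. det (mat_delete (M x) j i)) \<in> polynomial_functions W"
  proof (rule polynomial_functions_det[OF del])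
    fix k l assume kl: "k < N - 1" "l < N - 1"
    have "(\<lambda>x. mat_delete (M x) j i $$ (k, l)) =
        (\<lambda>x. M x $$ (if k < j then k else Suc k, if l < i then l else Suc l))"
      using kl M[THEN carrier_matD(1)] M[THEN carrier_matD(2)] by (simp add: mat_delete_def)
    also have "\<dots> \<in> polynomial_functions W" using kl ij by (intro poly) auto
    finally show "(\<lambda>x. mat_delete (M x) j i $$ (k, l)) \<in> polynomial_functions W" .
  qed
  then have "(\<lambda>x. (- 1) ^ (j + i) * det (mat_delete (M x) j i)) \<in> polynomial_functions W"
    by (intro polynomial_functions.mult polynomial_functions.const)
  moreover have "adj_mat (M x) $$ (i, j) = (- 1) ^ (j + i) * det (mat_delete (M x) j i)" for x
    using M[of x] ij by (simp add: adj_mat_def cofactor_def)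
  ultimately show ?thesis by simp
qed

lemma polynomial_functions_entry:
  assumes "i < n" "j < m"
  shows "(\<lambda>x. fst x $$ (i, j)) \<in> polynomial_functions
           (direct_sum (module_mat TYPE(complex) n m) (module_mat TYPE(complex) n m))"
    and "(\<lambda>x. snd x $$ (i, j)) \<in> polynomial_functions
           (direct_sum (module_mat TYPE(complex) n m) (module_mat TYPE(complex) n m))"
  by (rule polynomial_functions.linear,
      use assms in \<open>auto simp: module_hom_def direct_sum_def scalar_module_def module_mat_simps
        class_ring_simps\<close>)+

section \<open>Linear systems with polynomial coefficients\<close>

text \<open>For the Gram matrix K of M, K v = 0 makes the squared norm of M v vanish, so v = 0 by
  injectivity. The conjugates matter: over the complex numbers M^T M can be singular for an
  injective M.\<close>

lemma gram_det_nonzero: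
  fixes M :: "'e \<Rightarrow> nat \<Rightarrow> complex"
  assumes "finite E"
    and inj: "\<And>v a. (\<And>e. e \<in> E \<Longrightarrow> (\<Sum>a<N. M e a * v a) = 0) \<Longrightarrow> a < N \<Longrightarrow> v a = 0"
  shows "det (mat N N (\<lambda>(a, b). \<Sum>e\<in>E. cnj (M e a) * M e b)) \<noteq> 0"
proof
  let ?K = "mat N N (\<lambda>(a, b). \<Sum>e\<in>E. cnj (M e a) * M e b)"
  assume "det ?K = 0"
  then obtain v where v: "v \<in> carrier_vec N" "v \<noteq> 0\<^sub>v N" "?K *\<^sub>v v = 0\<^sub>v N"
    using det_0_iff_vec_prod_zero[of ?K N] by auto
  define w where "w e = (\<Sum>b<N. M e b * v $ b)" for e
  have row: "(\<Sum>e\<in>E. cnj (M e a) * w e) = 0" if "a < N" for a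
  proof -
    have "(\<Sum>e\<in>E. cnj (M e a) * w e) = (\<Sum>e\<in>E. \<Sum>b<N. cnj (M e a) * M e b * v $ b)"
      by (simp add: w_def sum_distrib_left mult.assoc)
    also have "\<dots> = (\<Sum>b<N. (\<Sum>e\<in>E. cnj (M e a) * M e b) * v $ b)"
      by (subst sum.swap) (simp add: sum_distrib_right)
    also have "\<dots> = (?K *\<^sub>v v) $ a"
      using that v(1) by (simp add: scalar_prod_def lessThan_atLeast0)
    finally show ?thesis using v(3) that by simp
  qed
  have "(\<Sum>e\<in>E. cnj (w e) * w e) = (\<Sum>e\<in>E. \<Sum>a<N. cnj (v $ a) * (cnj (M e a) * w e))"
  proof (rule sum.cong[OF refl])
    fix e
    have "cnj (w e) = (\<Sum>a<N. cnj (v $ a) * cnj (M e a))" by (simp add: w_def mult.commute)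
    then show "cnj (w e) * w e = (\<Sum>a<N. cnj (v $ a) * (cnj (M e a) * w e))"
      by (simp add: sum_distrib_right mult.assoc)
  qed
  also have "\<dots> = (\<Sum>a<N. cnj (v $ a) * (\<Sum>e\<in>E. cnj (M e a) * w e))"
    by (subst sum.swap) (simp add: sum_distrib_left)
  also have "\<dots> = 0" using row by simp
  finally have "complex_of_real (\<Sum>e\<in>E. (cmod (w e))\<^sup>2) = 0"
    by (simp only: of_real_sum complex_norm_square mult.commute)
  then have "(\<Sum>e\<in>E. (cmod (w e))\<^sup>2) = 0" by (simp only: of_real_eq_0_iff)
  then have w0: "w e = 0" if "e \<in> E" for e
    using that assms(1) by (simp add: sum_nonneg_eq_0_iff)
  have "v $ a = 0" if "a < N" for a
    by (rule inj) (use w0 that in \<open>auto simp: w_def\<close>)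
  then show False using v(1,2) by auto
qed

text \<open>With \<open>K x = L x (L x0)\<^sup>*\<close>, a matrix invertible at \<open>x0\<close>, the solution is Cramer's rule without denominators:
  \<open>det (K x) z0 - (L x0)\<^sup>* adj (K x) (L x) z0\<close>, normalised at \<open>x0\<close>.\<close>

lemma polynomial_kernel:
  fixes L :: "'w \<Rightarrow> 'e \<Rightarrow> 'i \<Rightarrow> complex"
  assumes fin: "finite E" "finite I"
    and poly: "\<And>e i. e \<in> E \<Longrightarrow> i \<in> I \<Longrightarrow> (\<lambda>x. L x e i) \<in> polynomial_functions W"
    and dual: "\<And>c e. (\<And>i. i \<in> I \<Longrightarrow> (\<Sum>e\<in>E. c e * L x0 e i) = 0) \<Longrightarrow> e \<in> E \<Longrightarrow> c e = 0"
    and z0: "\<And>e. e \<in> E \<Longrightarrow> (\<Sum>i\<in>I. L x0 e i * z0 i) = 0"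
  obtains z where "\<And>i. i \<in> I \<Longrightarrow> (\<lambda>x. z x i) \<in> polynomial_functions W"
    and "\<And>x e. e \<in> E \<Longrightarrow> (\<Sum>i\<in>I. L x e i * z x i) = 0"
    and "\<And>i. z x0 i = z0 i"
proof -
  obtain g where g: "bij_betw g {..<card E} E"
    using ex_bij_betw_nat_finite[OF fin(1)] by (auto simp: lessThan_atLeast0)
  define N where "N = card E"
  have gE: "g a \<in> E" if "a < N" for a using g that by (auto simp: bij_betw_def N_def)
  have reE: "(\<Sum>e\<in>E. h e) = (\<Sum>a<N. h (g a))" for h :: "'e \<Rightarrow> complex"
    unfolding N_def by (rule sum.reindex_bij_betw[OF g, symmetric])
  define K where "K x = mat N N (\<lambda>(a, b). \<Sum>i\<in>I. L x (g a) i * cnj (L x0 (g b) i))" for x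
  have K: "K x \<in> carrier_mat N N" for x by (simp add: K_def)
  have Kpoly: "(\<lambda>x. K x $$ (a, b)) \<in> polynomial_functions W" if "a < N" "b < N" for a b
    unfolding K_def using that
    by (auto intro!: polynomial_functions_sum polynomial_functions.mult polynomial_functions.const poly gE)
  \<comment> \<open>The Gram lemma is applied to the adjoint of \<open>L x0\<close>, whose
    injectivity is the independence of rows in \<open>dual\<close>; hence the double
    conjugates.\<close>
  have "det (mat N N (\<lambda>(a, b). \<Sum>i\<in>I. cnj (cnj (L x0 (g a) i)) * cnj (L x0 (g b) i))) \<noteq> 0"
  proof (rule gram_det_nonzero[OF fin(2)])
    fix v a assume v: "\<And>i. i \<in> I \<Longrightarrow> (\<Sum>a<N. cnj (L x0 (g a) i) * v a) = 0" and a: "a < N"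
    let ?c = "\<lambda>e. cnj (v (the_inv_into {..<N} g e))"
    have inv: "the_inv_into {..<N} g (g a) = a" if "a < N" for a
      using g that by (auto simp: bij_betw_def N_def the_inv_into_f_f)
    have "?c (g a) = 0"
    proof (rule dual)
      fix i assume "i \<in> I"
      have "(\<Sum>e\<in>E. ?c e * L x0 e i) = (\<Sum>a<N. cnj (cnj (L x0 (g a) i) * v a))"
        unfolding reE by (rule sum.cong) (auto simp: inv)
      also have "\<dots> = cnj (\<Sum>a<N. cnj (L x0 (g a) i) * v a)" by simp
      finally show "(\<Sum>e\<in>E. ?c e * L x0 e i) = 0" using v[OF \<open>i \<in> I\<close>] by simp
    qed (use a gE in auto)
    then show "v a = 0" using inv a by simp
  qed
  then have det0: "det (K x0) \<noteq> 0" by (simp add: K_def)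
  define l where "l x a = (\<Sum>i\<in>I. L x (g a) i * z0 i)" for x a
  define y where "y x b = (\<Sum>a<N. adj_mat (K x) $$ (b, a) * l x a)" for x b
  define z where "z x i = inverse (det (K x0)) *
     (det (K x) * z0 i - (\<Sum>b<N. cnj (L x0 (g b) i) * y x b))" for x i
  \<comment> \<open>From K adj(K) = det K times the identity, valid at every \<open>x\<close>,
    including those where \<open>K x\<close> is singular.\<close>
  have Ky: "(\<Sum>b<N. K x $$ (a, b) * y x b) = det (K x) * l x a" if a: "a < N" for x a
  proof -
    have "(\<Sum>b<N. K x $$ (a, b) * y x b) = (\<Sum>b<N. \<Sum>c<N. K x $$ (a, b) * adj_mat (K x) $$ (b, c) * l x c)"
      by (simp add: y_def sum_distrib_left mult.assoc)
    also have "\<dots> = (\<Sum>c<N. (\<Sum>b<N. K x $$ (a, b) * adj_mat (K x) $$ (b, c)) * l x c)"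
      by (subst sum.swap) (simp add: sum_distrib_right)
    also have "\<dots> = (\<Sum>c<N. (K x * adj_mat (K x)) $$ (a, c) * l x c)"
      by (rule sum.cong) (use a K[of x] adj_mat(1)[OF K[of x]] in
          \<open>auto simp: scalar_prod_def lessThan_atLeast0\<close>)
    also have "\<dots> = (\<Sum>c<N. (if a = c then det (K x) else 0) * l x c)"
      by (rule sum.cong) (use a adj_mat(2)[OF K[of x]] in auto)
    also have "\<dots> = det (K x) * l x a" using a by (simp add: if_distrib[of "\<lambda>z. z * _"] cong: if_cong)
    finally show ?thesis .
  qed
  show ?thesis
  proof
    fix i assume i: "i \<in> I"
    show "(\<lambda>x. z x i) \<in> polynomial_functions W"
      unfolding z_def y_def l_def
      by (intro polynomial_functions_diff polynomial_functions_sum polynomial_functions.mult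
          polynomial_functions.const poly gE i polynomial_functions_det[OF K]
          polynomial_functions_adj_mat[OF K] Kpoly) auto
  next
    fix x e assume "e \<in> E"
    then obtain a where a: "a < N" "e = g a" using g by (auto simp: bij_betw_def N_def)
    have "(\<Sum>i\<in>I. L x e i * (\<Sum>b<N. cnj (L x0 (g b) i) * y x b)) =
        (\<Sum>i\<in>I. \<Sum>b<N. L x e i * cnj (L x0 (g b) i) * y x b)"
      by (simp add: sum_distrib_left mult.assoc)
    also have "\<dots> = (\<Sum>b<N. K x $$ (a, b) * y x b)"
      by (subst sum.swap) (use a in \<open>simp add: K_def sum_distrib_right\<close>)
    also have "\<dots> = (\<Sum>i\<in>I. L x e i * (det (K x) * z0 i))"
      unfolding Ky[OF a(1)] l_def a(2) by (simp add: sum_distrib_left mult_ac)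
    finally have "(\<Sum>i\<in>I. L x e i * (det (K x) * z0 i - (\<Sum>b<N. cnj (L x0 (g b) i) * y x b))) = 0"
      by (simp add: right_diff_distrib sum_subtractf)
    then have "inverse (det (K x0)) *
       (\<Sum>i\<in>I. L x e i * (det (K x) * z0 i - (\<Sum>b<N. cnj (L x0 (g b) i) * y x b))) = 0" by simp
    then show "(\<Sum>i\<in>I. L x e i * z x i) = 0"
      unfolding z_def by (simp only: sum_distrib_left mult.left_commute)
  next
    fix i
    \<comment> \<open>At \<open>x0\<close> the vector \<open>z0\<close> solves the system, so the
      correction term vanishes, and the factor \<open>inverse (det (K x0))\<close> returns
      \<open>z0\<close> itself.\<close>
    have "l x0 a = 0" if "a < N" for a using z0 gE that by (simp add: l_def)
    then have "y x0 b = 0" for b by (simp add: y_def)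
    then show "z x0 i = z0 i" using det0 by (simp add: z_def)
  qed
qed

text \<open>The polynomial is the determinant of the adjoint of \<open>L x0\<close> times
  \<open>L x\<close>. At \<open>x0\<close> this product is a Gram matrix, hence invertible; wherever
  it is invertible, \<open>L x\<close> has trivial kernel.\<close>

lemma polynomial_injectivity:
  fixes L :: "'w \<Rightarrow> 'e \<Rightarrow> 'i \<Rightarrow> complex"
  assumes fin: "finite E" "finite I"
    and poly: "\<And>e i. e \<in> E \<Longrightarrow> i \<in> I \<Longrightarrow> (\<lambda>x. L x e i) \<in> polynomial_functions W"
    and inj: "\<And>z i. (\<And>e. e \<in> E \<Longrightarrow> (\<Sum>i\<in>I. L x0 e i * z i) = 0) \<Longrightarrow> i \<in> I \<Longrightarrow> z i = 0"
  obtains p where "p \<in> polynomial_functions W" "p x0 \<noteq> 0"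
    and "\<And>x z i. p x \<noteq> 0 \<Longrightarrow> (\<And>e. e \<in> E \<Longrightarrow> (\<Sum>i\<in>I. L x e i * z i) = 0) \<Longrightarrow> i \<in> I \<Longrightarrow> z i = 0"
proof -
  obtain g where g: "bij_betw g {..<card I} I"
    using ex_bij_betw_nat_finite[OF fin(2)] by (auto simp: lessThan_atLeast0)
  define N where "N = card I"
  have gI: "g a \<in> I" if "a < N" for a using g that by (auto simp: bij_betw_def N_def)
  have reI: "(\<Sum>i\<in>I. h i) = (\<Sum>a<N. h (g a))" for h :: "'i \<Rightarrow> complex"
    unfolding N_def by (rule sum.reindex_bij_betw[OF g, symmetric])
  have inv: "the_inv_into {..<N} g (g a) = a" if "a < N" for a
    using g that by (auto simp: bij_betw_def N_def the_inv_into_f_f)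
  define K where "K x = mat N N (\<lambda>(a, b). \<Sum>e\<in>E. cnj (L x0 e (g a)) * L x e (g b))" for x
  have K: "K x \<in> carrier_mat N N" for x by (simp add: K_def)
  show ?thesis
  proof
    have Kpoly: "(\<lambda>x. K x $$ (a, b)) \<in> polynomial_functions W" if "a < N" "b < N" for a b
      unfolding K_def using that
      by (auto intro!: polynomial_functions_sum polynomial_functions.mult polynomial_functions.const poly gI)
    show "(\<lambda>x. det (K x)) \<in> polynomial_functions W"
      by (rule polynomial_functions_det[OF K Kpoly])
    show "det (K x0) \<noteq> 0"
      unfolding K_def
    proof (rule gram_det_nonzero[OF fin(1)])
      fix v a assume v: "\<And>e. e \<in> E \<Longrightarrow> (\<Sum>a<N. L x0 e (g a) * v a) = 0" and a: "a < N"
      let ?z = "\<lambda>i. v (the_inv_into {..<N} g i)"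
      have "?z (g a) = 0"
      proof (rule inj)
        fix e assume "e \<in> E"
        have "(\<Sum>i\<in>I. L x0 e i * ?z i) = (\<Sum>a<N. L x0 e (g a) * v a)"
          unfolding reI by (rule sum.cong) (auto simp: inv)
        then show "(\<Sum>i\<in>I. L x0 e i * ?z i) = 0" using v[OF \<open>e \<in> E\<close>] by simp
      qed (use a gI in auto)
      then show "v a = 0" using inv a by simp
    qed
    fix x z i assume det: "det (K x) \<noteq> 0" and z: "\<And>e. e \<in> E \<Longrightarrow> (\<Sum>i\<in>I. L x e i * z i) = 0" and i: "i \<in> I"
    let ?v = "vec N (\<lambda>a. z (g a))"
    have "K x *\<^sub>v ?v = 0\<^sub>v N"
    proof (rule eq_vecI)
      fix a assume "a < dim_vec (0\<^sub>v N :: complex vec)"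
      then have a: "a < N" by simp
      have "(K x *\<^sub>v ?v) $ a = (\<Sum>b<N. (\<Sum>e\<in>E. cnj (L x0 e (g a)) * L x e (g b)) * z (g b))"
        using a by (simp add: K_def scalar_prod_def lessThan_atLeast0)
      also have "\<dots> = (\<Sum>b<N. \<Sum>e\<in>E. cnj (L x0 e (g a)) * (L x e (g b) * z (g b)))"
        by (simp add: sum_distrib_right mult.assoc)
      also have "\<dots> = (\<Sum>e\<in>E. cnj (L x0 e (g a)) * (\<Sum>b<N. L x e (g b) * z (g b)))"
        by (subst sum.swap) (simp add: sum_distrib_left)
      also have "\<dots> = 0" using z unfolding reI by simp
      finally show "(K x *\<^sub>v ?v) $ a = 0\<^sub>v N $ a" using a by simp
    qed (simp add: K_def)
    then have "?v = 0\<^sub>v N" using det det_0_iff_vec_prod_zero[OF K[of x]] by (metis vec_carrier)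
    moreover obtain a where "a < N" "i = g a" using g i by (auto simp: bij_betw_def N_def)
    ultimately show "z i = 0" by (metis index_vec index_zero_vec(1))
  qed
qed

text \<open>The open set is the non-vanishing locus of a single polynomial, and \<open>x0\<close>
  shows that it is non-empty.\<close>

lemma has_JK_invariantsI:
  assumes "p \<in> polynomial_functions (direct_sum V V)"
    and "x0 \<in> carrier (direct_sum V V)" "p x0 \<noteq> 0"
    and "\<And>a b. a \<in> carrier V \<Longrightarrow> b \<in> carrier V \<Longrightarrow> p (a, b) \<noteq> 0 \<Longrightarrow>
           has_algebraic_type G V (\<lambda>\<xi>. \<rho> \<xi> a) (\<lambda>\<xi>. \<rho> \<xi> b) T"
  shows "has_JK_invariants G V \<rho> T"
  unfolding has_JK_invariants_def
proof (intro exI conjI)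
  let ?S = "{x \<in> carrier (direct_sum V V). \<exists>p\<in>{p}. p x \<noteq> 0}"
  show "zariski_open (direct_sum V V) ?S"
    unfolding zariski_open_def using assms(1) by blast
  show "?S \<noteq> {}" using assms(2,3) by blast
  show "\<forall>(a, b)\<in>?S. has_algebraic_type G V (\<lambda>\<xi>. \<rho> \<xi> a) (\<lambda>\<xi>. \<rho> \<xi> b) T"
    using assms(4) by (auto simp: direct_sum_def)
qed

section \<open>Matrices and bilinear forms as functions\<close>

text \<open>Extension by zero puts matrices of all sizes into one function space, where
  \<open>mat_space n m\<close> is a subspace.\<close>

definition entries :: "complex mat \<Rightarrow> nat \<times> nat \<Rightarrow> complex" where
  "entries M = (\<lambda>(i, j). if i < dim_row M \<and> j < dim_col M then M $$ (i, j) else 0)"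

definition mat_space :: "nat \<Rightarrow> nat \<Rightarrow> (nat \<times> nat \<Rightarrow> complex) set" where
  "mat_space n m = {f. \<forall>i j. \<not> (i < n \<and> j < m) \<longrightarrow> f (i, j) = 0}"

definition form_space :: "nat \<Rightarrow> int \<Rightarrow> (nat \<times> nat \<Rightarrow> complex) set" where
  "form_space n \<epsilon> = {f \<in> mat_space n n. \<forall>i j. f (j, i) = of_int \<epsilon> * f (i, j)}"

text \<open>The positions of the free entries of a form in \<open>form_space n \<epsilon>\<close>;
  the diagonal of a skew form vanishes. The same set later indexes the unordered pairs of residue
  classes.\<close>

definition triangle :: "nat \<Rightarrow> int \<Rightarrow> (nat \<times> nat) set" where
  "triangle n \<epsilon> = {(i, j). i < n \<and> (j < i \<or> j = i \<and> \<epsilon> = 1)}"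

definition right_mult :: "nat \<Rightarrow> nat \<Rightarrow> complex mat \<Rightarrow> (nat \<times> nat \<Rightarrow> complex) \<Rightarrow> nat \<times> nat \<Rightarrow> complex" where
  "right_mult n m A f = entries (mat n n f * A)"

lemma mat_entries: "M \<in> carrier_mat n m \<Longrightarrow> mat n m (entries M) = M"
  by (intro eq_matI) (auto simp: entries_def)

lemma entries_mat: "f \<in> mat_space n m \<Longrightarrow> entries (mat n m f) = f"
  by (rule ext) (auto simp: entries_def mat_space_def)

lemma entries_in_mat_space: "M \<in> carrier_mat n m \<Longrightarrow> entries M \<in> mat_space n m"
  by (auto simp: entries_def mat_space_def)

lemma subspace_mat_space: "fs.subspace (mat_space n m)"
  by (auto simp: fs.subspace_def mat_space_def)

lemma form_space_sym: "f \<in> form_space n \<epsilon> \<Longrightarrow> f (j, i) = of_int \<epsilon> * f (i, j)"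
  unfolding form_space_def by blast

lemma form_space_subset: "form_space n \<epsilon> \<subseteq> mat_space n n"
  unfolding form_space_def by blast

lemma form_spaceI:
  "f \<in> mat_space n n \<Longrightarrow> (\<And>i j. f (j, i) = of_int \<epsilon> * f (i, j)) \<Longrightarrow> f \<in> form_space n \<epsilon>"
  unfolding form_space_def by blast

lemma subspace_form_space: "fs.subspace (form_space n \<epsilon>)"
proof (rule fs.subspaceI)
  show "0 \<in> form_space n \<epsilon>" by (simp add: form_space_def mat_space_def)
next
  fix f g assume fg: "f \<in> form_space n \<epsilon>" "g \<in> form_space n \<epsilon>"
  have "(f + g) (j, i) = of_int \<epsilon> * (f + g) (i, j)" for i j
    unfolding plus_fun_apply form_space_sym[OF fg(1), of j i] form_space_sym[OF fg(2), of j i]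
    by (rule distrib_left[symmetric])
  then show "f + g \<in> form_space n \<epsilon>"
    using fg form_space_subset fs.subspace_add[OF subspace_mat_space] by (intro form_spaceI) blast
next
  fix f c assume f: "f \<in> form_space n \<epsilon>"
  have "fscale c f (j, i) = of_int \<epsilon> * fscale c f (i, j)" for i j
    unfolding fscale_apply form_space_sym[OF f, of j i] by (rule mult.left_commute)
  then show "fscale c f \<in> form_space n \<epsilon>"
    using f form_space_subset fs.subspace_scale[OF subspace_mat_space] by (intro form_spaceI) blast
qed

lemma mat_space_basis:
  "\<exists>B. finite B \<and> fs.independent B \<and> fs.span B = mat_space n m \<and> card B = n * m"
proof -
  have "\<exists>B. finite B \<and> fs.independent B \<and> fs.span B = mat_space n m \<and> card B = card ({..<n} \<times> {..<m})"
  proof (rule dual_family_dim[where b = "\<lambda>x y. if x = y then 1 else 0" and pos = id])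
    fix f assume f: "f \<in> mat_space n m" and 0: "\<And>x. x \<in> {..<n} \<times> {..<m} \<Longrightarrow> f (id x) = 0"
    have "f (i, j) = 0" for i j using f 0[of "(i, j)"] by (auto simp: mat_space_def)
    then show "f = 0" by (intro ext) auto
  next
    show "fs.subspace (mat_space n m)" by (rule subspace_mat_space)
  qed (auto simp: mat_space_def)
  then show ?thesis by (simp add: card_cartesian_product)
qed

lemma finite_triangle [simp]: "finite (triangle n \<epsilon>)"
proof (rule finite_subset)
  show "triangle n \<epsilon> \<subseteq> {..<n} \<times> {..<n}" by (auto simp: triangle_def)
qed simp

text \<open>A new last row adds \<open>n\<close> positions, or \<open>n + 1\<close> with the
  diagonal. Doubling avoids integer division.\<close>

lemma card_triangle:
  assumes "\<epsilon> = 1 \<or> \<epsilon> = -1"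
  shows "2 * int (card (triangle n \<epsilon>)) = int n * (int n + \<epsilon>)"
proof (induction n)
  case 0
  then show ?case by (simp add: triangle_def)
next
  case (Suc n)
  let ?R = "if \<epsilon> = 1 then {..n} else {..<n}"
  have split: "triangle (Suc n) \<epsilon> = triangle n \<epsilon> \<union> {n} \<times> ?R"
    by (auto simp: triangle_def less_Suc_eq)
  have "card (triangle (Suc n) \<epsilon>) = card (triangle n \<epsilon>) + card ({n} \<times> ?R)"
    unfolding split
  proof (rule card_Un_disjoint)
    show "triangle n \<epsilon> \<inter> {n} \<times> ?R = {}" by (auto simp: triangle_def)
  qed auto
  then show ?case using Suc assms by (auto simp: card_cartesian_product algebra_simps)
qed

lemma form_space_basis:
  assumes \<epsilon>: "\<epsilon> = 1 \<or> \<epsilon> = -1"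
  shows "\<exists>B. finite B \<and> fs.independent B \<and> fs.span B = form_space n \<epsilon> \<and>
           2 * int (card B) = int n * (int n + \<epsilon>)"
proof -
  \<comment> \<open>For i = j the first branch decides, so a diagonal unit has entry 1; this occurs
    only for \<epsilon> = 1.\<close>
  let ?b = "\<lambda>(i, j) y. if y = (i, j) then 1 else if y = (j, i) then of_int \<epsilon> else (0 :: complex)"
  have "\<exists>B. finite B \<and> fs.independent B \<and> fs.span B = form_space n \<epsilon> \<and> card B = card (triangle n \<epsilon>)"
  proof (rule dual_family_dim[where b = ?b and pos = id])
    fix f assume f: "f \<in> form_space n \<epsilon>" and 0: "\<And>x. x \<in> triangle n \<epsilon> \<Longrightarrow> f (id x) = 0"
    note sym = form_space_sym[OF f]
    have "f (i, j) = 0" for i j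
    proof (cases "i < n \<and> j < n")
      case True
      then consider "(i, j) \<in> triangle n \<epsilon>" | "(j, i) \<in> triangle n \<epsilon>" | "i = j" "\<epsilon> = -1"
        using \<epsilon> by (fastforce simp: triangle_def)
      then show ?thesis
      proof cases
        case 2
        then show ?thesis using 0[of "(j, i)"] sym[of i j] by simp
      next
        case 3
        then show ?thesis using sym[of i i] by simp
      next
        case 1
        then show ?thesis using 0[of "(i, j)"] by simp
      qed
    next
      case False
      then show ?thesis using f form_space_subset unfolding mat_space_def by blast
    qed
    then show "f = 0" by (intro ext) auto
  next
    show "fs.subspace (form_space n \<epsilon>)" by (rule subspace_form_space)
  next
    fix x assume x: "x \<in> triangle n \<epsilon>"
    show "?b x \<in> form_space n \<epsilon>"
      by (rule form_spaceI) (use x \<epsilon> in \<open>auto simp: mat_space_def triangle_def\<close>)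
  next
    show "finite (triangle n \<epsilon>)" by (rule finite_triangle)
  qed (auto simp: triangle_def split: if_splits)
  then show ?thesis using card_triangle[OF \<epsilon>, of n] by metis
qed

lemma mat_add_fun: "mat n m (f + g) = mat n m f + mat n m g" for f g :: "nat \<times> nat \<Rightarrow> complex"
  by (intro eq_matI) auto

lemma mat_fscale: "mat n m (fscale c f) = c \<cdot>\<^sub>m mat n m f"
  by (intro eq_matI) auto

lemma entries_add: "M \<in> carrier_mat n m \<Longrightarrow> N \<in> carrier_mat n m \<Longrightarrow> entries (M + N) = entries M + entries N"
  by (auto simp: entries_def fun_eq_iff)

lemma entries_smult: "entries (c \<cdot>\<^sub>m M) = fscale c (entries M)"
  by (auto simp: entries_def fun_eq_iff)

lemma linear_right_mult:
  assumes "A \<in> carrier_mat n m"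
  shows "Vector_Spaces.linear fscale fscale (right_mult n m A)"
proof (intro_locales, unfold_locales)
  fix f g :: "nat \<times> nat \<Rightarrow> complex" and c
  have car: "mat n n f * A \<in> carrier_mat n m" for f using assms by auto
  show "right_mult n m A (f + g) = right_mult n m A f + right_mult n m A g"
    unfolding right_mult_def mat_add_fun
    using assms by (subst add_mult_distrib_mat[of _ n n]) (auto intro: entries_add[OF car car])
  show "right_mult n m A (fscale c f) = fscale c (right_mult n m A f)"
    unfolding right_mult_def mat_fscale
    using assms by (subst mult_smult_assoc_mat[of _ n n]) (auto simp: entries_smult)
qed

lemma right_mult_in_mat_space: "A \<in> carrier_mat n m \<Longrightarrow> right_mult n m A f \<in> mat_space n m"
  unfolding right_mult_def by (intro entries_in_mat_space) auto

lemma sandwich_cancel: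
  fixes M :: "complex mat"
  assumes "P \<in> carrier_mat n n" "P' \<in> carrier_mat n n" "P' * P = 1\<^sub>m n"
    and "Q \<in> carrier_mat m m" "Q' \<in> carrier_mat m m" "Q * Q' = 1\<^sub>m m"
    and "M \<in> carrier_mat n m"
  shows "P' * (P * M * Q) * Q' = M"
proof -
  have MQ: "M * Q \<in> carrier_mat n m" using assms by auto
  have "P' * (P * M * Q) = P' * (P * (M * Q))" using assms assoc_mult_mat[of P n n M m Q m] by simp
  also have "\<dots> = P' * P * (M * Q)" by (rule assoc_mult_mat[OF assms(2,1) MQ, symmetric])
  also have "\<dots> = M * Q" unfolding assms(3) by (rule left_mult_one_mat[OF MQ])
  finally have "P' * (P * M * Q) * Q' = M * Q * Q'" by simp
  also have "\<dots> = M * (Q * Q')" using assms by (intro assoc_mult_mat)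
  finally show ?thesis using assms by simp
qed

text \<open>One family of coordinates serves both the source of the pencil, with m = n, and its
  target; the inverse sends M to \<open>P' * M * Q'\<close>.\<close>

lemma linear_model_mat:
  assumes P: "P \<in> carrier_mat n n" "P' \<in> carrier_mat n n" "P * P' = 1\<^sub>m n" "P' * P = 1\<^sub>m n"
    and Q: "Q \<in> carrier_mat m m" "Q' \<in> carrier_mat m m" "Q * Q' = 1\<^sub>m m" "Q' * Q = 1\<^sub>m m"
  shows "linear_model (module_mat TYPE(complex) n m) (mat_space n m) (\<lambda>f. P * mat n m f * Q)"
proof -
  interpret V: vectorspace "class_ring :: complex ring" "module_mat TYPE(complex) n m"
    by (rule matrix_vs)
  show ?thesis
  proof (unfold_locales, goal_cases)
    case 1
    show ?case by (rule subspace_mat_space)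
  next
    case 2
    show ?case
    proof (rule bij_betw_byWitness[where f' = "\<lambda>M. entries (P' * M * Q')"])
      have "P' * (P * M * Q) * Q' = M" if "M \<in> carrier_mat n m" for M
        using P(1,2,4) Q(1-3) that by (rule sandwich_cancel)
      then show "\<forall>f\<in>mat_space n m. entries (P' * (P * mat n m f * Q) * Q') = f"
        by (simp add: entries_mat)
      have "P * (P' * M * Q') * Q = M" if "M \<in> carrier_mat n m" for M
        using P(2,1,3) Q(2,1,4) that by (rule sandwich_cancel)
      moreover have "mat n m (entries (P' * M * Q')) = P' * M * Q'" if "M \<in> carrier_mat n m" for M
        using P Q that by (intro mat_entries) auto
      ultimately show "\<forall>M\<in>carrier (module_mat TYPE(complex) n m). P * mat n m (entries (P' * M * Q')) * Q = M"
        by (simp add: module_mat_simps)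
      show "(\<lambda>f. P * mat n m f * Q) ` mat_space n m \<subseteq> carrier (module_mat TYPE(complex) n m)"
        using P Q by (auto simp: module_mat_simps)
      show "(\<lambda>M. entries (P' * M * Q')) ` carrier (module_mat TYPE(complex) n m) \<subseteq> mat_space n m"
        using P Q by (auto simp: module_mat_simps intro!: entries_in_mat_space)
    qed
  next
    case (3 f g)
    show ?case
      unfolding mat_add_fun module_mat_simps
      using P Q by (simp add: mult_add_distrib_mat[of _ n n _ m] add_mult_distrib_mat[of _ n m _ _ m])
  next
    case (4 f c)
    show ?case
      unfolding mat_fscale module_mat_simps
      using P Q by (simp add: mult_smult_distrib[of _ n n _ m] mult_smult_assoc_mat[of _ n m _ m])
  qed
qed

lemma linear_model_restrict:
  assumes "linear_model V H \<Psi>" "fs.subspace G" "G \<subseteq> H" "C = \<Psi> ` G"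
  shows "linear_model (V\<lparr>carrier := C\<rparr>) G \<Psi>"
proof -
  interpret V: linear_model V H \<Psi> by (rule assms(1))
  have G: "0 \<in> G" "\<And>x y. x \<in> G \<Longrightarrow> y \<in> G \<Longrightarrow> x + y \<in> G" "\<And>x c. x \<in> G \<Longrightarrow> fscale c x \<in> G"
    using assms(2) by (auto simp: fs.subspace_def)
  have "VectorSpace.subspace class_ring C V"
  proof (intro VectorSpace.subspace.intro submodule.intro)
    show "vectorspace class_ring V" by (rule V.vectorspace_axioms)
    show "module class_ring V" by (rule V.module_axioms)
    show "C \<subseteq> carrier V" using assms(3,4) V.closed by blast
    show "\<zero>\<^bsub>V\<^esub> \<in> C" using V.zero G(1) assms(4) by (metis imageI)
    show "v \<oplus>\<^bsub>V\<^esub> w \<in> C" if "v \<in> C" "w \<in> C" for v w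
      using that G(2) V.add assms(3,4) by (smt (verit, ccfv_threshold) imageE imageI subsetD)
    show "c \<odot>\<^bsub>V\<^esub> v \<in> C" if "c \<in> carrier class_ring" "v \<in> C" for c v
      using that G(3) V.smult assms(3,4) by (smt (verit, ccfv_threshold) imageE imageI subsetD)
  qed
  then have vs: "vectorspace class_ring (V\<lparr>carrier := C\<rparr>)" by (rule V.subspace_is_vs)
  interpret C: vectorspace "class_ring :: complex ring" "V\<lparr>carrier := C\<rparr>" by (rule vs)
  show ?thesis
  proof (unfold_locales, goal_cases)
    case 1
    show ?case by (rule assms(2))
  next
    case 2
    show ?case using V.inj assms(3,4) by (auto simp: bij_betw_def inj_on_subset)
  next
    case (3 x y)
    then show ?case using V.add[of x y] assms(3) by auto
  next
    case (4 x c)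
    then show ?case using V.smult[of x c] assms(3) by auto
  qed
qed

section \<open>Normal forms of the pair of points\<close>

text \<open>The matrix \<open>J\<close> is the identity for \<open>so\<close> and the symplectic form for \<open>sp\<close>.\<close>

definition form_algebra :: "complex mat \<Rightarrow> nat \<Rightarrow> int \<Rightarrow> complex mat set" where
  "form_algebra J n \<epsilon> = {Y \<in> carrier_mat n n. transpose_mat (J * Y) = of_int \<epsilon> \<cdot>\<^sub>m (J * Y)}"

lemma so_algebra_eq: "so_algebra n = form_algebra (1\<^sub>m n) n (-1)"
proof -
  have "- Y = of_int (- 1) \<cdot>\<^sub>m Y" for Y :: "complex mat"
    by (intro eq_matI) auto
  then show ?thesis by (auto simp: so_algebra_def form_algebra_def)
qed

lemma symplectic_form_props:
  assumes "even n"
  shows "symplectic_form n \<in> carrier_mat n n"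
    and "transpose_mat (symplectic_form n) = - symplectic_form n"
    and "symplectic_form n * (- symplectic_form n) = 1\<^sub>m n"
proof -
  define k where "k = n div 2"
  have n: "n = k + k" using assms by (auto simp: k_def)
  have F: "symplectic_form n = four_block_mat (0\<^sub>m k k) (1\<^sub>m k) (- 1\<^sub>m k) (0\<^sub>m k k)"
    by (simp add: symplectic_form_def k_def[symmetric])
  show car: "symplectic_form n \<in> carrier_mat n n" unfolding F unfolding n by (intro four_block_carrier_mat) auto
  have neg: "- symplectic_form n = four_block_mat (0\<^sub>m k k) (- 1\<^sub>m k) (1\<^sub>m k) (0\<^sub>m k k)"
    unfolding F by (intro eq_matI) auto
  show "transpose_mat (symplectic_form n) = - symplectic_form n"
    unfolding neg unfolding F by (intro eq_matI) auto
  have "(1\<^sub>m k :: complex mat) * 1\<^sub>m k = 1\<^sub>m k" by simp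
  then show "symplectic_form n * (- symplectic_form n) = 1\<^sub>m n"
    unfolding neg unfolding F unfolding n
    by (subst mult_four_block_mat[of _ k k _ k _ k _ _ k _ k]) (auto intro!: eq_matI)
qed

lemma add_mat_eq_0_iff:
  fixes A B :: "complex mat"
  assumes A: "A \<in> carrier_mat n m" and B: "B \<in> carrier_mat n m"
  shows "A + B = 0\<^sub>m n m \<longleftrightarrow> - A = B"
proof
  assume h: "A + B = 0\<^sub>m n m"
  show "- A = B"
  proof (rule eq_matI)
    fix i j assume ij: "i < dim_row B" "j < dim_col B"
    have "(A + B) $$ (i, j) = 0" using h ij B by simp
    then have "A $$ (i, j) + B $$ (i, j) = 0" using ij by simp
    then show "(- A) $$ (i, j) = B $$ (i, j)" using ij A B by (simp add: minus_unique)
  qed (use A B in auto)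
next
  assume h: "- A = B"
  show "A + B = 0\<^sub>m n m" unfolding h[symmetric] by (intro eq_matI) (use A in auto)
qed

text \<open>The symplectic matrix S is skew, so (S Y)^T = - Y^T S and the defining equation says
  that S Y is symmetric: the sign is +1 although S is skew.\<close>

lemma sp_algebra_eq:
  assumes "even n"
  shows "sp_algebra n = form_algebra (symplectic_form n) n 1"
proof -
  note S = symplectic_form_props[OF assms]
  have "transpose_mat Y * symplectic_form n + symplectic_form n * Y = 0\<^sub>m n n \<longleftrightarrow>
        transpose_mat (symplectic_form n * Y) = of_int 1 \<cdot>\<^sub>m (symplectic_form n * Y)"
    if Y: "Y \<in> carrier_mat n n" for Y
  proof -
    let ?A = "transpose_mat Y * symplectic_form n" and ?B = "symplectic_form n * Y"
    have car: "?A \<in> carrier_mat n n" "?B \<in> carrier_mat n n" using Y S by auto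
    have "transpose_mat ?B = transpose_mat Y * (- symplectic_form n)"
      using transpose_mult[OF S(1) Y] S(2) by simp
    also have "\<dots> = - ?A" using Y S(1) by simp
    finally have T: "transpose_mat ?B = - ?A" .
    have "?A + ?B = 0\<^sub>m n n \<longleftrightarrow> - ?A = ?B"
      using car by (rule add_mat_eq_0_iff)
    moreover have "of_int 1 \<cdot>\<^sub>m ?B = ?B" by (intro eq_matI) auto
    ultimately show ?thesis unfolding T by simp
  qed
  then show ?thesis unfolding sp_algebra_def form_algebra_def by blast
qed

text \<open>For S = \<open>mat n n f\<close> put Y = J' U'^T S U'. Then J Y is congruent to S, so
  the symmetry is preserved, and U' A = A0 W' gives Y A = J' U'^T (S A0) W'. Thus \<Phi> and \<Psi>
  turn right multiplication by A into that by A0, and likewise for B.\<close>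

lemma has_kronecker_form_from_normal_form:
  fixes A B :: "complex mat"
  assumes J: "J \<in> carrier_mat n n" "J' \<in> carrier_mat n n" "J * J' = 1\<^sub>m n" "J' * J = 1\<^sub>m n"
    and U: "U \<in> carrier_mat n n" "U' \<in> carrier_mat n n" "U * U' = 1\<^sub>m n" "U' * U = 1\<^sub>m n"
    and W: "W \<in> carrier_mat m m" "W' \<in> carrier_mat m m" "W * W' = 1\<^sub>m m" "W' * W = 1\<^sub>m m"
    and car: "A \<in> carrier_mat n m" "B \<in> carrier_mat n m" "A0 \<in> carrier_mat n m" "B0 \<in> carrier_mat n m"
    and equiv: "A * W = U * A0" "B * W = U * B0"
    and us: "distinct us" "fs.independent (set us)" "fs.span (set us) = form_space n \<epsilon>"
    and vs: "distinct vs" "fs.independent (set vs)" "fs.span (set vs) = mat_space n m"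
    and rel: "block_rel (right_mult n m A0) (right_mult n m B0) us vs bs"
    and pos: "\<And>b. b \<in> set bs \<Longrightarrow> block_size b \<ge> 1"
  shows "has_kronecker_form ((module_mat TYPE(complex) n n)\<lparr>carrier := form_algebra J n \<epsilon>\<rparr>)
     (module_mat TYPE(complex) n m) (\<lambda>Y. Y * A) (\<lambda>Y. Y * B) bs"
proof -
  define P where "P = J' * transpose_mat U'"
  define P' where "P' = transpose_mat U * J"
  have P: "P \<in> carrier_mat n n" "P' \<in> carrier_mat n n" using J U by (auto simp: P_def P'_def)
  have TU: "transpose_mat U' * transpose_mat U = 1\<^sub>m n" "transpose_mat U * transpose_mat U' = 1\<^sub>m n"
    unfolding transpose_mult[OF U(1,2), symmetric] transpose_mult[OF U(2,1), symmetric] U(3,4) by simp_all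
  have carT: "transpose_mat U \<in> carrier_mat n n" "transpose_mat U' \<in> carrier_mat n n" using U by auto
  have PP': "P * P' = 1\<^sub>m n"
  proof -
    have "P * P' = J' * (transpose_mat U' * transpose_mat U) * J"
      unfolding P_def P'_def using J(1,2) carT
      by (simp add: assoc_mult_mat[of _ n n _ n _ n])
    then show ?thesis using TU J by simp
  qed
  have P'P: "P' * P = 1\<^sub>m n"
  proof -
    have "P' * P = transpose_mat U * (J * J') * transpose_mat U'"
      unfolding P_def P'_def using J(1,2) carT
      by (simp add: assoc_mult_mat[of _ n n _ n _ n])
    then show ?thesis using TU J carT by simp
  qed
  define \<Phi> where "\<Phi> f = P * mat n n f * U'" for f :: "nat \<times> nat \<Rightarrow> complex"
  define \<Psi> where "\<Psi> f = P * mat n m f * W'" for f :: "nat \<times> nat \<Rightarrow> complex"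
  have JP: "J * P = transpose_mat U'"
    unfolding P_def using J carT by (simp add: assoc_mult_mat[symmetric, of _ n n _ n _ n])
  have J\<Phi>: "J * \<Phi> f = transpose_mat U' * mat n n f * U'" for f
  proof -
    have "J * \<Phi> f = J * P * mat n n f * U'"
      unfolding \<Phi>_def using J(1) P(1) U(2) by (simp add: assoc_mult_mat[of _ n n _ n _ n])
    then show ?thesis unfolding JP .
  qed
  have transp: "transpose_mat (transpose_mat U' * M * U') = transpose_mat U' * transpose_mat M * U'"
    if "M \<in> carrier_mat n n" for M :: "complex mat"
    using that U carT by (simp add: transpose_mult[of _ n n _ n] assoc_mult_mat[of _ n n _ n _ n])
  have scal: "c \<cdot>\<^sub>m (transpose_mat U' * M * U') = transpose_mat U' * (c \<cdot>\<^sub>m M) * U'"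
    if "M \<in> carrier_mat n n" for c and M :: "complex mat"
    using that U carT
    by (simp add: mult_smult_distrib[of _ n n _ n] mult_smult_assoc_mat[of _ n n _ n])
  have model: "linear_model (module_mat TYPE(complex) n n) (mat_space n n) \<Phi>"
    unfolding \<Phi>_def by (rule linear_model_mat[OF P PP' P'P U(2,1,4,3)])
  have mem: "\<Phi> f \<in> form_algebra J n \<epsilon> \<longleftrightarrow> f \<in> form_space n \<epsilon>" if f: "f \<in> mat_space n n" for f
  proof -
    let ?M = "mat n n f"
    have "transpose_mat (J * \<Phi> f) = of_int \<epsilon> \<cdot>\<^sub>m (J * \<Phi> f) \<longleftrightarrow>
       transpose_mat U' * transpose_mat ?M * U' = transpose_mat U' * (of_int \<epsilon> \<cdot>\<^sub>m ?M) * U'"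
      unfolding J\<Phi> by (simp add: transp scal)
    also have "\<dots> \<longleftrightarrow> transpose_mat ?M = of_int \<epsilon> \<cdot>\<^sub>m ?M"
    proof
      assume "transpose_mat U' * transpose_mat ?M * U' = transpose_mat U' * (of_int \<epsilon> \<cdot>\<^sub>m ?M) * U'"
      then have "transpose_mat U * (transpose_mat U' * transpose_mat ?M * U') * U =
          transpose_mat U * (transpose_mat U' * (of_int \<epsilon> \<cdot>\<^sub>m ?M) * U') * U" by simp
      then show "transpose_mat ?M = of_int \<epsilon> \<cdot>\<^sub>m ?M"
        using sandwich_cancel[OF carT(2,1) TU(2) U(2,1,4)] by simp
    next
      assume "transpose_mat ?M = of_int \<epsilon> \<cdot>\<^sub>m ?M"
      then show "transpose_mat U' * transpose_mat ?M * U' = transpose_mat U' * (of_int \<epsilon> \<cdot>\<^sub>m ?M) * U'"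
        by (rule arg_cong)
    qed
    also have "\<dots> \<longleftrightarrow> f \<in> form_space n \<epsilon>"
    proof
      assume T: "transpose_mat ?M = of_int \<epsilon> \<cdot>\<^sub>m ?M"
      show "f \<in> form_space n \<epsilon>"
      proof (rule form_spaceI[OF f])
        fix i j
        show "f (j, i) = of_int \<epsilon> * f (i, j)"
        proof (cases "i < n \<and> j < n")
          case True
          then show ?thesis using arg_cong[OF T, of "\<lambda>M. M $$ (i, j)"] by simp
        next
          case False
          then have "f (i, j) = 0" "f (j, i) = 0" using f unfolding mat_space_def by blast+
          then show ?thesis by simp
        qed
      qed
    next
      assume "f \<in> form_space n \<epsilon>"
      then have sym: "f (j, i) = of_int \<epsilon> * f (i, j)" for i j by (rule form_space_sym)
      show "transpose_mat ?M = of_int \<epsilon> \<cdot>\<^sub>m ?M"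
      proof (rule eq_matI)
        fix i j assume "i < dim_row (of_int \<epsilon> \<cdot>\<^sub>m ?M)" "j < dim_col (of_int \<epsilon> \<cdot>\<^sub>m ?M)"
        then show "transpose_mat ?M $$ (i, j) = (of_int \<epsilon> \<cdot>\<^sub>m ?M) $$ (i, j)"
          using sym[of j i] by simp
      qed simp_all
    qed
    finally have "transpose_mat (J * \<Phi> f) = of_int \<epsilon> \<cdot>\<^sub>m (J * \<Phi> f) \<longleftrightarrow> f \<in> form_space n \<epsilon>" .
    moreover have "\<Phi> f \<in> carrier_mat n n" unfolding \<Phi>_def using P U by (meson mat_carrier mult_carrier_mat)
    ultimately show ?thesis unfolding form_algebra_def by blast
  qed
  have "form_algebra J n \<epsilon> = \<Phi> ` form_space n \<epsilon>"
  proof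
    show "\<Phi> ` form_space n \<epsilon> \<subseteq> form_algebra J n \<epsilon>" using mem form_space_subset by blast
    have im: "carrier_mat n n = \<Phi> ` mat_space n n"
      using linear_model.bij[OF model] by (simp add: bij_betw_def module_mat_simps)
    show "form_algebra J n \<epsilon> \<subseteq> \<Phi> ` form_space n \<epsilon>"
    proof
      fix Y assume Y: "Y \<in> form_algebra J n \<epsilon>"
      then have "Y \<in> carrier_mat n n" unfolding form_algebra_def by blast
      then obtain f where f: "f \<in> mat_space n n" "Y = \<Phi> f" unfolding im by (rule imageE)
      then show "Y \<in> \<Phi> ` form_space n \<epsilon>" using mem[OF f(1)] Y by simp
    qed
  qed
  then have modelG: "linear_model ((module_mat TYPE(complex) n n)\<lparr>carrier := form_algebra J n \<epsilon>\<rparr>) (form_space n \<epsilon>) \<Phi>"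
    by (rule linear_model_restrict[OF model subspace_form_space form_space_subset])
  have modelV: "linear_model (module_mat TYPE(complex) n m) (mat_space n m) \<Psi>"
    unfolding \<Psi>_def by (rule linear_model_mat[OF P PP' P'P W(2,1,4,3)])
  have hom: "(\<lambda>Y. Y * C) \<in> module_hom class_ring
      ((module_mat TYPE(complex) n n)\<lparr>carrier := form_algebra J n \<epsilon>\<rparr>) (module_mat TYPE(complex) n m)"
    if C: "C \<in> carrier_mat n m" for C
    using C unfolding module_hom_def form_algebra_def
    by (auto simp: module_mat_simps add_mult_distrib_mat[of _ n n] mult_smult_assoc_mat[of _ n n])
  have comm: "\<Phi> f * C = \<Psi> (right_mult n m C0 f)"
    if C: "C \<in> carrier_mat n m" "C0 \<in> carrier_mat n m" "C * W = U * C0" for f C C0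
  proof -
    let ?F = "mat n n f"
    have F: "?F \<in> carrier_mat n n" by simp
    have "C = C * (W * W')" using C W by simp
    also have "\<dots> = U * C0 * W'" using C W assoc_mult_mat[OF C(1) W(1,2)] by simp
    finally have C': "C = U * C0 * W'" .
    have UC: "U * C0 \<in> carrier_mat n m" and PF: "P * ?F \<in> carrier_mat n n" using U C P by auto
    have "\<Phi> f * C = P * ?F * (U' * C)"
      unfolding \<Phi>_def by (rule assoc_mult_mat[OF PF U(2) C(1)])
    also have "U' * C = U' * (U * C0) * W'"
      unfolding C' by (rule assoc_mult_mat[OF U(2) UC W(2), symmetric])
    also have "U' * (U * C0) = C0"
      using assoc_mult_mat[OF U(2,1) C(2)] U(4) C(2) by simp
    also have "P * ?F * (C0 * W') = P * ?F * C0 * W'"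
      by (rule assoc_mult_mat[OF PF C(2) W(2), symmetric])
    also have "P * ?F * C0 = P * (?F * C0)"
      by (rule assoc_mult_mat[OF P(1) F C(2)])
    also have "?F * C0 = mat n m (right_mult n m C0 f)"
      unfolding right_mult_def by (rule mat_entries[symmetric]) (use C in auto)
    finally show ?thesis unfolding \<Psi>_def .
  qed
  show ?thesis
    by (rule has_kronecker_form_transfer[OF modelG modelV hom[OF car(1)] hom[OF car(2)]
          comm[OF car(1,3) equiv(1)] comm[OF car(2,4) equiv(2)] us vs rel pos])
qed

section \<open>The shift pencil and Hankel forms\<close>

text \<open>The two kernels sit at opposite ends of the chain because the zero column comes first in
  (0 | I) and last in (I | 0).\<close>

lemma matrix_rel_horizontal:
  assumes len: "length xs = Suc l" "length ys = l"
    and A: "A (xs ! 0) = 0" "\<And>t. t < l \<Longrightarrow> A (xs ! Suc t) = ys ! t"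
    and B: "B (xs ! l) = 0" "\<And>t. t < l \<Longrightarrow> B (xs ! t) = ys ! t"
  shows "matrix_rel xs ys A (fst (block_pair (Horizontal_block (Suc l))))"
    and "matrix_rel xs ys B (snd (block_pair (Horizontal_block (Suc l))))"
proof -
  let ?MA = "fst (block_pair (Horizontal_block (Suc l)))"
  let ?MB = "snd (block_pair (Horizontal_block (Suc l)))"
  have delta: "(\<Sum>i<l. fscale (if i = k then 1 else 0) (ys ! i)) = (if k < l then ys ! k else 0)" for k
  proof -
    have "(\<Sum>i<l. fscale (if i = k then 1 else 0) (ys ! i)) = (\<Sum>i<l. if i = k then ys ! i else 0)"
      by (rule sum.cong) simp_all
    then show ?thesis by simp
  qed
  have MA: "?MA $$ (i, j) = (if j = i + 1 then 1 else 0)" "?MB $$ (i, j) = (if i = j then 1 else 0)"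
    if "i < l" "j < Suc l" for i j using that by simp_all
  have carr: "?MA \<in> carrier_mat l (Suc l)" "?MB \<in> carrier_mat l (Suc l)"
    by (rule carrier_matI; simp)+
  show "matrix_rel xs ys A ?MA"
    unfolding matrix_rel_def len
  proof (intro conjI carr allI impI)
    fix j assume j: "j < Suc l"
    show "A (xs ! j) = (\<Sum>i<l. fscale (?MA $$ (i, j)) (ys ! i))"
    proof (cases j)
      case 0
      have "(\<Sum>i<l. fscale (?MA $$ (i, j)) (ys ! i)) = (\<Sum>i<l. 0)"
      proof (rule sum.cong)
        fix i assume "i \<in> {..<l}"
        then have "?MA $$ (i, j) = 0" unfolding 0 by (subst MA(1)) simp_all
        then show "fscale (?MA $$ (i, j)) (ys ! i) = 0" by (metis fs.scale_zero_left)
      qed simp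
      then show ?thesis using A(1) unfolding 0 sum.neutral_const by (rule trans[OF _ sym, rotated])
    next
      case (Suc k)
      have "(\<Sum>i<l. fscale (?MA $$ (i, j)) (ys ! i)) = (\<Sum>i<l. fscale (if i = k then 1 else 0) (ys ! i))"
      proof (rule sum.cong)
        fix i assume "i \<in> {..<l}"
        then have "?MA $$ (i, j) = (if i = k then 1 else 0)" using j Suc by (subst MA(1)) auto
        then show "fscale (?MA $$ (i, j)) (ys ! i) = fscale (if i = k then 1 else 0) (ys ! i)"
          by (rule arg_cong)
      qed simp
      also have "\<dots> = ys ! k" unfolding delta using j Suc by simp
      also have "\<dots> = A (xs ! j)" unfolding Suc by (rule A(2)[symmetric]) (use j Suc in simp)
      finally show ?thesis ..
    qed
  qed
  show "matrix_rel xs ys B ?MB"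
    unfolding matrix_rel_def len
  proof (intro conjI carr allI impI)
    fix j assume j: "j < Suc l"
    have "(\<Sum>i<l. fscale (?MB $$ (i, j)) (ys ! i)) = (\<Sum>i<l. fscale (if i = j then 1 else 0) (ys ! i))"
    proof (rule sum.cong)
      fix i assume "i \<in> {..<l}"
      then have "?MB $$ (i, j) = (if i = j then 1 else 0)" using j by (subst MA(2)) auto
      then show "fscale (?MB $$ (i, j)) (ys ! i) = fscale (if i = j then 1 else 0) (ys ! i)"
        by (rule arg_cong)
    qed simp
    also have "\<dots> = B (xs ! j)"
    proof (cases "j < l")
      case True
      then show ?thesis unfolding delta by (metis B(2))
    next
      case False
      then have "j = l" using j by simp
      then show ?thesis unfolding delta by (metis B(1) False)
    qed
    finally show "B (xs ! j) = (\<Sum>i<l. fscale (?MB $$ (i, j)) (ys ! i))" ..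
  qed
qed

definition shift_mat :: "nat \<Rightarrow> nat \<Rightarrow> nat \<Rightarrow> complex mat" where
  "shift_mat n m s = mat n m (\<lambda>(i, j). if i = j + s then 1 else 0)"

lemma right_mult_shift_mat:
  assumes "m + s \<le> n"
  shows "right_mult n m (shift_mat n m s) f (p, k) = (if p < n \<and> k < m then f (p, k + s) else 0)"
proof (cases "p < n \<and> k < m")
  case True
  have "right_mult n m (shift_mat n m s) f (p, k) = (\<Sum>j<n. f (p, j) * (if j = k + s then 1 else 0))"
    using True by (simp add: right_mult_def entries_def shift_mat_def scalar_prod_def lessThan_atLeast0)
  also have "\<dots> = f (p, k + s)" using True assms by (simp add: if_distrib cong: if_cong)
  finally show ?thesis using True by simp
next
  case False
  then show ?thesis unfolding right_mult_def entries_def shift_mat_def by auto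
qed

text \<open>Each index occurs in e - 1 pairs with another index, and for \<epsilon> = 1 its diagonal
  pair counts it twice more.\<close>

lemma sum_triangle:
  fixes g :: "nat \<Rightarrow> int"
  assumes "\<epsilon> = 1 \<or> \<epsilon> = -1"
  shows "(\<Sum>(i, j)\<in>triangle e \<epsilon>. g i + g j) = (int e + \<epsilon>) * (\<Sum>i<e. g i)"
proof (induction e)
  case 0
  then show ?case by (simp add: triangle_def)
next
  case (Suc e)
  let ?R = "if \<epsilon> = 1 then {..e} else {..<e}"
  have split: "triangle (Suc e) \<epsilon> = triangle e \<epsilon> \<union> {e} \<times> ?R"
    by (auto simp: triangle_def less_Suc_eq)
  have disj: "triangle e \<epsilon> \<inter> {e} \<times> ?R = {}" by (auto simp: triangle_def)
  have "(\<Sum>(i, j)\<in>{e} \<times> ?R. g i + g j) = (\<Sum>j\<in>?R. g e + g j)"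
    by (subst sum.cartesian_product[symmetric]) simp
  also have "\<dots> = (\<Sum>i<e. g i) + (int e + 1 + \<epsilon>) * g e"
    using assms by (auto simp: sum.distrib lessThan_Suc_atMost[symmetric] algebra_simps)
  finally show ?case
    unfolding split using Suc disj by (subst sum.union_disjoint) (auto simp: algebra_simps)
qed

text \<open>Taking quotient, step and remainder as parameters makes m and n explicit, so that block
  indices and residues are computed by \<open>div\<close> and \<open>mod\<close>.\<close>

locale hankel =
  fixes q d r :: nat and \<epsilon> :: int
  assumes r: "r < d" and \<epsilon>: "\<epsilon> = 1 \<or> \<epsilon> = -1"
begin

abbreviation "m \<equiv> q * d + r"
abbreviation "n \<equiv> m + d"

text \<open>A row index is written as \<open>s * d + i\<close> with \<open>i < d\<close>; then \<open>level i\<close> is the largest \<open>s\<close> in the residue class \<open>i\<close>.\<close>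

definition level :: "nat \<Rightarrow> nat" where "level i = (if i < r then q + 1 else q)"

text \<open>The \<epsilon>-symmetric unit form on residues; for i = j the first branch
  decides.\<close>

definition residue_entry :: "nat \<Rightarrow> nat \<Rightarrow> nat \<Rightarrow> nat \<Rightarrow> complex" where
  "residue_entry i j a b = (if a = i \<and> b = j then 1 else if a = j \<and> b = i then of_int \<epsilon> else 0)"

text \<open>On the block of residues (i, j), indexed by the quotients, this is the Hankel matrix
  with ones on antidiagonal \<open>c\<close>; the block (j, i) carries its
  \<epsilon>-transpose.\<close>

definition hankel_unit :: "nat \<times> nat \<times> nat \<Rightarrow> nat \<times> nat \<Rightarrow> complex" where
  "hankel_unit = (\<lambda>(i, j, c) (p, k). if p < n \<and> k < n \<and> p div d + k div d = c
     then residue_entry i j (p mod d) (k mod d) else 0)"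

lemma hankel_unit_eq:
  "p < n \<Longrightarrow> k < n \<Longrightarrow> p div d + k div d = c \<Longrightarrow>
     hankel_unit (i, j, c) (p, k) = residue_entry i j (p mod d) (k mod d)"
  unfolding hankel_unit_def prod.case by (rule if_P) blast

lemma hankel_unit_eq_0:
  "\<not> (p < n \<and> k < n \<and> p div d + k div d = c) \<Longrightarrow> hankel_unit (i, j, c) (p, k) = 0"
  unfolding hankel_unit_def prod.case by (rule if_not_P)

text \<open>The quotients run up to \<open>level i\<close> and \<open>level j\<close>, hence the
  antidiagonals up to their sum, inclusive.\<close>

definition index_set :: "(nat \<times> nat \<times> nat) set" where
  "index_set = {(i, j, c). (i, j) \<in> triangle d \<epsilon> \<and> c \<le> level i + level j}"

text \<open>The representative of antidiagonal \<open>c\<close> with the largest row quotient and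
  hence the smallest column quotient. Below the top antidiagonal its column is then less than m, so
  it is kept when the last d columns are cut off.\<close>

definition pos :: "nat \<times> nat \<times> nat \<Rightarrow> nat \<times> nat" where
  "pos = (\<lambda>(i, j, c). (min c (level i) * d + i, (c - min c (level i)) * d + j))"

definition hankel_space :: "(nat \<times> nat \<Rightarrow> complex) set" where
  "hankel_space = {f \<in> form_space n \<epsilon>. \<forall>p<m. \<forall>k<m. f (p, k + d) = f (p + d, k)}"

lemma d_pos: "0 < d" using r by simp

text \<open>From n = (q + 1) * d + r: the quotient q + 1 occurs exactly for the residues below
  r.\<close>

lemma less_n_iff: "i < d \<Longrightarrow> s * d + i < n \<longleftrightarrow> s \<le> level i"
proof -
  assume i: "i < d"
  consider "s \<le> q" | "s = q + 1" | "q + 2 \<le> s" by linarith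
  then show ?thesis
  proof cases
    case 1
    then have "s * d \<le> q * d" by (rule mult_le_mono1)
    then have "s * d + i < n" using i by linarith
    then show ?thesis using 1 by (simp add: level_def)
  next
    case 3
    then have "(q + 2) * d \<le> s * d" by (rule mult_le_mono1)
    then have "q * d + d + d \<le> s * d" by (simp add: algebra_simps)
    then have "\<not> s * d + i < n" using r by linarith
    then show ?thesis using 3 by (auto simp: level_def)
  qed (auto simp: level_def)
qed

lemma div_le_level: "p < n \<Longrightarrow> p div d \<le> level (p mod d)"
  using less_n_iff[of "p mod d" "p div d"] d_pos by simp

lemma div_less_level: "k < m \<Longrightarrow> k div d < level (k mod d)"
  using div_le_level[of "k + d"] d_pos by simp

lemma less_mI: "j < d \<Longrightarrow> s < level j \<Longrightarrow> s * d + j < m"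
  using less_n_iff[of j "Suc s"] by simp

lemma index_setD:
  assumes "(i, j, c) \<in> index_set"
  shows "i < d" "j < d" "j \<le> i" "c \<le> level i + level j" "level i \<le> level j" "i = j \<Longrightarrow> \<epsilon> = 1"
  using assms by (auto simp: index_set_def triangle_def level_def)

lemma hankel_unit_pos:
  assumes x: "x \<in> index_set" and y: "y \<in> index_set"
  shows "hankel_unit x (pos y) = (if x = y then 1 else 0)"
proof -
  obtain i j c i' j' c' where xy: "x = (i, j, c)" "y = (i', j', c')" by (metis prod_cases3)
  note X = index_setD[OF x[unfolded xy]] and Y = index_setD[OF y[unfolded xy]]
  define s where "s = min c' (level i')"
  have lt: "s * d + i' < n" "(c' - s) * d + j' < n"
    using less_n_iff[OF Y(1), of s] less_n_iff[OF Y(2), of "c' - s"] Y(4) by (auto simp: s_def)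
  have sum: "s + (c' - s) = c'" by (simp add: s_def)
  have dm: "(s * d + i') div d = s" "((c' - s) * d + j') div d = c' - s"
    "(s * d + i') mod d = i'" "((c' - s) * d + j') mod d = j'"
    using Y(1,2) by simp_all
  have "pos y = (s * d + i', (c' - s) * d + j')" unfolding pos_def xy s_def prod.case ..
  then have "hankel_unit x (pos y) = (if c' = c then residue_entry i j i' j' else 0)"
    unfolding hankel_unit_def xy by (simp only: prod.case lt dm sum simp_thms)
  \<comment> \<open>Both pairs list the larger residue first, so a swapped match is possible only
    for equal residues, where it is also a direct match.\<close>
  moreover have "\<not> (i' = j \<and> j' = i) \<or> i' = i \<and> j' = j" using X(3) Y(3) by linarith
  ultimately show ?thesis unfolding xy prod.inject residue_entry_def by (auto split: if_splits)
qed

lemma residue_entry_sym: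
  assumes "i = j \<Longrightarrow> \<epsilon> = 1"
  shows "residue_entry i j b a = of_int \<epsilon> * residue_entry i j a b"
proof -
  have sq: "of_int \<epsilon> * of_int \<epsilon> = (1 :: complex)" using \<epsilon> by (elim disjE) simp_all
  show ?thesis
  proof (cases "i = j")
    case True
    then have "of_int \<epsilon> = (1 :: complex)" using assms by simp
    then show ?thesis using True unfolding residue_entry_def by auto
  next
    case False
    then show ?thesis using sq unfolding residue_entry_def by auto
  qed
qed

lemma hankel_unit_sym:
  assumes "i = j \<Longrightarrow> \<epsilon> = 1"
  shows "hankel_unit (i, j, c) (k, p) = of_int \<epsilon> * hankel_unit (i, j, c) (p, k)"
proof (cases "p < n \<and> k < n \<and> p div d + k div d = c")
  case True
  have "hankel_unit (i, j, c) (k, p) = residue_entry i j (k mod d) (p mod d)"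
    by (rule hankel_unit_eq) (use True in linarith)+
  moreover have "hankel_unit (i, j, c) (p, k) = residue_entry i j (p mod d) (k mod d)"
    by (rule hankel_unit_eq) (use True in linarith)+
  ultimately show ?thesis using residue_entry_sym[OF assms] by metis
next
  case False
  have "hankel_unit (i, j, c) (k, p) = 0"
    by (rule hankel_unit_eq_0) (use False in linarith)
  moreover have "hankel_unit (i, j, c) (p, k) = 0"
    using False by (rule hankel_unit_eq_0)
  ultimately show ?thesis by simp
qed

lemma finite_index_set: "finite index_set"
proof (rule finite_subset)
  show "index_set \<subseteq> {..<d} \<times> {..<d} \<times> {..2 * q + 2}"
    by (auto simp: index_set_def triangle_def level_def split: if_splits)
qed simp

lemma subspace_hankel_space: "fs.subspace hankel_space"
proof (rule fs.subspaceI)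
  show "0 \<in> hankel_space"
    unfolding hankel_space_def using fs.subspace_0[OF subspace_form_space] by simp
next
  fix f g assume "f \<in> hankel_space" "g \<in> hankel_space"
  then show "f + g \<in> hankel_space"
    unfolding hankel_space_def using fs.subspace_add[OF subspace_form_space] by simp
next
  fix f c assume "f \<in> hankel_space"
  then show "fscale c f \<in> hankel_space"
    unfolding hankel_space_def using fs.subspace_scale[OF subspace_form_space] by simp
qed

text \<open>The positions (p, k + d) and (p + d, k) have the same residues and the same sum of
  quotients.\<close>

lemma hankel_unit_in_hankel_space:
  assumes "x \<in> index_set"
  shows "hankel_unit x \<in> hankel_space"
proof -
  obtain i j c where x: "x = (i, j, c)" by (metis prod_cases3)
  note X = index_setD[OF assms[unfolded x]]
  have "hankel_unit x \<in> form_space n \<epsilon>"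
    unfolding x
  proof (rule form_spaceI)
    show "hankel_unit (i, j, c) \<in> mat_space n n"
      unfolding mat_space_def using hankel_unit_eq_0 by blast
    show "hankel_unit (i, j, c) (k, p) = of_int \<epsilon> * hankel_unit (i, j, c) (p, k)" for p k
      using X(6) by (rule hankel_unit_sym)
  qed
  moreover have "hankel_unit x (p, k + d) = hankel_unit x (p + d, k)" if pk: "p < m" "k < m" for p k
  proof -
    have *: "(k + d) mod d = k mod d" "(k + d) div d = k div d + 1" "(p + d) mod d = p mod d"
      "(p + d) div d = p div d + 1" using d_pos by simp_all
    have lt: "p < n" "k < n" "p + d < n" "k + d < n" using pk by simp_all
    show ?thesis
    proof (cases "p div d + k div d + 1 = c")
      case True
      have "hankel_unit x (p, k + d) = residue_entry i j (p mod d) ((k + d) mod d)"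
        unfolding x using lt * True by (intro hankel_unit_eq) linarith+
      also have "\<dots> = hankel_unit x (p + d, k)"
        unfolding x * using lt * True by (subst hankel_unit_eq) (linarith | simp only: *)+
      finally show ?thesis .
    next
      case False
      have "hankel_unit x (p, k + d) = 0" unfolding x by (rule hankel_unit_eq_0) (use * False in linarith)
      moreover have "hankel_unit x (p + d, k) = 0" unfolding x by (rule hankel_unit_eq_0) (use * False in linarith)
      ultimately show ?thesis by (rule trans[OF _ sym])
    qed
  qed
  ultimately show ?thesis unfolding hankel_space_def by blast
qed

text \<open>Each move shifts one step d from the column to the row. The first \<open>t\<close> moves
  end at column quotient \<open>Suc u\<close>, hence the generalisation over
  \<open>u\<close>.\<close>

lemma hankel_move:
  assumes f: "f \<in> hankel_space"
  shows "s * d + i < n \<Longrightarrow> (s + t) * d + i < n \<Longrightarrow> (u + t) * d + j < n \<Longrightarrow>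
     f (s * d + i, (u + t) * d + j) = f ((s + t) * d + i, u * d + j)"
proof (induction t arbitrary: u)
  case (Suc t)
  have bounds: "(s + t) * d + i < m" "u * d + j < m" using Suc.prems by (auto simp: algebra_simps)
  have "f (s * d + i, (u + Suc t) * d + j) = f (s * d + i, (Suc u + t) * d + j)" by simp
  also have "\<dots> = f ((s + t) * d + i, Suc u * d + j)"
    using bounds Suc.prems by (intro Suc.IH) (auto simp: algebra_simps)
  also have "\<dots> = f ((s + t) * d + i, u * d + j + d)" by (simp add: algebra_simps)
  also have "\<dots> = f ((s + t) * d + i + d, u * d + j)"
    using f bounds by (simp add: hankel_space_def)
  also have "\<dots> = f ((s + Suc t) * d + i, u * d + j)" by (simp add: algebra_simps)
  finally show ?case .
qed simp

text \<open>Moving along the antidiagonal reaches \<open>pos\<close> if the larger residue is in the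
  row, and symmetry covers the transposed case. For equal residues and \<epsilon> = -1 there is no
  such position, but the moves take (p, k) to (k, p), where skew symmetry demands the opposite
  value.\<close>

lemma hankel_space_separated:
  assumes f: "f \<in> hankel_space" and 0: "\<And>x. x \<in> index_set \<Longrightarrow> f (pos x) = 0"
  shows "f = 0"
proof -
  have form: "f \<in> form_space n \<epsilon>" using f by (simp add: hankel_space_def)
  have tri: "f (p, k) = 0" if p: "p < n" and k: "k < n" and tri: "(p mod d, k mod d) \<in> triangle d \<epsilon>" for p k
  proof -
    define i j s u where "i = p mod d" and "j = k mod d" and "s = p div d" and "u = k div d"
    \<comment> \<open>The number of moves from row quotient \<open>s\<close> to the row quotient of
      \<open>pos\<close>.\<close>
    define t where "t = min (s + u) (level i) - s"
    have ij: "i < d" "j < d" using d_pos by (auto simp: i_def j_def)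
    have pk: "p = s * d + i" "k = u * d + j" by (simp_all add: i_def j_def s_def u_def)
    have le: "s \<le> level i" "u \<le> level j"
      using div_le_level[OF p] div_le_level[OF k] by (simp_all add: i_def j_def s_def u_def)
    have x: "(i, j, s + u) \<in> index_set" using tri le by (simp add: index_set_def i_def j_def)
    have t: "t \<le> u" "s + t \<le> level i" "s + t = min (s + u) (level i)" using le by (auto simp: t_def)
    have "f (s * d + i, (u - t + t) * d + j) = f ((s + t) * d + i, (u - t) * d + j)"
      by (rule hankel_move[OF f]) (use t p k less_n_iff[OF ij(1)] in \<open>auto simp: pk\<close>)
    moreover have "pos (i, j, s + u) = ((s + t) * d + i, (u - t) * d + j)"
      unfolding pos_def prod.case t(3)[symmetric] using t(1) by simp
    ultimately show ?thesis using 0[OF x] t(1) by (simp add: pk)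
  qed
  have "f (p, k) = 0" if pk: "p < n" "k < n" for p k
  proof -
    have "p mod d < d" "k mod d < d" using d_pos by auto
    then consider "(p mod d, k mod d) \<in> triangle d \<epsilon>" | "(k mod d, p mod d) \<in> triangle d \<epsilon>"
      | "p mod d = k mod d" "\<epsilon> = -1"
      using \<epsilon> by (auto simp: triangle_def) (metis linorder_neqE_nat)+
    then show ?thesis
    proof cases
      case 1
      then show ?thesis using tri pk by blast
    next
      case 2
      then show ?thesis using tri[OF pk(2,1)] form_space_sym[OF form, of p k] by simp
    next
      case 3
      have swap: "f (a, b) = f (b, a)" if ab: "a div d \<le> b div d" "a mod d = b mod d" "a < n" "b < n" for a b
      proof -
        define t where "t = b div d - a div d"
        have a: "a = a div d * d + a mod d" by simp
        have b: "b = (a div d + t) * d + a mod d" using ab by (simp add: t_def)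
        have "f (a div d * d + a mod d, (a div d + t) * d + a mod d) =
            f ((a div d + t) * d + a mod d, a div d * d + a mod d)"
          using ab(3,4) b by (intro hankel_move[OF f]) auto
        then show ?thesis using a b by metis
      qed
      have "f (p, k) = f (k, p)"
        using swap[of p k] swap[of k p] 3(1) pk by (metis nat_le_linear)
      then show ?thesis using form_space_sym[OF form, of p k] 3(2) by simp
    qed
  qed
  moreover have "f (p, k) = 0" if "\<not> (p < n \<and> k < n)" for p k
    using that form form_space_subset unfolding mat_space_def by blast
  ultimately have "f (p, k) = 0" for p k by blast
  then show ?thesis by (intro ext) (simp add: split_paired_all)
qed

end

lemma image_mset_constant_on:
  assumes "\<And>x. x \<in> T \<Longrightarrow> f x = c"
  shows "image_mset f (mset_set T) = replicate_mset (card T) c"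
proof (cases "finite T")
  case True
  have "image_mset f (mset_set T) = image_mset (\<lambda>_. c) (mset_set T)"
    by (rule image_mset_cong) (use assms True in auto)
  then show ?thesis by (simp add: image_mset_const_eq)
qed simp

lemma distinct_concat_triples:
  assumes "distinct ps" "\<And>i j. distinct (g i j)"
  shows "distinct (concat (map (\<lambda>(i, j). map (\<lambda>c. (i, j, c)) (g i j)) ps))"
  using assms(1)
proof (induction ps)
  case (Cons x ps)
  obtain i j where x: "x = (i, j)" by (cases x)
  have "distinct (map (\<lambda>c. (i, j, c)) (g i j))"
    using assms(2) by (simp add: distinct_map inj_on_def)
  moreover have "set (map (\<lambda>c. (i, j, c)) (g i j)) \<inter>
      set (concat (map (\<lambda>(i, j). map (\<lambda>c. (i, j, c)) (g i j)) ps)) = {}"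
    using Cons.prems x by auto
  ultimately show ?case using Cons x by (simp del: set_concat)
qed simp

section \<open>Chains of Hankel units under the two shift maps\<close>

context hankel
begin

abbreviation "SA \<equiv> right_mult n m (shift_mat n m 0)"
abbreviation "SB \<equiv> right_mult n m (shift_mat n m d)"

lemma SA_apply: "SA f (p, k) = (if p < n \<and> k < m then f (p, k) else 0)"
  using right_mult_shift_mat[of m 0 n f p k] by simp

lemma SB_apply: "SB f (p, k) = (if p < n \<and> k < m then f (p, k + d) else 0)"
  by (rule right_mult_shift_mat) simp

lemma add_d: "(k + d) mod d = k mod d" "(k + d) div d = Suc (k div d)"
  using d_pos by simp_all

text \<open>Reading the column d further on lowers the antidiagonal number by one; these equalities
  are the links of the chain.\<close>

lemma SB_hankel_unit_Suc: "SB (hankel_unit (i, j, Suc c)) = SA (hankel_unit (i, j, c))"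
proof (rule ext, clarify)
  fix p k
  show "SB (hankel_unit (i, j, Suc c)) (p, k) = SA (hankel_unit (i, j, c)) (p, k)"
  proof (cases "p < n \<and> k < m")
    case True
    then have lt: "p < n" "k + d < n" "k < n" by simp_all
    have "hankel_unit (i, j, Suc c) (p, k + d) = hankel_unit (i, j, c) (p, k)"
    proof (cases "p div d + k div d = c")
      case True
      then have "hankel_unit (i, j, Suc c) (p, k + d) = residue_entry i j (p mod d) ((k + d) mod d)"
        using lt add_d(2)[of k] by (intro hankel_unit_eq) linarith+
      then show ?thesis using hankel_unit_eq[OF lt(1,3) True] unfolding add_d(1) by metis
    next
      case False
      have "hankel_unit (i, j, Suc c) (p, k + d) = 0"
        by (rule hankel_unit_eq_0) (use False add_d(2)[of k] in linarith)
      moreover have "hankel_unit (i, j, c) (p, k) = 0"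
        by (rule hankel_unit_eq_0) (use False in linarith)
      ultimately show ?thesis by metis
    qed
    then show ?thesis unfolding SA_apply SB_apply by metis
  next
    case False
    then show ?thesis unfolding SA_apply SB_apply by metis
  qed
qed

lemma SB_hankel_unit_0: "SB (hankel_unit (i, j, 0)) = 0"
proof (rule ext, clarify)
  fix p k
  have "hankel_unit (i, j, 0) (p, k + d) = 0"
    by (rule hankel_unit_eq_0) (use add_d(2)[of k] in linarith)
  then show "SB (hankel_unit (i, j, 0)) (p, k) = 0 (p, k)"
    unfolding SB_apply zero_fun_apply by metis
qed

text \<open>On the top antidiagonal both quotients are maximal for their residues, so the column is
  at least m and \<open>SA\<close> cuts it off.\<close>

lemma SA_hankel_unit_top: "SA (hankel_unit (i, j, level i + level j)) = 0"
proof (rule ext, clarify)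
  fix p k
  have "hankel_unit (i, j, level i + level j) (p, k) = 0" if pk: "p < n" "k < m"
  proof (cases "p div d + k div d = level i + level j")
    case True
    have "p div d + k div d < level (p mod d) + level (k mod d)"
      using div_le_level[OF pk(1)] div_less_level[OF pk(2)] by linarith
    then have "\<not> (p mod d = i \<and> k mod d = j)" "\<not> (p mod d = j \<and> k mod d = i)"
      unfolding True by (auto simp: add.commute)
    then have "residue_entry i j (p mod d) (k mod d) = 0" unfolding residue_entry_def by metis
    moreover have "k < n" using pk by linarith
    ultimately show ?thesis using hankel_unit_eq[OF pk(1) _ True] by metis
  next
    case False
    show ?thesis by (rule hankel_unit_eq_0) (use False in linarith)
  qed
  then show "SA (hankel_unit (i, j, level i + level j)) (p, k) = 0 (p, k)"
    unfolding SA_apply zero_fun_apply by metis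
qed

text \<open>The equation reads Y(p, k) = - Z(p, k + d). Alternating it with the symmetry of Y and of
  Z moves the shift by d from one index to the other; the two factors \<epsilon> cancel.\<close>

lemma kernel_in_hankel_space:
  assumes Y: "Y \<in> form_space n \<epsilon>" and Z: "Z \<in> form_space n \<epsilon>" and sum0: "SA Y + SB Z = 0"
  shows "Y \<in> hankel_space \<and> Z \<in> hankel_space"
proof -
  have rel: "Y (p, k) = - Z (p, k + d)" if "p < n" "k < m" for p k
  proof -
    have "(SA Y + SB Z) (p, k) = 0" using sum0 by (metis zero_fun_apply)
    then have "Y (p, k) + Z (p, k + d) = 0"
      unfolding plus_fun_apply SA_apply SB_apply using that by metis
    then show ?thesis by (metis add_eq_0_iff2)
  qed
  let ?e = "of_int \<epsilon> :: complex"
  have e: "?e * ?e = 1" using \<epsilon> by (elim disjE) simp_all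
  have Zh: "Z (p, k + d) = Z (p + d, k)" if pk: "p < m" "k < m" for p k
  proof -
    have "Z (p, k + d) = - Y (p, k)" using rel[of p k] pk by (metis minus_minus trans_less_add1)
    also have "Y (p, k) = ?e * Y (k, p)" by (rule form_space_sym[OF Y])
    also have "Y (k, p) = - Z (k, p + d)" using pk by (intro rel) linarith+
    also have "Z (k, p + d) = ?e * Z (p + d, k)" by (rule form_space_sym[OF Z])
    also have "- (?e * - (?e * Z (p + d, k))) = ?e * ?e * Z (p + d, k)" by (simp only: mult_minus_right minus_minus mult.assoc)
    finally show ?thesis unfolding e mult_1 .
  qed
  have Yh: "Y (p, k + d) = Y (p + d, k)" if pk: "p < m" "k < m" for p k
  proof -
    have "Y (p, k + d) = ?e * Y (k + d, p)" by (rule form_space_sym[OF Y])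
    also have "Y (k + d, p) = - Z (k + d, p + d)" using pk by (intro rel) linarith+
    also have "Z (k + d, p + d) = ?e * Z (p + d, k + d)" by (rule form_space_sym[OF Z])
    also have "?e * - (?e * Z (p + d, k + d)) = - (?e * ?e * Z (p + d, k + d))"
      by (simp only: mult_minus_right mult.assoc)
    also have "\<dots> = - Z (p + d, k + d)" unfolding e mult_1 ..
    also have "\<dots> = Y (p + d, k)" using pk by (intro rel[symmetric]) linarith+
    finally show ?thesis .
  qed
  show ?thesis unfolding hankel_space_def using Y Z Yh Zh by blast
qed

lemma hankel_unit_basis:
  "inj_on hankel_unit index_set" "fs.independent (hankel_unit ` index_set)"
  "fs.span (hankel_unit ` index_set) = hankel_space"
proof -
  note dual = dual_family_independent[where pos = pos and b = hankel_unit, OF finite_index_set hankel_unit_pos]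
  show "inj_on hankel_unit index_set" "fs.independent (hankel_unit ` index_set)" by (rule dual, assumption+)+
  show "fs.span (hankel_unit ` index_set) = hankel_space"
    by (rule dual_family_span[where pos = pos and b = hankel_unit, OF finite_index_set hankel_unit_pos subspace_hankel_space
          hankel_unit_in_hankel_space hankel_space_separated])
qed

text \<open>The top antidiagonal of each pair is dropped because \<open>SA\<close> kills it; what
  remains indexes the l targets of a horizontal block with l + 1 sources.\<close>

definition low_index_set where
  "low_index_set = {(i, j, c). (i, j) \<in> triangle d \<epsilon> \<and> c < level i + level j}"

text \<open>For the lower antidiagonals \<open>pos\<close> lies in the columns kept by
  \<open>SA\<close>, so evaluation there still gives a dual family.\<close>

lemma SA_hankel_unit_independent:
  "inj_on (\<lambda>x. SA (hankel_unit x)) low_index_set"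
  "fs.independent ((\<lambda>x. SA (hankel_unit x)) ` low_index_set)"
proof -
  have sub: "low_index_set \<subseteq> index_set" by (auto simp: low_index_set_def index_set_def)
  then have fin: "finite low_index_set" using finite_index_set finite_subset by blast
  have dual: "SA (hankel_unit x) (pos y) = (if x = y then 1 else 0)"
    if "x \<in> low_index_set" and y: "y \<in> low_index_set" for x y
  proof -
    obtain i j c where yy: "y = (i, j, c)" by (metis prod_cases3)
    have "y \<in> index_set" using y sub by blast
    note Y = index_setD[OF this[unfolded yy]]
    have c: "c < level i + level j" using y by (simp add: yy low_index_set_def)
    have "min c (level i) * d + i < n" using less_n_iff[OF Y(1)] by simp
    moreover have "c - min c (level i) < level j" using c Y(5) by linarith
    then have "(c - min c (level i)) * d + j < m" by (rule less_mI[OF Y(2)])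
    ultimately have "SA (hankel_unit x) (pos y) = hankel_unit x (pos y)"
      unfolding pos_def yy prod.case SA_apply by (intro if_P conjI)
    also have "\<dots> = (if x = y then 1 else 0)"
      by (rule hankel_unit_pos) (use that sub in blast)+
    finally show ?thesis .
  qed
  show "inj_on (\<lambda>x. SA (hankel_unit x)) low_index_set"
    "fs.independent ((\<lambda>x. SA (hankel_unit x)) ` low_index_set)"
    by (rule dual_family_independent[where pos = pos and b = "\<lambda>x. SA (hankel_unit x)", OF fin dual]; assumption)+
qed

text \<open>Counts the n indices by residue class.\<close>

lemma sum_level: "(\<Sum>i<d. int (level i) + 1) = int n"
proof -
  have "{..<d} = {..<r} \<union> {r..<d}" using r by auto
  then have "(\<Sum>i<d. int (level i) + 1) = (\<Sum>i<r. int (level i) + 1) + (\<Sum>i\<in>{r..<d}. int (level i) + 1)"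
    by (metis finite_atLeastLessThan finite_lessThan ivl_disj_int_one(2) sum.union_disjoint)
  also have "(\<Sum>i<r. int (level i) + 1) = (\<Sum>i<r. int q + 2)"
    by (rule sum.cong) (simp_all add: level_def)
  also have "(\<Sum>i\<in>{r..<d}. int (level i) + 1) = (\<Sum>i\<in>{r..<d}. int q + 1)"
    by (rule sum.cong) (simp_all add: level_def)
  finally show ?thesis using r by (simp add: of_nat_diff algebra_simps)
qed

text \<open>Each pair of residues contributes one chain of Hankel units, with a kernel at either
  end. A dimension count gives 2 (dim G - dim H) = m (m - \<epsilon>) for the complement of the
  Hankel space H in the space G of forms, and leaves no room for vertical indices 1.\<close>

lemma shift_pencil_kronecker_form:
  "\<exists>ps. distinct ps \<and> set ps = triangle d \<epsilon> \<and>
     kronecker_realizable SA SB (form_space n \<epsilon>) (mat_space n m)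
     (map (\<lambda>(i, j). Horizontal_block (Suc (level i + level j))) ps @
       replicate (nat (int m * (int m - \<epsilon>) div 2)) (Vertical_block 2))"
proof -
  obtain ps where ps: "distinct ps" "set ps = triangle d \<epsilon>"
    using finite_distinct_list[OF finite_triangle] by blast
  \<comment> \<open>Decreasing \<open>c\<close> puts the unit killed by \<open>SA\<close> first, as
    the zero column of (0 | I) demands.\<close>
  define XL where "XL = concat (map (\<lambda>(i, j). map (\<lambda>c. (i, j, c)) (rev [0..<Suc (level i + level j)])) ps)"
  define YL where "YL = concat (map (\<lambda>(i, j). map (\<lambda>c. (i, j, c)) (rev [0..<level i + level j])) ps)"
  have distL: "distinct XL" "distinct YL"
    unfolding XL_def YL_def by (rule distinct_concat_triples[OF ps(1)], simp)+
  have setXL: "set XL = index_set"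
    unfolding XL_def index_set_def using ps(2) by (force simp: image_iff)
  have setYL: "set YL = low_index_set"
    unfolding YL_def low_index_set_def using ps(2) by (force simp: image_iff)
  define xs where "xs = map hankel_unit XL"
  define ys where "ys = map (\<lambda>x. SA (hankel_unit x)) YL"
  have xs: "distinct xs" "fs.independent (set xs)" "fs.span (set xs) = hankel_space"
    unfolding xs_def distinct_map set_map setXL using distL hankel_unit_basis by blast+
  have ys: "distinct ys" "fs.independent (set ys)"
    unfolding ys_def distinct_map set_map setYL using distL SA_hankel_unit_independent by blast+
  define u where "u = (\<lambda>(i, j). map (\<lambda>c. hankel_unit (i, j, c)) (rev [0..<Suc (level i + level j)]))"
  define v where "v = (\<lambda>(i, j). map (\<lambda>c. SA (hankel_unit (i, j, c))) (rev [0..<level i + level j]))"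
  have xs_u: "xs = concat (map u ps)"
    unfolding xs_def XL_def u_def map_concat map_map by (rule arg_cong[where f = concat], rule map_cong) auto
  have ys_v: "ys = concat (map v ps)"
    unfolding ys_def YL_def v_def map_concat map_map by (rule arg_cong[where f = concat], rule map_cong) auto
  have blocks: "matrix_rel (u x) (v x) SA (fst (block_pair (case x of (i, j) \<Rightarrow> Horizontal_block (Suc (level i + level j)))))
     \<and> matrix_rel (u x) (v x) SB (snd (block_pair (case x of (i, j) \<Rightarrow> Horizontal_block (Suc (level i + level j)))))" for x
  proof -
    obtain i j where x: "x = (i, j)" by (cases x)
    define l where "l = level i + level j"
    have len: "length (u x) = Suc l" "length (v x) = l"
      unfolding x u_def v_def l_def by simp_all
    have un: "u x ! t = hankel_unit (i, j, l - t)" if "t < Suc l" for t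
      using that unfolding x u_def l_def prod.case
      by (subst nth_map) (simp_all add: rev_nth del: upt_Suc)
    have vn: "v x ! t = SA (hankel_unit (i, j, l - Suc t))" if "t < l" for t
      using that unfolding x v_def l_def prod.case
      by (subst nth_map) (simp_all add: rev_nth del: upt_Suc)
    have A0: "SA (u x ! 0) = 0" using un[of 0] SA_hankel_unit_top l_def by simp
    have A1: "SA (u x ! Suc t) = v x ! t" if "t < l" for t
      using un[of "Suc t"] vn[OF that] that by simp
    have B0: "SB (u x ! l) = 0" using un[of l] SB_hankel_unit_0 by simp
    have B1: "SB (u x ! t) = v x ! t" if t: "t < l" for t
    proof -
      have "SB (u x ! t) = SB (hankel_unit (i, j, Suc (l - Suc t)))"
        using un[of t] t by (simp add: Suc_diff_Suc)
      then show ?thesis using vn[OF t] SB_hankel_unit_Suc by simp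
    qed
    show ?thesis
      unfolding x prod.case l_def[symmetric]
      using matrix_rel_horizontal[where A = SA and B = SB, OF len A0 A1 B0 B1] unfolding x by blast
  qed
  have rel: "block_rel SA SB xs ys (map (\<lambda>(i, j). Horizontal_block (Suc (level i + level j))) ps)"
    unfolding xs_u ys_v by (rule block_rel_concat) (use blocks in blast)+
  obtain BG where BG: "finite BG" "fs.independent BG" "fs.span BG = form_space n \<epsilon>"
    "2 * int (card BG) = int n * (int n + \<epsilon>)"
    using form_space_basis[OF \<epsilon>, of n] by blast
  obtain BV where BV: "finite BV" "fs.independent BV" "fs.span BV = mat_space n m" "card BV = n * m"
    using mat_space_basis by blast
  have shift_car: "shift_mat n m s \<in> carrier_mat n m" for s by (simp add: shift_mat_def)
  have lin: "Vector_Spaces.linear fscale fscale SA" "Vector_Spaces.linear fscale fscale SB"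
    by (rule linear_right_mult[OF shift_car])+
  have xsG: "set xs \<subseteq> form_space n \<epsilon>"
    using xs(3) fs.span_superset[of "set xs"] unfolding hankel_space_def by blast
  have ysH: "\<exists>h\<in>fs.span (set xs). \<exists>h'\<in>fs.span (set xs). y = SA h + SB h'" if yin: "y \<in> set ys" for y
  proof -
    obtain x where x: "y = SA (hankel_unit x)" "x \<in> low_index_set"
      using yin unfolding ys_def set_map setYL by (rule imageE)
    have SB0: "SB 0 = 0"
      using SB_apply[of 0] by (intro ext) (simp add: split_paired_all)
    have "y = SA (hankel_unit x) + SB 0" unfolding SB0 x(1) add_0_right ..
    moreover have "hankel_unit x \<in> fs.span (set xs)"
      unfolding xs(3) by (rule hankel_unit_in_hankel_space)
        (use x(2) in \<open>auto simp: low_index_set_def index_set_def\<close>)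
    ultimately show ?thesis using fs.span_zero by blast
  qed
  define G where "G = (\<lambda>x. int (level (fst x)) + int (level (snd x)))"
  \<comment> \<open>With 2 added, a summand is (level i + 1) + (level j + 1), the sum of two class
    sizes, to which \<open>sum_triangle\<close> and \<open>sum_level\<close> apply.\<close>
  have sumG: "(\<Sum>x\<in>triangle d \<epsilon>. G x + 2) = (int d + \<epsilon>) * int n"
    unfolding sum_level[symmetric] sum_triangle[OF \<epsilon>, symmetric]
    by (rule sum.cong) (auto simp: G_def)
  have "int (length XL) = int (sum_list (map (\<lambda>x. level (fst x) + level (snd x) + 1) ps))"
    unfolding XL_def length_concat map_map
    by (rule arg_cong[where f = int], rule arg_cong[where f = sum_list], rule map_cong) auto
  also have "\<dots> = (\<Sum>x\<in>triangle d \<epsilon>. G x + 1)"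
    unfolding sum_list_distinct_conv_sum_set[OF ps(1)] ps(2) G_def by simp
  also have "\<dots> = (\<Sum>x\<in>triangle d \<epsilon>. G x + 2) - int (card (triangle d \<epsilon>))"
    by (simp add: sum.distrib)
  finally have lenXL: "int (length XL) = (int d + \<epsilon>) * int n - int (card (triangle d \<epsilon>))"
    unfolding sumG .
  have "int (length YL) = int (sum_list (map (\<lambda>x. level (fst x) + level (snd x)) ps))"
    unfolding YL_def length_concat map_map
    by (rule arg_cong[where f = int], rule arg_cong[where f = sum_list], rule map_cong) auto
  also have "\<dots> = (\<Sum>x\<in>triangle d \<epsilon>. G x)"
    unfolding sum_list_distinct_conv_sum_set[OF ps(1)] ps(2) G_def by simp
  also have "\<dots> = (\<Sum>x\<in>triangle d \<epsilon>. G x + 2) - 2 * int (card (triangle d \<epsilon>))"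
    by (simp add: sum.distrib)
  finally have lenYL: "int (length YL) = int (length XL) - int (card (triangle d \<epsilon>))"
    unfolding sumG lenXL by simp
  note tri = card_triangle[OF \<epsilon>, of d]
  define M N X T where "M = int m" and "N = int n" and "X = int (length XL)"
    and "T = int (card (triangle d \<epsilon>))"
  have N: "N = M + int d" by (simp add: M_def N_def)
  have X: "X = (int d + \<epsilon>) * N - T" and T: "2 * T = int d * (int d + \<epsilon>)"
    using lenXL tri by (simp_all only: X_def N_def T_def)
  have G: "2 * int (card BG) = N * (N + \<epsilon>)" using BG(4) by (simp only: N_def)
  have K: "2 * (int (card BG) - X) = M * (M - \<epsilon>)"
  proof -
    have "2 * (int (card BG) - X) = N * (N + \<epsilon>) - 2 * ((int d + \<epsilon>) * N) + int d * (int d + \<epsilon>)"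
      unfolding right_diff_distrib G X T by simp
    then show ?thesis unfolding N by (simp add: algebra_simps)
  qed
  have ge: "0 \<le> M * (M - \<epsilon>)"
  proof (cases "m = 0")
    case True
    then have "M = 0" unfolding M_def by (simp only: of_nat_0)
    then show ?thesis by simp
  next
    case False
    then have "1 \<le> M" unfolding M_def by linarith
    then show ?thesis using \<epsilon> by (intro mult_nonneg_nonneg) auto
  qed
  have K': "card BG - length xs = nat (int m * (int m - \<epsilon>) div 2)"
  proof -
    have "nat (M * (M - \<epsilon>) div 2) = nat (int (card BG) - int (length XL))"
      unfolding K[symmetric] X_def by simp
    then show ?thesis unfolding xs_def M_def by simp
  qed
  \<comment> \<open>The images of the chains and of the complement already fill the n * m dimensions
    of the target.\<close>
  have rest: "card BV - length ys - 2 * (card BG - length xs) = 0"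
  proof -
    have "int (card BV) = N * M" unfolding BV(4) N_def M_def by (simp only: of_nat_mult)
    moreover have "N * M = (X - T) + 2 * (int (card BG) - X)"
    proof -
      have "(X - T) + M * (M - \<epsilon>) = (int d + \<epsilon>) * N - 2 * T + M * (M - \<epsilon>)" unfolding X by simp
      also have "\<dots> = N * M" unfolding T N by (simp add: algebra_simps)
      finally show ?thesis unfolding K by simp
    qed
    moreover have "int (length YL) = X - T" using lenYL by (simp only: X_def T_def)
    ultimately have BVe: "int (card BV) = int (length YL) + 2 * (int (card BG) - X)" by (metis (no_types))
    have "0 \<le> 2 * (int (card BG) - X)" unfolding K by (rule ge)
    then have "length XL \<le> card BG" unfolding X_def by simp
    then have "int (card BG) - X = int (card BG - length XL)" unfolding X_def by (rule of_nat_diff[symmetric])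
    then have "int (card BV) = int (length YL + 2 * (card BG - length XL))" unfolding BVe by simp
    then have "card BV = length YL + 2 * (card BG - length XL)" by (rule of_nat_eq_iff[THEN iffD1])
    then show ?thesis unfolding xs_def ys_def length_map by simp
  qed
  have maps: "SA ` form_space n \<epsilon> \<subseteq> mat_space n m" "SB ` form_space n \<epsilon> \<subseteq> mat_space n m"
    using right_mult_in_mat_space[OF shift_car] by blast+
  have key: "Y \<in> fs.span (set xs) \<and> Z \<in> fs.span (set xs)"
    if "Y \<in> form_space n \<epsilon>" "Z \<in> form_space n \<epsilon>" "SA Y + SB Z = 0" for Y Z
    unfolding xs(3) using that by (rule kernel_in_hankel_space)
  let ?bs = "map (\<lambda>(i, j). Horizontal_block (Suc (level i + level j))) ps"
  have "kronecker_realizable SA SB (form_space n \<epsilon>) (mat_space n m)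
     (?bs @ replicate (card BG - length xs) (Vertical_block 2) @
        replicate (card BV - length ys - 2 * (card BG - length xs)) (Vertical_block 1))"
    by (rule kronecker_decomposition[where A = SA and B = SB and BG = BG and BV = BV and xs = xs
          and ys = ys and bs = ?bs])
      (fact lin BG BV maps xs(1,2) xsG ys rel | erule ysH | erule (2) key)+
  moreover have "replicate (card BG - length xs) (Vertical_block 2) @
      replicate (card BV - length ys - 2 * (card BG - length xs)) (Vertical_block 1) =
      replicate (nat (int m * (int m - \<epsilon>) div 2)) (Vertical_block 2)"
    unfolding rest unfolding K' replicate_0 append_Nil2 ..
  ultimately have "kronecker_realizable SA SB (form_space n \<epsilon>) (mat_space n m)
     (?bs @ replicate (nat (int m * (int m - \<epsilon>) div 2)) (Vertical_block 2))"
    by (rule back_subst[where P = "\<lambda>r. kronecker_realizable SA SB (form_space n \<epsilon>) (mat_space n m) (?bs @ r)"])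
  with ps show ?thesis by (intro exI conjI)
qed

end

section \<open>Counting the horizontal indices\<close>

context hankel
begin

text \<open>The triangle splits by how many of the two residues lie below r, hence have level q + 1
  instead of q: none, one or two. In the mixed case the smaller residue j is the one below
  r.\<close>

lemma horizontal_index_multiset:
  assumes ps: "distinct ps" "set ps = triangle d \<epsilon>"
  shows "mset (map (\<lambda>(i, j). Suc (level i + level j)) ps) =
     replicate_mset (card (triangle (d - r) \<epsilon>)) (2 * q + 1) +
     replicate_mset ((d - r) * r) (2 * q + 2) + replicate_mset (card (triangle r \<epsilon>)) (2 * q + 3)"
proof -
  let ?f = "\<lambda>(i, j). Suc (level i + level j)"
  let ?T1 = "(\<lambda>(i, j). (i + r, j + r)) ` triangle (d - r) \<epsilon>" and ?T2 = "{r..<d} \<times> {..<r}"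
    and ?T3 = "triangle r \<epsilon>"
  have inT1: "(i, j) \<in> ?T1" if "(i, j) \<in> triangle d \<epsilon>" "r \<le> j" for i j
  proof -
    have "(i - r, j - r) \<in> triangle (d - r) \<epsilon>" using that by (auto simp: triangle_def)
    moreover have "r \<le> i" using that by (auto simp: triangle_def)
    ultimately show ?thesis using that(2) by (auto simp: image_iff intro!: bexI[of _ "(i - r, j - r)"])
  qed
  have T: "triangle d \<epsilon> = ?T1 \<union> (?T2 \<union> ?T3)"
  proof
    show "triangle d \<epsilon> \<subseteq> ?T1 \<union> (?T2 \<union> ?T3)"
    proof
      fix x assume x: "x \<in> triangle d \<epsilon>"
      obtain i j where ij: "x = (i, j)" by (cases x)
      show "x \<in> ?T1 \<union> (?T2 \<union> ?T3)"
      proof (cases "r \<le> j")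
        case True
        then show ?thesis using inT1[of i j] x unfolding ij by blast
      next
        case False
        then have "(i, j) \<in> ?T2 \<union> ?T3" using x unfolding ij triangle_def by auto
        then show ?thesis unfolding ij by blast
      qed
    qed
    show "?T1 \<union> (?T2 \<union> ?T3) \<subseteq> triangle d \<epsilon>" using r by (auto simp: triangle_def)
  qed
  have disj: "?T1 \<inter> (?T2 \<union> ?T3) = {}" "?T2 \<inter> ?T3 = {}" by (auto simp: triangle_def)
  have "mset (map ?f ps) = image_mset ?f (mset_set (triangle d \<epsilon>))"
    unfolding mset_map ps(2)[symmetric] mset_set_set[OF ps(1)] ..
  also have "\<dots> = image_mset ?f (mset_set ?T1) + (image_mset ?f (mset_set ?T2) + image_mset ?f (mset_set ?T3))"
    unfolding T by (subst mset_set_Union; (simp add: disj)?) (subst mset_set_Union; simp add: disj)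
  also have "image_mset ?f (mset_set ?T1) = replicate_mset (card ?T1) (2 * q + 1)"
    by (rule image_mset_constant_on) (auto simp: level_def)
  also have "card ?T1 = card (triangle (d - r) \<epsilon>)"
    by (rule card_image) (auto simp: inj_on_def)
  also have "image_mset ?f (mset_set ?T2) = replicate_mset (card ?T2) (2 * q + 2)"
    by (rule image_mset_constant_on) (auto simp: level_def)
  also have "card ?T2 = (d - r) * r" by (simp add: card_cartesian_product)
  also have "image_mset ?f (mset_set ?T3) = replicate_mset (card ?T3) (2 * q + 3)"
    by (rule image_mset_constant_on) (auto simp: level_def triangle_def)
  finally show ?thesis by (simp only: add.assoc)
qed

end

section \<open>Generic pairs with fewer columns than rows\<close>

abbreviation pair_space :: "nat \<Rightarrow> nat \<Rightarrow> (complex, complex mat \<times> complex mat) module" where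
  "pair_space n m \<equiv> direct_sum (module_mat TYPE(complex) n m) (module_mat TYPE(complex) n m)"

lemma det_nonzero_inverse:
  fixes M :: "complex mat"
  assumes M: "M \<in> carrier_mat N N" and det: "det M \<noteq> 0"
  obtains M' where "M' \<in> carrier_mat N N" "M * M' = 1\<^sub>m N" "M' * M = 1\<^sub>m N"
proof -
  let ?M' = "inverse (det M) \<cdot>\<^sub>m adj_mat M"
  note adj = adj_mat[OF M]
  have one: "inverse (det M) \<cdot>\<^sub>m (det M \<cdot>\<^sub>m 1\<^sub>m N) = 1\<^sub>m N"
    using det by (intro eq_matI) auto
  have "M * ?M' = 1\<^sub>m N"
    unfolding mult_smult_distrib[OF M adj(1)] adj(2) by (rule one)
  moreover have "?M' * M = 1\<^sub>m N"
    unfolding mult_smult_assoc_mat[OF adj(1) M] adj(3) by (rule one)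
  ultimately show thesis using that adj(1) by (metis smult_carrier_mat)
qed

text \<open>The transpose of the linear system for the columns \<open>w\<^sub>k\<close> of \<open>W\<close>, namely \<open>A w\<^bsub>k+d\<^esub> = B w\<^sub>k\<close>, is injective
  at the pair of shifts. The relation moves an entry along its diagonal; following it towards the nearer
  end of the diagonal gives 0.\<close>

lemma shift_dual_zero:
  fixes c :: "nat \<times> nat \<Rightarrow> complex"
  assumes d: "0 < d"
    and rel: "\<And>i l. i < m \<Longrightarrow> l < m \<Longrightarrow>
       (if d \<le> l then c (i, l - d) else 0) = (if l + d < m then c (i + d, l) else 0)"
  shows "p < m + d \<Longrightarrow> k + d < m \<Longrightarrow> c (p, k) = 0"
proof (cases "k div d < p div d")
  case True
  have "k div d < p div d \<Longrightarrow> p < m + d \<Longrightarrow> k + d < m \<Longrightarrow> c (p, k) = 0" for p k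
  proof (induction k arbitrary: p rule: less_induct)
    case (less k)
    have dp: "d \<le> p"
    proof (rule ccontr)
      assume "\<not> d \<le> p"
      then have "p div d = 0" by simp
      then show False using less.prems(1) by simp
    qed
    then have "c (p, k) = (if d \<le> k then c (p - d, k - d) else 0)"
      using rel[of "p - d" k] less.prems by simp
    also have "\<dots> = 0"
    proof (cases "d \<le> k")
      case True
      have "(k - d) div d < (p - d) div d"
        using less.prems(1) True dp d by (simp add: le_div_geq)
      then have "c (p - d, k - d) = 0"
        using True d less.prems by (intro less.IH) auto
      then show ?thesis by simp
    qed simp
    finally show ?case .
  qed
  then show "p < m + d \<Longrightarrow> k + d < m \<Longrightarrow> c (p, k) = 0" using True by blast
next
  case False
  have "p div d \<le> k div d \<Longrightarrow> k + d < m \<Longrightarrow> c (p, k) = 0" for p k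
  proof (induction "m - k" arbitrary: p k rule: less_induct)
    case less
    have "p < (k div d + 1) * d" using less.prems(1) d by (meson div_less_iff_less_mult less_add_one order_le_less_trans)
    also have "\<dots> \<le> k + d" by simp
    finally have pm: "p < m" using less.prems(2) by simp
    have "c (p, k) = (if k + d + d < m then c (p + d, k + d) else 0)"
      using rel[of p "k + d"] pm less.prems(2) by simp
    also have "\<dots> = 0"
    proof (cases "k + d + d < m")
      case True
      have "c (p + d, k + d) = 0"
        using True d less.prems by (intro less.hyps) auto
      then show ?thesis by simp
    qed simp
    finally show ?case .
  qed
  then show "k + d < m \<Longrightarrow> c (p, k) = 0" using False by simp
qed

lemma shift_mat_index: "p < n \<Longrightarrow> i < m \<Longrightarrow> shift_mat n m s $$ (p, i) = (if p = i + s then 1 else 0)"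
  by (simp add: shift_mat_def)

lemma shift_mat_carrier: "shift_mat n m s \<in> carrier_mat n m"
  by (simp add: shift_mat_def)

lemma mult_shift_mat_index:
  assumes "U \<in> carrier_mat N n" "m + s \<le> n" "p < N" "k < m"
  shows "(U * shift_mat n m s) $$ (p, k) = U $$ (p, k + s)"
proof -
  have "(U * shift_mat n m s) $$ (p, k) = (\<Sum>j<n. U $$ (p, j) * (if j = k + s then 1 else 0))"
    using assms by (simp add: shift_mat_def scalar_prod_def lessThan_atLeast0)
  also have "\<dots> = U $$ (p, k + s)" using assms by (simp add: if_distrib cong: if_cong)
  finally show ?thesis .
qed

lemma mult_mat_index:
  fixes A :: "complex mat"
  assumes "A \<in> carrier_mat n m" "p < n" "k < l"
  shows "(A * mat m l f) $$ (p, k) = (\<Sum>i<m. A $$ (p, i) * f (i, k))"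
  using assms by (simp add: scalar_prod_def lessThan_atLeast0)

text \<open>The unknowns are the columns w_k of W in A w_(k+d) = B w_k, with one scalar equation for
  each coordinate \<open>p\<close>. At the shifts W = 1 is a solution and the transposed system is
  injective, so \<open>polynomial_kernel\<close> extends this solution to all pairs.\<close>

lemma shift_equation_polynomial_solution:
  fixes m d :: nat
  assumes d: "0 < d"
  defines "x0 \<equiv> (shift_mat (m + d) m 0, shift_mat (m + d) m d)"
  obtains z where "\<And>i l. i < m \<Longrightarrow> l < m \<Longrightarrow> (\<lambda>x. z x (i, l)) \<in> polynomial_functions (pair_space (m + d) m)"
    and "\<And>x p k. p < m + d \<Longrightarrow> k + d < m \<Longrightarrow>
       (\<Sum>i<m. fst x $$ (p, i) * z x (i, k + d)) = (\<Sum>i<m. snd x $$ (p, i) * z x (i, k))"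
    and "\<And>i l. z x0 (i, l) = (if i = l then 1 else 0)"
proof -
  let ?n = "m + d"
  define I where "I = {..<m} \<times> {..<m}"
  define E where "E = {..<?n} \<times> {..<m - d}"
  define L :: "complex mat \<times> complex mat \<Rightarrow> nat \<times> nat \<Rightarrow> nat \<times> nat \<Rightarrow> complex"
    where "L x e i = (if snd i = snd e + d then fst x $$ (fst e, fst i) else 0) -
                     (if snd i = snd e then snd x $$ (fst e, fst i) else 0)" for x e i
  have fin: "finite E" "finite I" by (simp_all add: E_def I_def)
  have poly: "(\<lambda>x. L x e i) \<in> polynomial_functions (pair_space ?n m)" if "e \<in> E" "i \<in> I" for e i
  proof -
    have ei: "fst e < ?n" "fst i < m" using that by (auto simp: E_def I_def)
    show ?thesis
      unfolding L_def
    proof (rule polynomial_functions_diff)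
      show "(\<lambda>x. if snd i = snd e + d then fst x $$ (fst e, fst i) else 0) \<in> polynomial_functions (pair_space ?n m)"
        using polynomial_functions_entry(1)[OF ei] polynomial_functions.const
        by (cases "snd i = snd e + d") auto
      show "(\<lambda>x. if snd i = snd e then snd x $$ (fst e, fst i) else 0) \<in> polynomial_functions (pair_space ?n m)"
        using polynomial_functions_entry(2)[OF ei] polynomial_functions.const
        by (cases "snd i = snd e") auto
    qed
  qed
  have apply_L: "(\<Sum>i\<in>I. L x (p, k) i * z i) =
      (\<Sum>i<m. fst x $$ (p, i) * z (i, k + d)) - (\<Sum>i<m. snd x $$ (p, i) * z (i, k))"
    if "k + d < m" for x p k and z :: "nat \<times> nat \<Rightarrow> complex"
  proof -
    have "(\<Sum>l<m. L x (p, k) (i, l) * z (i, l)) = fst x $$ (p, i) * z (i, k + d) - snd x $$ (p, i) * z (i, k)" for i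
    proof -
      have "(\<Sum>l<m. L x (p, k) (i, l) * z (i, l)) =
         (\<Sum>l<m. (if l = k + d then fst x $$ (p, i) * z (i, l) else 0) - (if l = k then snd x $$ (p, i) * z (i, l) else 0))"
        by (rule sum.cong) (auto simp: L_def left_diff_distrib)
      then show ?thesis using that by (simp add: sum_subtractf)
    qed
    moreover have "(\<Sum>i\<in>I. g i) = (\<Sum>i<m. \<Sum>l<m. g (i, l))" for g :: "nat \<times> nat \<Rightarrow> complex"
      unfolding I_def sum.cartesian_product by (rule sum.cong) auto
    ultimately show ?thesis by (simp only: sum_subtractf)
  qed
  have dual: "c e = 0"
    if c: "\<And>i. i \<in> I \<Longrightarrow> (\<Sum>e\<in>E. c e * L x0 e i) = 0" and e: "e \<in> E" for c e
  proof -
    \<comment> \<open>The coefficient of the unknown (i, l) is read off: at the shifts it occurs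
      only in the equations (i, l - d) and (i + d, l).\<close>
    have rel: "(if d \<le> l then c (i, l - d) else 0) = (if l + d < m then c (i + d, l) else 0)"
      if il: "i < m" "l < m" for i l
    proof -
      \<comment> \<open>The guard excludes the case l < d, in which l - d is truncated to 0.\<close>
      let ?g = "\<lambda>e. if d \<le> l then c e else 0"
      have summand: "c e * L x0 e (i, l) = (if e = (i, l - d) then ?g e else 0) - (if e = (i + d, l) then c e else 0)"
        if eE: "e \<in> E" for e
      proof -
        obtain p k where pk: "e = (p, k)" by (cases e)
        have "p < ?n" "k + d < m" using eE unfolding pk E_def by auto
        then have Lv: "L x0 e (i, l) = (if l = k + d then if p = i then 1 else 0 else 0) -
            (if l = k then if p = i + d then 1 else 0 else 0)"
          unfolding pk L_def x0_def fst_conv snd_conv using il by (simp only: shift_mat_index add_0_right)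
        have iff: "e = (i, l - d) \<and> d \<le> l \<longleftrightarrow> l = k + d \<and> p = i" "e = (i + d, l) \<longleftrightarrow> l = k \<and> p = i + d"
          unfolding pk prod.inject by linarith+
        have gen: "a * ((if P1 then if P2 then 1 else 0 else 0) - (if Q1 then if Q2 then 1 else 0 else 0)) =
            (if E1 then if D then a else 0 else 0) - (if F then a else 0)"
          if "E1 \<and> D \<longleftrightarrow> P1 \<and> P2" "F \<longleftrightarrow> Q1 \<and> Q2" for P1 P2 Q1 Q2 E1 D F and a :: complex
          using that by auto
        show ?thesis unfolding Lv by (rule gen[OF iff])
      qed
      have "0 = (\<Sum>e\<in>E. c e * L x0 e (i, l))" by (rule c[symmetric]) (use il in \<open>simp add: I_def\<close>)
      also have "\<dots> = (\<Sum>e\<in>E. (if e = (i, l - d) then ?g e else 0) - (if e = (i + d, l) then c e else 0))"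
        by (rule sum.cong[OF refl summand])
      also have "\<dots> = (if (i, l - d) \<in> E then ?g (i, l - d) else 0) - (if (i + d, l) \<in> E then c (i + d, l) else 0)"
        unfolding sum_subtractf sum.delta[OF fin(1)] ..
      also have "(if (i, l - d) \<in> E then ?g (i, l - d) else 0) = ?g (i, l - d)"
      proof (cases "d \<le> l")
        case True
        then have "(i, l - d) \<in> E" using il by (simp add: E_def)
        then show ?thesis by (rule if_P)
      qed simp
      also have "(i + d, l) \<in> E \<longleftrightarrow> l + d < m" using il by (auto simp: E_def)
      finally show ?thesis by (rule iffD2[OF eq_iff_diff_eq_0, OF sym])
    qed
    obtain p k where pk: "e = (p, k)" by (cases e)
    show ?thesis
      unfolding pk by (rule shift_dual_zero[OF d rel]) (use e pk in \<open>auto simp: E_def\<close>)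
  qed
  define z0 :: "nat \<times> nat \<Rightarrow> complex" where "z0 i = (if fst i = snd i then 1 else 0)" for i
  have sol: "(\<Sum>i\<in>I. L x0 e i * z0 i) = 0" if e: "e \<in> E" for e
  proof -
    obtain p k where pk: "e = (p, k)" by (cases e)
    have k: "k + d < m" "p < ?n" using e pk by (auto simp: E_def)
    have "(\<Sum>i<m. fst x0 $$ (p, i) * z0 (i, k + d)) = (\<Sum>i<m. if i = k + d then if p = i then 1 else 0 else 0)"
      by (rule sum.cong) (use k in \<open>auto simp: x0_def shift_mat_index z0_def\<close>)
    moreover have "(\<Sum>i<m. snd x0 $$ (p, i) * z0 (i, k)) = (\<Sum>i<m. if i = k then if p = i + d then 1 else 0 else 0)"
      by (rule sum.cong) (use k in \<open>auto simp: x0_def shift_mat_index z0_def\<close>)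
    ultimately show ?thesis unfolding pk apply_L[OF k(1)] using k by simp
  qed
  show thesis
  proof (rule polynomial_kernel[where L = L and E = E and I = I and W = "pair_space ?n m" and ?x0.0 = x0 and ?z0.0 = z0])
    fix c e assume "\<And>i. i \<in> I \<Longrightarrow> (\<Sum>e\<in>E. c e * L x0 e i) = 0" "e \<in> E"
    then show "c e = 0" by (rule dual)
  next
    fix z assume z: "\<And>i. i \<in> I \<Longrightarrow> (\<lambda>x. z x i) \<in> polynomial_functions (pair_space ?n m)"
      "\<And>x e. e \<in> E \<Longrightarrow> (\<Sum>i\<in>I. L x e i * z x i) = 0" "\<And>i. z x0 i = z0 i"
    show thesis
    proof (rule that)
      show "(\<lambda>x. z x (i, l)) \<in> polynomial_functions (pair_space ?n m)" if "i < m" "l < m" for i l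
        by (rule z(1)) (use that in \<open>simp add: I_def\<close>)
      show "(\<Sum>i<m. fst x $$ (p, i) * z x (i, k + d)) = (\<Sum>i<m. snd x $$ (p, i) * z x (i, k))"
        if "p < ?n" "k + d < m" for x p k
      proof -
        have "(p, k) \<in> E" using that by (simp add: E_def)
        from z(2)[OF this, of x] show ?thesis unfolding apply_L[OF that(2)] by simp
      qed
      show "z x0 (i, l) = (if i = l then 1 else 0)" for i l
        unfolding z(3) z0_def by simp
    qed
  qed (fact fin poly sol | erule (1) poly | erule sol)+
qed

text \<open>Stated as A W = U A0 with explicit two-sided inverses, since U and W are what the
  constructions yield directly.\<close>

definition strictly_equivalent ::
  "nat \<Rightarrow> nat \<Rightarrow> complex mat \<Rightarrow> complex mat \<Rightarrow> complex mat \<Rightarrow> complex mat \<Rightarrow> bool" where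
  "strictly_equivalent n m A B A0 B0 \<longleftrightarrow> (\<exists>U U' W W'.
     U \<in> carrier_mat n n \<and> U' \<in> carrier_mat n n \<and> U * U' = 1\<^sub>m n \<and> U' * U = 1\<^sub>m n \<and>
     W \<in> carrier_mat m m \<and> W' \<in> carrier_mat m m \<and> W * W' = 1\<^sub>m m \<and> W' * W = 1\<^sub>m m \<and>
     A * W = U * A0 \<and> B * W = U * B0)"

text \<open>The columns of U are A w_k for k < m and B w_(k-d) for k \<ge> d; where both apply they
  agree by the equation for W. So A W and B W are U times the two shifts by construction. At the
  shifts U = 1, and the polynomial is det U.\<close>

lemma generic_pair_shift_form:
  fixes m d :: nat
  assumes d: "0 < d"
  obtains p where "p \<in> polynomial_functions (pair_space (m + d) m)"
    and "p (shift_mat (m + d) m 0, shift_mat (m + d) m d) \<noteq> 0"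
    and "\<And>A B. A \<in> carrier_mat (m + d) m \<Longrightarrow> B \<in> carrier_mat (m + d) m \<Longrightarrow> p (A, B) \<noteq> 0 \<Longrightarrow>
      strictly_equivalent (m + d) m A B (shift_mat (m + d) m 0) (shift_mat (m + d) m d)"
proof -
  let ?n = "m + d"
  define x0 where "x0 = (shift_mat ?n m 0, shift_mat ?n m d)"
  obtain z where z: "\<And>i l. i < m \<Longrightarrow> l < m \<Longrightarrow> (\<lambda>x. z x (i, l)) \<in> polynomial_functions (pair_space ?n m)"
    and zk: "\<And>x p k. p < ?n \<Longrightarrow> k + d < m \<Longrightarrow>
       (\<Sum>i<m. fst x $$ (p, i) * z x (i, k + d)) = (\<Sum>i<m. snd x $$ (p, i) * z x (i, k))"
    and z0: "\<And>i l. z x0 (i, l) = (if i = l then 1 else 0)"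
    by (rule shift_equation_polynomial_solution[OF d, of m, folded x0_def]) (rule that)
  \<comment> \<open>If d > m, the columns from m to d - 1 are reached by neither shift and are
    filled with unit vectors.\<close>
  define U where "U x = mat ?n ?n (\<lambda>(p, k). if k < m then (\<Sum>i<m. fst x $$ (p, i) * z x (i, k))
     else if d \<le> k then (\<Sum>i<m. snd x $$ (p, i) * z x (i, k - d)) else if p = k then 1 else 0)" for x
  have U: "U x \<in> carrier_mat ?n ?n" for x by (simp add: U_def)
  have U1: "U x $$ (p, k) = (\<Sum>i<m. fst x $$ (p, i) * z x (i, k))" if "p < ?n" "k < m" for x p k
    using that by (simp add: U_def)
  have U2: "U x $$ (p, k + d) = (\<Sum>i<m. snd x $$ (p, i) * z x (i, k))" if "p < ?n" "k < m" for x p k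
  proof (cases "k + d < m")
    case True
    have "U x $$ (p, k + d) = (\<Sum>i<m. fst x $$ (p, i) * z x (i, k + d))" using that(1) True by (rule U1)
    then show ?thesis unfolding zk[OF that(1) True] .
  next
    case False
    then show ?thesis using that by (simp add: U_def)
  qed
  have U3: "U x $$ (p, k) = (if p = k then 1 else 0)" if "p < ?n" "m \<le> k" "k < d" for x p k
    using that by (simp add: U_def)
  show thesis
  proof (rule that)
    show "(\<lambda>x. det (U x)) \<in> polynomial_functions (pair_space ?n m)"
    proof (rule polynomial_functions_det[OF U])
      fix p k assume pk: "p < ?n" "k < ?n"
      consider "k < m" | l where "k = l + d" "l < m" | "m \<le> k" "k < d"
        by (metis add_diff_inverse_nat add.commute not_less pk(2) nat_add_left_cancel_less)
      then show "(\<lambda>x. U x $$ (p, k)) \<in> polynomial_functions (pair_space ?n m)"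
      proof cases
        case 1
        show ?thesis
          unfolding U1[OF pk(1) 1]
          by (intro polynomial_functions_sum polynomial_functions.mult polynomial_functions_entry z pk 1) auto
      next
        case (2 l)
        show ?thesis
          unfolding 2(1) U2[OF pk(1) 2(2)]
          by (intro polynomial_functions_sum polynomial_functions.mult polynomial_functions_entry z pk 2) auto
      next
        case 3
        show ?thesis unfolding U3[OF pk(1) 3] by (rule polynomial_functions.const)
      qed
    qed
    have "U x0 = 1\<^sub>m ?n"
    proof (rule eq_matI)
      fix p k assume "p < dim_row (1\<^sub>m ?n :: complex mat)" "k < dim_col (1\<^sub>m ?n :: complex mat)"
      then have pk: "p < ?n" "k < ?n" by simp_all
      consider "k < m" | l where "k = l + d" "l < m" | "m \<le> k" "k < d"
        by (metis add_diff_inverse_nat add.commute not_less pk(2) nat_add_left_cancel_less)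
      then have "U x0 $$ (p, k) = (if p = k then 1 else 0)"
      proof cases
        case 1
        have "U x0 $$ (p, k) = (\<Sum>i<m. if i = k then if p = i then 1 else 0 else 0)"
          unfolding U1[OF pk(1) 1] x0_def fst_conv
          by (rule sum.cong) (use pk in \<open>simp_all add: shift_mat_index z0[unfolded x0_def]\<close>)
        then show ?thesis using 1 by simp
      next
        case (2 l)
        have "U x0 $$ (p, k) = (\<Sum>i<m. if i = l then if p = i + d then 1 else 0 else 0)"
          unfolding 2(1) U2[OF pk(1) 2(2)] x0_def snd_conv
          by (rule sum.cong) (use pk in \<open>simp_all add: shift_mat_index z0[unfolded x0_def]\<close>)
        then show ?thesis using 2 by simp
      next
        case 3
        then show ?thesis using U3[OF pk(1)] by simp
      qed
      then show "U x0 $$ (p, k) = 1\<^sub>m ?n $$ (p, k)" using pk by simp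
    qed (simp_all add: U_def)
    then show "det (U (shift_mat ?n m 0, shift_mat ?n m d)) \<noteq> 0"
      unfolding x0_def by simp
  next
    fix A B :: "complex mat"
    assume A: "A \<in> carrier_mat ?n m" and B: "B \<in> carrier_mat ?n m" and det: "det (U (A, B)) \<noteq> 0"
    define V where "V = U (A, B)"
    have V: "V \<in> carrier_mat ?n ?n" unfolding V_def by (rule U)
    define W where "W = mat m m (z (A, B))"
    have W: "W \<in> carrier_mat m m" by (simp add: W_def)
    obtain V' where V': "V' \<in> carrier_mat ?n ?n" "V * V' = 1\<^sub>m ?n" "V' * V = 1\<^sub>m ?n"
      using det_nonzero_inverse[OF V] det unfolding V_def by blast
    have AW: "A * W = V * shift_mat ?n m 0"
    proof (rule eq_matI)
      fix p k assume "p < dim_row (V * shift_mat ?n m 0)" "k < dim_col (V * shift_mat ?n m 0)"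
      then have pk: "p < ?n" "k < m" using V by (simp_all add: shift_mat_def)
      have "(A * W) $$ (p, k) = V $$ (p, k)"
        unfolding W_def mult_mat_index[OF A pk] V_def U1[OF pk] by simp
      then show "(A * W) $$ (p, k) = (V * shift_mat ?n m 0) $$ (p, k)"
        using mult_shift_mat_index[OF V _ pk, of 0] by simp
    qed (use A V in \<open>simp_all add: W_def shift_mat_def\<close>)
    have BW: "B * W = V * shift_mat ?n m d"
    proof (rule eq_matI)
      fix p k assume "p < dim_row (V * shift_mat ?n m d)" "k < dim_col (V * shift_mat ?n m d)"
      then have pk: "p < ?n" "k < m" using V by (simp_all add: shift_mat_def)
      have "(B * W) $$ (p, k) = V $$ (p, k + d)"
        unfolding W_def mult_mat_index[OF B pk] V_def U2[OF pk] by simp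
      then show "(B * W) $$ (p, k) = (V * shift_mat ?n m d) $$ (p, k)"
        using mult_shift_mat_index[OF V _ pk, of d] by simp
    qed (use B V in \<open>simp_all add: W_def shift_mat_def\<close>)
    \<comment> \<open>\<open>S\<close> is a left inverse of the shift by 0, so
      \<open>S * V' * A\<close> is a left inverse of \<open>W\<close>: invertibility of W follows
      from that of U.\<close>
    define S where "S = mat m ?n (\<lambda>(i, j). if i = j then 1 else 0 :: complex)"
    have S: "S \<in> carrier_mat m ?n" by (simp add: S_def)
    have "S * V' * A * W = 1\<^sub>m m"
    proof -
      have SV: "S * V' \<in> carrier_mat m ?n" using S V' by simp
      have "S * V' * A * W = S * V' * (A * W)" by (rule assoc_mult_mat[OF SV A W])
      also have "\<dots> = S * (V' * (V * shift_mat ?n m 0))"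
        unfolding AW by (rule assoc_mult_mat[OF S V'(1)]) (use V shift_mat_carrier in auto)
      also have "V' * (V * shift_mat ?n m 0) = V' * V * shift_mat ?n m 0"
        by (rule assoc_mult_mat[OF V'(1) V shift_mat_carrier, symmetric])
      also have "\<dots> = shift_mat ?n m 0"
        unfolding V'(3) by (rule left_mult_one_mat[OF shift_mat_carrier])
      also have "S * shift_mat ?n m 0 = 1\<^sub>m m"
      proof (rule eq_matI)
        fix i k assume "i < dim_row (1\<^sub>m m :: complex mat)" "k < dim_col (1\<^sub>m m :: complex mat)"
        then have ik: "i < m" "k < m" by simp_all
        show "(S * shift_mat ?n m 0) $$ (i, k) = 1\<^sub>m m $$ (i, k)"
          using mult_shift_mat_index[OF S _ ik, of 0] ik by (simp add: S_def)
      qed (simp_all add: S_def shift_mat_def)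
      finally show ?thesis .
    qed
    then have "det (S * V' * A) * det W = 1"
      using det_mult[of "S * V' * A" m W] S V' A W by simp
    then have "det W \<noteq> 0" by auto
    then obtain W' where W': "W' \<in> carrier_mat m m" "W * W' = 1\<^sub>m m" "W' * W = 1\<^sub>m m"
      using det_nonzero_inverse[OF W] by blast
    show "strictly_equivalent ?n m A B (shift_mat ?n m 0) (shift_mat ?n m d)"
      unfolding strictly_equivalent_def
      by (rule exI[of _ V], rule exI[of _ V'], rule exI[of _ W], rule exI[of _ W'])
        (intro conjI V V' W W' AW BW)
  qed
qed

section \<open>From Kronecker forms of normal forms to invariants\<close>

lemma type_of_singular_blocks:
  "type_of_blocks (map Horizontal_block hs @ map Vertical_block vs) =
     \<lparr> jordan_sizes = {#}, horizontal_indices = mset hs, vertical_indices = mset vs \<rparr>"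
proof -
  let ?bs = "map Horizontal_block hs @ map Vertical_block vs"
  have "[h. Horizontal_block h \<leftarrow> map Vertical_block vs] = []" by (induction vs) auto
  moreover have "[h. Horizontal_block h \<leftarrow> map Horizontal_block hs] = hs" by (induction hs) auto
  moreover have "[v. Vertical_block v \<leftarrow> map Horizontal_block hs] = []" by (induction hs) auto
  moreover have "[v. Vertical_block v \<leftarrow> map Vertical_block vs] = vs" by (induction vs) auto
  moreover have "{e. \<exists>k. Jordan_block e k \<in> set ?bs} = {}" by auto
  ultimately show ?thesis unfolding type_of_blocks_def by simp
qed

lemma form_algebra_pencil_type:
  fixes A B :: "complex mat"
  assumes J: "J \<in> carrier_mat n n" "J' \<in> carrier_mat n n" "J * J' = 1\<^sub>m n" "J' * J = 1\<^sub>m n"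
    and equiv: "strictly_equivalent n m A B A0 B0"
    and car: "A \<in> carrier_mat n m" "B \<in> carrier_mat n m" "A0 \<in> carrier_mat n m" "B0 \<in> carrier_mat n m"
    and form: "kronecker_realizable (right_mult n m A0) (right_mult n m B0) (form_space n \<epsilon>) (mat_space n m)
     bs"
    and pos: "\<And>b. b \<in> set bs \<Longrightarrow> block_size b \<ge> 1"
    and type: "type_of_blocks bs = T"
  shows "has_algebraic_type ((module_mat TYPE(complex) n n)\<lparr>carrier := form_algebra J n \<epsilon>\<rparr>)
     (module_mat TYPE(complex) n m) (\<lambda>Y. Y * A) (\<lambda>Y. Y * B) T"
proof -
  obtain U U' W W' where UW: "U \<in> carrier_mat n n" "U' \<in> carrier_mat n n" "U * U' = 1\<^sub>m n" "U' * U = 1\<^sub>m n"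
    "W \<in> carrier_mat m m" "W' \<in> carrier_mat m m" "W * W' = 1\<^sub>m m" "W' * W = 1\<^sub>m m"
    "A * W = U * A0" "B * W = U * B0"
    using equiv unfolding strictly_equivalent_def by (elim exE conjE) (rule that)
  obtain us vs where uv: "distinct us" "fs.independent (set us)" "fs.span (set us) = form_space n \<epsilon>"
    "distinct vs" "fs.independent (set vs)" "fs.span (set vs) = mat_space n m"
    "block_rel (right_mult n m A0) (right_mult n m B0) us vs bs"
    using form unfolding kronecker_realizable_def by (elim exE conjE) (rule that)
  have "has_kronecker_form ((module_mat TYPE(complex) n n)\<lparr>carrier := form_algebra J n \<epsilon>\<rparr>)
     (module_mat TYPE(complex) n m) (\<lambda>Y. Y * A) (\<lambda>Y. Y * B) bs"
    by (rule has_kronecker_form_from_normal_form[OF J UW(1-8) car UW(9,10) uv pos])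
  then show ?thesis unfolding has_algebraic_type_def using type by blast
qed

lemma carrier_pair_space: "(A, B) \<in> carrier (pair_space n m) \<longleftrightarrow> A \<in> carrier_mat n m \<and> B \<in> carrier_mat n m"
  by (simp add: direct_sum_def module_mat_simps)

lemma standard_sum_invariants_less:
  fixes q d r :: nat
  assumes r: "r < d" and \<epsilon>: "\<epsilon> = 1 \<or> \<epsilon> = -1" and m: "m = q * d + r" and n: "n = m + d"
    and J: "J \<in> carrier_mat n n" "J' \<in> carrier_mat n n" "J * J' = 1\<^sub>m n" "J' * J = 1\<^sub>m n"
  shows "standard_sum_has_JK_invariants (form_algebra J n \<epsilon>) n m
    \<lparr> jordan_sizes = {#},
      horizontal_indices = replicate_mset (card (triangle (d - r) \<epsilon>)) (2 * q + 1) +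
        replicate_mset ((d - r) * r) (2 * q + 2) + replicate_mset (card (triangle r \<epsilon>)) (2 * q + 3),
      vertical_indices = replicate_mset (nat (int m * (int m - \<epsilon>) div 2)) 2 \<rparr>"
    (is "standard_sum_has_JK_invariants _ _ _ ?T")
proof -
  interpret hankel q d r \<epsilon> by unfold_locales (use r \<epsilon> in auto)
  have d: "0 < d" using r by simp
  obtain ps where ps: "distinct ps" "set ps = triangle d \<epsilon>"
    and form: "kronecker_realizable (right_mult n m (shift_mat n m 0)) (right_mult n m (shift_mat n m d))
       (form_space n \<epsilon>) (mat_space n m)
       (map (\<lambda>(i, j). Horizontal_block (Suc (level i + level j))) ps @
        replicate (nat (int m * (int m - \<epsilon>) div 2)) (Vertical_block 2))"
    using shift_pencil_kronecker_form unfolding m[symmetric] n[symmetric] by (elim exE conjE) (rule that)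
  define bs where "bs = map Horizontal_block (map (\<lambda>(i, j). Suc (level i + level j)) ps) @
     map Vertical_block (replicate (nat (int m * (int m - \<epsilon>) div 2)) 2)"
  have bs: "map (\<lambda>(i, j). Horizontal_block (Suc (level i + level j))) ps @
       replicate (nat (int m * (int m - \<epsilon>) div 2)) (Vertical_block 2) = bs"
    unfolding bs_def by (simp add: case_prod_unfold comp_def)
  have type: "type_of_blocks bs = ?T"
    unfolding bs_def type_of_singular_blocks horizontal_index_multiset[OF ps] mset_replicate ..
  have pos: "block_size b \<ge> 1" if "b \<in> set bs" for b
    using that unfolding bs_def by auto
  obtain p where p: "p \<in> polynomial_functions (pair_space n m)"
    "p (shift_mat n m 0, shift_mat n m d) \<noteq> 0"
    "\<And>A B. A \<in> carrier_mat n m \<Longrightarrow> B \<in> carrier_mat n m \<Longrightarrow> p (A, B) \<noteq> 0 \<Longrightarrow>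
      strictly_equivalent n m A B (shift_mat n m 0) (shift_mat n m d)"
    by (rule generic_pair_shift_form[OF d, of m, folded n]) (rule that)
  show ?thesis
    unfolding standard_sum_has_JK_invariants_def
  proof (rule has_JK_invariantsI[OF p(1) _ p(2)])
    show "(shift_mat n m 0, shift_mat n m d) \<in> carrier (pair_space n m)"
      unfolding carrier_pair_space by (intro conjI shift_mat_carrier)
    fix A B assume "A \<in> carrier (module_mat TYPE(complex) n m)" "B \<in> carrier (module_mat TYPE(complex) n m)"
      and p0: "p (A, B) \<noteq> 0"
    then have AB: "A \<in> carrier_mat n m" "B \<in> carrier_mat n m" by (simp_all add: module_mat_simps)
    show "has_algebraic_type ((module_mat TYPE(complex) n n)\<lparr>carrier := form_algebra J n \<epsilon>\<rparr>)
       (module_mat TYPE(complex) n m) (\<lambda>Y. Y * A) (\<lambda>Y. Y * B) ?T"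
      by (rule form_algebra_pencil_type[OF J p(3)[OF AB p0] AB shift_mat_carrier shift_mat_carrier
            form[unfolded bs] pos type])
  qed
qed

section \<open>Generic pairs with an injective pencil\<close>

lemma right_mult_apply:
  assumes "A \<in> carrier_mat n m"
  shows "right_mult n m A f (p, k) = (if p < n \<and> k < m then \<Sum>j<n. f (p, j) * A $$ (j, k) else 0)"
proof (cases "p < n \<and> k < m")
  case True
  then have "right_mult n m A f (p, k) = (\<Sum>j<n. f (p, j) * A $$ (j, k))"
    using assms by (simp add: right_mult_def entries_def scalar_prod_def lessThan_atLeast0)
  then show ?thesis using True by simp
next
  case False
  have "right_mult n m A f \<in> mat_space n m" using assms by (rule right_mult_in_mat_space)
  then have "right_mult n m A f (p, k) = 0" using False unfolding mat_space_def by blast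
  then show ?thesis unfolding if_not_P[OF False] .
qed

text \<open>The case H = 0: such a pair has only vertical indices 1 and 2, whatever its strict
  equivalence class.\<close>

definition injective_pair :: "nat \<Rightarrow> nat \<Rightarrow> int \<Rightarrow> complex mat \<Rightarrow> complex mat \<Rightarrow> bool" where
  "injective_pair n m \<epsilon> A B \<longleftrightarrow> (\<forall>Y\<in>form_space n \<epsilon>. \<forall>Z\<in>form_space n \<epsilon>.
     right_mult n m A Y + right_mult n m B Z = 0 \<longrightarrow> Y = 0 \<and> Z = 0)"

text \<open>Injectivity of (Y, Z) to Y A + Z B is an open condition: in a basis of forms the map is
  a matrix with entries linear in the pair, and \<open>polynomial_injectivity\<close>
  applies.\<close>

lemma generic_injective_pair:
  fixes A0 B0 :: "complex mat"
  assumes \<epsilon>: "\<epsilon> = 1 \<or> \<epsilon> = -1"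
    and car0: "A0 \<in> carrier_mat n m" "B0 \<in> carrier_mat n m"
    and inj0: "injective_pair n m \<epsilon> A0 B0"
  obtains p where "p \<in> polynomial_functions (pair_space n m)" "p (A0, B0) \<noteq> 0"
    and "\<And>A B. A \<in> carrier_mat n m \<Longrightarrow> B \<in> carrier_mat n m \<Longrightarrow> p (A, B) \<noteq> 0 \<Longrightarrow>
       injective_pair n m \<epsilon> A B"
proof -
  obtain BG where BG: "finite BG" "fs.independent BG" "fs.span BG = form_space n \<epsilon>"
    using form_space_basis[OF \<epsilon>, of n] by blast
  define E where "E = {..<n} \<times> {..<m}"
  \<comment> \<open>The Boolean tells the coordinates of Y from those of Z.\<close>
  define I where "I = (UNIV :: bool set) \<times> BG"
  define L :: "complex mat \<times> complex mat \<Rightarrow> nat \<times> nat \<Rightarrow> bool \<times> (nat \<times> nat \<Rightarrow> complex) \<Rightarrow> complex"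
    where "L x e i = (\<Sum>j<n. snd i (fst e, j) * (if fst i then fst x else snd x) $$ (j, snd e))" for x e i
  define comb where "comb z b = (\<Sum>v\<in>BG. fscale (z (b, v)) v)" for z :: "bool \<times> (nat \<times> nat \<Rightarrow> complex) \<Rightarrow> complex" and b
  have fin: "finite E" "finite I" using BG(1) by (simp_all add: E_def I_def)
  have poly: "(\<lambda>x. L x e i) \<in> polynomial_functions (pair_space n m)" if "e \<in> E" "i \<in> I" for e i
  proof -
    have e: "snd e < m" using that by (auto simp: E_def)
    show ?thesis
      unfolding L_def
    proof (intro polynomial_functions_sum polynomial_functions.mult polynomial_functions.const)
      fix j assume "j \<in> {..<n}"
      then have j: "j < n" by simp
      show "(\<lambda>x. (if fst i then fst x else snd x) $$ (j, snd e)) \<in> polynomial_functions (pair_space n m)"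
        using polynomial_functions_entry[OF j e] by (cases "fst i") simp_all
    qed
  qed
  have sumL: "(\<Sum>i\<in>I. L (A, B) (p, k) i * z i) =
      (\<Sum>j<n. comb z True (p, j) * A $$ (j, k)) + (\<Sum>j<n. comb z False (p, j) * B $$ (j, k))" for A B p k z
  proof -
    have inner: "(\<Sum>v\<in>BG. L (A, B) (p, k) (b, v) * z (b, v)) =
       (\<Sum>j<n. comb z b (p, j) * (if b then A else B) $$ (j, k))" for b
    proof -
      have "(\<Sum>v\<in>BG. L (A, B) (p, k) (b, v) * z (b, v)) =
         (\<Sum>v\<in>BG. \<Sum>j<n. z (b, v) * v (p, j) * (if b then A else B) $$ (j, k))"
        by (rule sum.cong) (simp_all add: L_def sum_distrib_left sum_distrib_right mult_ac)
      also have "\<dots> = (\<Sum>j<n. \<Sum>v\<in>BG. z (b, v) * v (p, j) * (if b then A else B) $$ (j, k))"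
        by (rule sum.swap)
      also have "\<dots> = (\<Sum>j<n. comb z b (p, j) * (if b then A else B) $$ (j, k))"
        by (rule sum.cong) (simp_all add: comb_def sum_fun_apply sum_distrib_right)
      finally show ?thesis .
    qed
    have "(\<Sum>i\<in>I. L (A, B) (p, k) i * z i) = (\<Sum>b\<in>UNIV. \<Sum>v\<in>BG. L (A, B) (p, k) (b, v) * z (b, v))"
      unfolding I_def sum.cartesian_product by (rule sum.cong) auto
    then show ?thesis unfolding UNIV_bool inner by simp
  qed
  have eq_iff: "right_mult n m A (comb z True) + right_mult n m B (comb z False) = 0 \<longleftrightarrow>
      (\<forall>e\<in>E. (\<Sum>i\<in>I. L (A, B) e i * z i) = 0)"
    if A: "A \<in> carrier_mat n m" and B: "B \<in> carrier_mat n m" for A B z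
  proof
    assume 0: "right_mult n m A (comb z True) + right_mult n m B (comb z False) = 0"
    show "\<forall>e\<in>E. (\<Sum>i\<in>I. L (A, B) e i * z i) = 0"
    proof
      fix e assume "e \<in> E"
      then obtain p k where e: "e = (p, k)" "p < n" "k < m" by (auto simp: E_def)
      have "(right_mult n m A (comb z True) + right_mult n m B (comb z False)) (p, k) = 0"
        unfolding 0 by simp
      then show "(\<Sum>i\<in>I. L (A, B) e i * z i) = 0"
        unfolding e(1) sumL plus_fun_apply right_mult_apply[OF A] right_mult_apply[OF B] using e(2,3) by simp
    qed
  next
    assume 0: "\<forall>e\<in>E. (\<Sum>i\<in>I. L (A, B) e i * z i) = 0"
    show "right_mult n m A (comb z True) + right_mult n m B (comb z False) = 0"
    proof (rule ext)
      fix e :: "nat \<times> nat"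
      obtain p k where e: "e = (p, k)" by (cases e)
      show "(right_mult n m A (comb z True) + right_mult n m B (comb z False)) e = 0 e"
      proof (cases "p < n \<and> k < m")
        case True
        then have "(\<Sum>i\<in>I. L (A, B) (p, k) i * z i) = 0" using 0 by (simp add: E_def)
        then show ?thesis
          unfolding e sumL plus_fun_apply right_mult_apply[OF A] right_mult_apply[OF B] using True by simp
      next
        case False
        then show ?thesis
          unfolding e plus_fun_apply right_mult_apply[OF A] right_mult_apply[OF B] by auto
      qed
    qed
  qed
  have comb_in: "comb z b \<in> form_space n \<epsilon>" for z b
    unfolding comb_def BG(3)[symmetric] by (intro fs.span_sum fs.span_scale fs.span_base)
  have comb_0: "z (b, v) = 0" if "comb z b = 0" "v \<in> BG" for z b v
    by (rule fs.independentD[OF BG(2,1) subset_refl, of "\<lambda>v. z (b, v)"])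
      (use that in \<open>simp_all add: comb_def\<close>)
  show thesis
  proof (rule polynomial_injectivity[where L = L and E = E and I = I and W = "pair_space n m" and ?x0.0 = "(A0, B0)"])
    fix z :: "bool \<times> (nat \<times> nat \<Rightarrow> complex) \<Rightarrow> complex" and i
    assume z: "\<And>e. e \<in> E \<Longrightarrow> (\<Sum>i\<in>I. L (A0, B0) e i * z i) = 0" and i: "i \<in> I"
    have "right_mult n m A0 (comb z True) + right_mult n m B0 (comb z False) = 0"
      unfolding eq_iff[OF car0] using z by blast
    then have "comb z True = 0" "comb z False = 0"
      using inj0 comb_in unfolding injective_pair_def by blast+
    then have "comb z (fst i) = 0" by (cases "fst i") simp_all
    moreover have "snd i \<in> BG" using i by (auto simp: I_def)
    ultimately show "z i = 0" using comb_0[of z "fst i" "snd i"] by simp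
  next
    fix p
    assume p: "p \<in> polynomial_functions (pair_space n m)" "p (A0, B0) \<noteq> 0"
      and inj: "\<And>x z i. p x \<noteq> 0 \<Longrightarrow> (\<And>e. e \<in> E \<Longrightarrow> (\<Sum>i\<in>I. L x e i * z i) = 0) \<Longrightarrow> i \<in> I \<Longrightarrow> z i = 0"
    show thesis
    proof (rule that[OF p])
      fix A B assume A: "A \<in> carrier_mat n m" and B: "B \<in> carrier_mat n m" and p0: "p (A, B) \<noteq> 0"
      show "injective_pair n m \<epsilon> A B"
        unfolding injective_pair_def
      proof (intro ballI impI)
        fix Y Z assume YZ: "Y \<in> form_space n \<epsilon>" "Z \<in> form_space n \<epsilon>"
          and 0: "right_mult n m A Y + right_mult n m B Z = 0"
        obtain u where u: "Y = (\<Sum>v\<in>BG. fscale (u v) v)"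
          using YZ(1) unfolding BG(3)[symmetric] fs.span_finite[OF BG(1)] by (rule rangeE)
        obtain w where w: "Z = (\<Sum>v\<in>BG. fscale (w v) v)"
          using YZ(2) unfolding BG(3)[symmetric] fs.span_finite[OF BG(1)] by (rule rangeE)
        define z where "z i = (if fst i then u (snd i) else w (snd i))" for i :: "bool \<times> (nat \<times> nat \<Rightarrow> complex)"
        have Yz: "Y = comb z True" and Zz: "Z = comb z False"
          unfolding u w comb_def z_def by simp_all
        have "\<forall>e\<in>E. (\<Sum>i\<in>I. L (A, B) e i * z i) = 0"
          using 0 unfolding Yz Zz eq_iff[OF A B] .
        then have "z i = 0" if "i \<in> I" for i using inj[OF p0 _ that] by blast
        then have z0: "z (b, v) = 0" if "v \<in> BG" for b v using that by (simp add: I_def)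
        have "comb z b = 0" for b
          unfolding comb_def by (rule sum.neutral) (simp add: z0)
        then show "Y = 0 \<and> Z = 0" unfolding Yz Zz by blast
      qed
    qed
  qed (fact fin | erule (1) poly)+
qed

text \<open>The first n columns force Y = - Z D with D = diag(0, ..., n - 1). As D has distinct
  entries, the symmetry of Y and Z kills Z off the diagonal. The diagonal vanishes by skew symmetry
  or, for m > n, by column n of ones, which sums the rows of Z.\<close>

lemma injective_pair_point:
  assumes \<epsilon>: "\<epsilon> = 1 \<or> \<epsilon> = -1" and nm: "n < m \<or> n = m \<and> \<epsilon> = -1"
  defines "A \<equiv> mat n m (\<lambda>(j, k). if j = k then 1 else 0 :: complex)"
    and "B \<equiv> mat n m (\<lambda>(j, k). if k < n then if j = k then of_nat k else 0 else 1 :: complex)"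
  shows "injective_pair n m \<epsilon> A B"
  unfolding injective_pair_def
proof (intro ballI impI)
  have A: "A \<in> carrier_mat n m" and B: "B \<in> carrier_mat n m" by (simp_all add: A_def B_def)
  fix Y Z assume Y: "Y \<in> form_space n \<epsilon>" and Z: "Z \<in> form_space n \<epsilon>"
    and 0: "right_mult n m A Y + right_mult n m B Z = 0"
  have eq: "(\<Sum>j<n. Y (p, j) * A $$ (j, k)) + (\<Sum>j<n. Z (p, j) * B $$ (j, k)) = 0" if "p < n" "k < m" for p k
  proof -
    have "(right_mult n m A Y + right_mult n m B Z) (p, k) = 0" unfolding 0 by simp
    then show ?thesis unfolding plus_fun_apply right_mult_apply[OF A] right_mult_apply[OF B] using that by simp
  qed
  have left: "Y (p, k) = - (of_nat k * Z (p, k))" if pk: "p < n" "k < n" for p k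
  proof -
    have km: "k < m" using pk nm by auto
    have "(\<Sum>j<n. Y (p, j) * A $$ (j, k)) = (\<Sum>j<n. if j = k then Y (p, j) else 0)"
      by (rule sum.cong) (use km in \<open>simp_all add: A_def\<close>)
    moreover have "(\<Sum>j<n. Z (p, j) * B $$ (j, k)) = (\<Sum>j<n. if j = k then Z (p, j) * of_nat k else 0)"
      by (rule sum.cong) (use km pk in \<open>simp_all add: B_def\<close>)
    ultimately have "Y (p, k) + of_nat k * Z (p, k) = 0" using eq[OF pk(1) km] pk by (simp add: mult.commute)
    then show ?thesis by (rule iffD1[OF eq_neg_iff_add_eq_0[symmetric]])
  qed
  have off: "Z (p, k) = 0" if pk: "p < n" "k < n" "p \<noteq> k" for p k
  proof -
    have e: "of_int \<epsilon> * of_int \<epsilon> = (1 :: complex)" using \<epsilon> by (elim disjE) simp_all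
    have "- (of_nat k * Z (p, k)) = Y (p, k)" by (rule left[OF pk(1,2), symmetric])
    also have "\<dots> = of_int \<epsilon> * Y (k, p)" by (rule form_space_sym[OF Y])
    also have "\<dots> = of_int \<epsilon> * - (of_nat p * (of_int \<epsilon> * Z (p, k)))"
      unfolding left[OF pk(2,1)] form_space_sym[OF Z, of k p] ..
    also have "\<dots> = - (of_nat p * (of_int \<epsilon> * of_int \<epsilon> * Z (p, k)))" by (simp only: mult_minus_right mult_ac)
    finally have "of_nat k * Z (p, k) = of_nat p * Z (p, k)" unfolding e by simp
    then have "(of_nat k - of_nat p) * Z (p, k) = 0" by (simp add: left_diff_distrib)
    then show ?thesis using pk(3) by simp
  qed
  have diag: "Z (p, p) = 0" if p: "p < n" for p
  proof (cases "\<epsilon> = -1")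
    case True
    have "Z (p, p) = - Z (p, p)" using form_space_sym[OF Z, of p p] True by simp
    then show ?thesis by simp
  next
    case False
    then have nm': "n < m" using nm by blast
    have "(\<Sum>j<n. Y (p, j) * A $$ (j, n)) = 0"
      by (rule sum.neutral) (use nm' in \<open>simp add: A_def\<close>)
    moreover have "(\<Sum>j<n. Z (p, j) * B $$ (j, n)) = (\<Sum>j<n. if j = p then Z (p, j) else 0)"
      by (rule sum.cong) (use nm' off[OF p] in \<open>auto simp: B_def\<close>)
    ultimately show ?thesis using eq[OF p nm'] p by simp
  qed
  have Z0: "Z (p, k) = 0" for p k
  proof (cases "p < n \<and> k < n")
    case True
    then show ?thesis using off diag by (cases "p = k") auto
  next
    case False
    then show ?thesis using Z form_space_subset unfolding mat_space_def by blast
  qed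
  have Y0: "Y (p, k) = 0" for p k
  proof (cases "p < n \<and> k < n")
    case True
    then show ?thesis using left Z0 by simp
  next
    case False
    then show ?thesis using Y form_space_subset unfolding mat_space_def by blast
  qed
  show "Y = 0 \<and> Z = 0" using Y0 Z0 by (auto intro!: ext simp: split_paired_all)
qed

text \<open>\<open>kronecker_decomposition\<close> with empty \<open>xs\<close> and
  \<open>ys\<close>: the complement is the whole space of forms.\<close>

lemma injective_pair_kronecker_form:
  assumes \<epsilon>: "\<epsilon> = 1 \<or> \<epsilon> = -1" and car: "A \<in> carrier_mat n m" "B \<in> carrier_mat n m"
    and inj: "injective_pair n m \<epsilon> A B" and K: "2 * int K = int n * (int n + \<epsilon>)"
  shows "kronecker_realizable (right_mult n m A) (right_mult n m B) (form_space n \<epsilon>) (mat_space n m)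
     (map Horizontal_block [] @ map Vertical_block (replicate K 2 @ replicate (n * m - 2 * K) 1))"
proof -
  obtain BG where BG: "finite BG" "fs.independent BG" "fs.span BG = form_space n \<epsilon>"
    "2 * int (card BG) = int n * (int n + \<epsilon>)"
    using form_space_basis[OF \<epsilon>, of n] by blast
  obtain BV where BV: "finite BV" "fs.independent BV" "fs.span BV = mat_space n m" "card BV = n * m"
    using mat_space_basis by blast
  have cardK: "card BG = K" using K BG(4) by linarith
  have "kronecker_realizable (right_mult n m A) (right_mult n m B) (form_space n \<epsilon>) (mat_space n m)
     ([] @ replicate (card BG - length ([] :: (nat \<times> nat \<Rightarrow> complex) list)) (Vertical_block 2) @
        replicate (card BV - length ([] :: (nat \<times> nat \<Rightarrow> complex) list) -
          2 * (card BG - length ([] :: (nat \<times> nat \<Rightarrow> complex) list))) (Vertical_block 1))"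
  proof (rule kronecker_decomposition[where BG = BG and BV = BV])
    show "right_mult n m A ` form_space n \<epsilon> \<subseteq> mat_space n m" "right_mult n m B ` form_space n \<epsilon> \<subseteq> mat_space n m"
      using right_mult_in_mat_space[OF car(1)] right_mult_in_mat_space[OF car(2)] by blast+
    fix Y Z assume "Y \<in> form_space n \<epsilon>" "Z \<in> form_space n \<epsilon>" "right_mult n m A Y + right_mult n m B Z = 0"
    then have "Y = 0 \<and> Z = 0" using inj unfolding injective_pair_def by blast
    then show "Y \<in> fs.span (set []) \<and> Z \<in> fs.span (set [])" using fs.span_zero by blast
  qed (use BG BV linear_right_mult[OF car(1)] linear_right_mult[OF car(2)] block_rel_Nil in
      \<open>auto simp: fs.dependent_def\<close>)
  then show ?thesis by (simp add: cardK BV(4) map_replicate)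
qed

lemma standard_sum_invariants_greater:
  assumes \<epsilon>: "\<epsilon> = 1 \<or> \<epsilon> = -1" and nm: "n < m \<or> n = m \<and> \<epsilon> = -1"
    and K: "2 * int K = int n * (int n + \<epsilon>)"
    and J: "J \<in> carrier_mat n n" "J' \<in> carrier_mat n n" "J * J' = 1\<^sub>m n" "J' * J = 1\<^sub>m n"
  shows "standard_sum_has_JK_invariants (form_algebra J n \<epsilon>) n m
    \<lparr> jordan_sizes = {#}, horizontal_indices = {#},
      vertical_indices = replicate_mset (n * m - 2 * K) 1 + replicate_mset K 2 \<rparr>"
    (is "standard_sum_has_JK_invariants _ _ _ ?T")
proof -
  let ?A = "mat n m (\<lambda>(j, k). if j = k then 1 else 0 :: complex)"
  let ?B = "mat n m (\<lambda>(j, k). if k < n then if j = k then of_nat k else 0 else 1 :: complex)"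
  have car0: "?A \<in> carrier_mat n m" "?B \<in> carrier_mat n m" by simp_all
  obtain p where p: "p \<in> polynomial_functions (pair_space n m)" "p (?A, ?B) \<noteq> 0"
    "\<And>A B. A \<in> carrier_mat n m \<Longrightarrow> B \<in> carrier_mat n m \<Longrightarrow> p (A, B) \<noteq> 0 \<Longrightarrow> injective_pair n m \<epsilon> A B"
    by (rule generic_injective_pair[OF \<epsilon> car0 injective_pair_point[OF \<epsilon> nm]]) (rule that)
  define bs where "bs = map Horizontal_block [] @ map Vertical_block (replicate K 2 @ replicate (n * m - 2 * K) 1)"
  have type: "type_of_blocks bs = ?T"
    unfolding bs_def type_of_singular_blocks by (simp add: add.commute)
  have pos: "block_size b \<ge> 1" if "b \<in> set bs" for b
    using that unfolding bs_def by auto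
  show ?thesis
    unfolding standard_sum_has_JK_invariants_def
  proof (rule has_JK_invariantsI[OF p(1) _ p(2)])
    show "(?A, ?B) \<in> carrier (pair_space n m)" unfolding carrier_pair_space using car0 by blast
    fix A B assume "A \<in> carrier (module_mat TYPE(complex) n m)" "B \<in> carrier (module_mat TYPE(complex) n m)"
      and p0: "p (A, B) \<noteq> 0"
    then have AB: "A \<in> carrier_mat n m" "B \<in> carrier_mat n m" by (simp_all add: module_mat_simps)
    have "A * 1\<^sub>m m = 1\<^sub>m n * A" "B * 1\<^sub>m m = 1\<^sub>m n * B" using AB by simp_all
    \<comment> \<open>The pair is its own normal form, since injectivity alone determines the
      blocks.\<close>
    then have equiv: "strictly_equivalent n m A B A B"
      unfolding strictly_equivalent_def by (intro exI[of _ "1\<^sub>m n"] exI[of _ "1\<^sub>m m"]) simp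
    show "has_algebraic_type ((module_mat TYPE(complex) n n)\<lparr>carrier := form_algebra J n \<epsilon>\<rparr>)
       (module_mat TYPE(complex) n m) (\<lambda>Y. Y * A) (\<lambda>Y. Y * B) ?T"
      by (rule form_algebra_pencil_type[OF J equiv AB AB
            injective_pair_kronecker_form[OF \<epsilon> AB p(3)[OF AB p0] K, folded bs_def] pos type])
  qed
qed

section \<open>Generic square pairs\<close>

definition mtrace :: "complex mat \<Rightarrow> complex" where
  "mtrace M = (\<Sum>i<dim_row M. M $$ (i, i))"

lemma mtrace_mult_commute:
  assumes "X \<in> carrier_mat n n" "Y \<in> carrier_mat n n"
  shows "mtrace (X * Y) = mtrace (Y * X)"
proof -
  have "mtrace (X * Y) = (\<Sum>i<n. \<Sum>j<n. X $$ (i, j) * Y $$ (j, i))"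
    using assms by (simp add: mtrace_def scalar_prod_def lessThan_atLeast0)
  also have "\<dots> = (\<Sum>j<n. \<Sum>i<n. X $$ (i, j) * Y $$ (j, i))" by (rule sum.swap)
  also have "\<dots> = mtrace (Y * X)"
    using assms by (simp add: mtrace_def scalar_prod_def lessThan_atLeast0 mult.commute)
  finally show ?thesis .
qed

lemma upper_triangular_pow:
  assumes T: "T \<in> carrier_mat n n" "upper_triangular T"
  shows "j \<le> i \<Longrightarrow> i < n \<Longrightarrow> (T ^\<^sub>m k) $$ (i, j) = (if i = j then (T $$ (i, i) :: complex) ^ k else 0)"
proof (induction k arbitrary: i j)
  case 0
  then show ?case using T by auto
next
  case (Suc k)
  have Tk: "T ^\<^sub>m k \<in> carrier_mat n n" using T by simp
  have "(T ^\<^sub>m Suc k) $$ (i, j) = (\<Sum>l<n. (T ^\<^sub>m k) $$ (i, l) * T $$ (l, j))"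
    using Suc.prems T Tk by (simp add: scalar_prod_def lessThan_atLeast0)
  also have "\<dots> = (\<Sum>l<n. if l = i then (T ^\<^sub>m k) $$ (i, i) * T $$ (i, j) else 0)"
  proof (rule sum.cong)
    fix l assume "l \<in> {..<n}"
    then have l: "l < n" by simp
    consider "l = i" | "l < i" | "i < l" by linarith
    then show "(T ^\<^sub>m k) $$ (i, l) * T $$ (l, j) = (if l = i then (T ^\<^sub>m k) $$ (i, i) * T $$ (i, j) else 0)"
    proof cases
      case 2
      then show ?thesis using Suc.IH[of l i] Suc.prems by simp
    next
      case 3
      then have "T $$ (l, j) = 0" using T l Suc.prems by (intro upper_triangularD[OF T(2)]) auto
      then show ?thesis using 3 by simp
    qed simp
  qed simp
  also have "\<dots> = (T ^\<^sub>m k) $$ (i, i) * T $$ (i, j)" using Suc.prems by simp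
  also have "\<dots> = (if i = j then T $$ (i, i) ^ Suc k else 0)"
  proof (cases "i = j")
    case True
    then show ?thesis using Suc.IH[of i i] Suc.prems by simp
  next
    case False
    then have "T $$ (i, j) = 0" using T Suc.prems by (intro upper_triangularD[OF T(2)]) auto
    then show ?thesis using False by simp
  qed
  finally show ?case .
qed

text \<open>By the identity \<open>moment_matrix n M = V\<^sup>T V\<close> with a Vandermonde matrix \<open>V\<close> of the eigenvalues, its determinant is
  the discriminant of the characteristic polynomial.\<close>

definition moment_matrix :: "nat \<Rightarrow> complex mat \<Rightarrow> complex mat" where
  "moment_matrix n M = mat n n (\<lambda>(i, j). mtrace (M ^\<^sub>m (i + j)))"

definition vandermonde :: "nat \<Rightarrow> (nat \<Rightarrow> complex) \<Rightarrow> complex mat" where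
  "vandermonde n \<mu> = mat n n (\<lambda>(a, i). \<mu> a ^ i)"

text \<open>Triangularisation turns the trace of M^k into the k-th power sum of the eigenvalues, and
  entry (i, j) of V^T V is the power sum of exponent i + j.\<close>

lemma moment_matrix_eq:
  assumes wit: "similar_mat_wit M T P Q" and M: "M \<in> carrier_mat n n" and ut: "upper_triangular T"
  shows "moment_matrix n M = transpose_mat (vandermonde n (\<lambda>a. T $$ (a, a))) * vandermonde n (\<lambda>a. T $$ (a, a))"
proof -
  note w = similar_mat_witD2[OF M wit]
  have tr: "mtrace (M ^\<^sub>m k) = (\<Sum>a<n. T $$ (a, a) ^ k)" for k
  proof -
    have Tk: "T ^\<^sub>m k \<in> carrier_mat n n" using w by simp
    have "mtrace (M ^\<^sub>m k) = mtrace (P * (T ^\<^sub>m k * Q))"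
      unfolding similar_mat_wit_pow_id[OF wit] using assoc_mult_mat[OF w(6) Tk w(7)] by simp
    also have "\<dots> = mtrace (T ^\<^sub>m k * Q * P)"
      by (rule mtrace_mult_commute[OF w(6)]) (use Tk w in auto)
    also have "T ^\<^sub>m k * Q * P = T ^\<^sub>m k * (Q * P)" by (rule assoc_mult_mat[OF Tk w(7,6)])
    also have "\<dots> = T ^\<^sub>m k" unfolding w(2) by (rule right_mult_one_mat[OF Tk])
    also have "mtrace (T ^\<^sub>m k) = (\<Sum>a<n. T $$ (a, a) ^ k)"
      unfolding mtrace_def carrier_matD(1)[OF Tk]
      by (rule sum.cong) (simp_all add: upper_triangular_pow[OF w(5) ut])
    finally show ?thesis .
  qed
  show ?thesis
    unfolding moment_matrix_def tr vandermonde_def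
    by (rule eq_matI) (simp_all add: scalar_prod_def lessThan_atLeast0 power_add)
qed

lemma vandermonde_det_distinct:
  assumes "det (vandermonde n \<mu>) \<noteq> 0"
  shows "inj_on \<mu> {..<n}"
proof (rule inj_onI, rule ccontr)
  fix a b assume ab: "a \<in> {..<n}" "b \<in> {..<n}" "\<mu> a = \<mu> b" "a \<noteq> b"
  have "row (vandermonde n \<mu>) a = row (vandermonde n \<mu>) b"
    using ab by (intro eq_vecI) (auto simp: vandermonde_def)
  then have "det (vandermonde n \<mu>) = 0"
    using ab by (intro det_identical_rows[of _ n a b]) (auto simp: vandermonde_def)
  then show False using assms by simp
qed

text \<open>A kernel vector lists the coefficients of a non-zero polynomial of degree less than n
  with the n roots \<open>\<mu> a\<close>.\<close>

lemma vandermonde_det_nonzero: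
  assumes inj: "inj_on \<mu> {..<n}"
  shows "det (vandermonde n \<mu>) \<noteq> 0"
proof
  have V: "vandermonde n \<mu> \<in> carrier_mat n n" by (simp add: vandermonde_def)
  assume "det (vandermonde n \<mu>) = 0"
  then obtain c where c: "c \<in> carrier_vec n" "c \<noteq> 0\<^sub>v n" "vandermonde n \<mu> *\<^sub>v c = 0\<^sub>v n"
    using det_0_iff_vec_prod_zero[OF V] by blast
  define p where "p = (\<Sum>i<n. monom (c $ i) i)"
  have coeff: "coeff p k = (if k < n then c $ k else 0)" for k
    unfolding p_def coeff_sum coeff_monom by simp
  have "poly p (\<mu> a) = 0" if "a < n" for a
  proof -
    have "poly p (\<mu> a) = (\<Sum>i<n. c $ i * \<mu> a ^ i)" unfolding p_def poly_sum poly_monom ..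
    also have "\<dots> = (vandermonde n \<mu> *\<^sub>v c) $ a"
      using that c(1) by (simp add: vandermonde_def scalar_prod_def lessThan_atLeast0 mult.commute)
    finally show ?thesis using c(3) that by simp
  qed
  then have sub: "\<mu> ` {..<n} \<subseteq> {x. poly p x = 0}" by auto
  obtain k where k: "k < n" "c $ k \<noteq> 0" using c(1,2) by (metis carrier_vecD eq_vecI index_zero_vec)
  then have p0: "p \<noteq> 0" using coeff[of k] by auto
  have "degree p < n"
    using p0 coeff k by (metis leading_coeff_0_iff)
  moreover have "card (\<mu> ` {..<n}) \<le> card {x. poly p x = 0}"
    using sub poly_roots_finite[OF p0] by (rule card_mono[rotated])
  ultimately show False
    using card_poly_roots_bound[OF p0] card_image[OF inj] by simp
qed

text \<open>A non-zero discriminant makes the diagonal entries of a Schur form distinct;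
  eigenvectors for them are the columns of W.\<close>

lemma diagonalisation_of_moment_matrix:
  assumes M: "M \<in> carrier_mat n n" and det: "det (moment_matrix n M) \<noteq> 0"
  obtains W W' \<mu> where "W \<in> carrier_mat n n" "W' \<in> carrier_mat n n" "W * W' = 1\<^sub>m n" "W' * W = 1\<^sub>m n"
    and "inj_on \<mu> {..<n}" and "M * W = W * mat n n (\<lambda>(i, j). if i = j then \<mu> i else 0)"
proof -
  obtain es where es: "char_poly M = (\<Prod>a\<leftarrow>es. [:- a, 1:])"
    using char_poly_factorized[OF M] by blast
  obtain T where T: "T \<in> carrier_mat n n" "upper_triangular T" "similar_mat M T"
    using schur_decomposition_exists[OF M es] by blast
  obtain P Q where wit: "similar_mat_wit M T P Q" using T(3) unfolding similar_mat_def by blast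
  define \<mu> where "\<mu> a = T $$ (a, a)" for a
  define V where "V = vandermonde n \<mu>"
  have V: "V \<in> carrier_mat n n" by (simp add: V_def vandermonde_def)
  have "moment_matrix n M = transpose_mat V * V"
    unfolding V_def \<mu>_def by (rule moment_matrix_eq[OF wit M T(2)])
  then have "det V * det V \<noteq> 0"
    using det det_mult[of "transpose_mat V" n V] det_transpose[OF V] V by simp
  then have detV: "det V \<noteq> 0" by auto
  have "\<exists>v. v \<in> carrier_vec n \<and> v \<noteq> 0\<^sub>v n \<and> M *\<^sub>v v = \<mu> a \<cdot>\<^sub>v v" if a: "a < n" for a
  proof -
    have "char_poly M = (\<Prod>a\<leftarrow>diag_mat T. [:- a, 1:])"
      using char_poly_similar[OF T(3)] char_poly_upper_triangular[OF T(1,2)] by simp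
    moreover have "\<mu> a \<in> set (diag_mat T)" using a T(1) by (auto simp: diag_mat_def \<mu>_def)
    ultimately have "poly (char_poly M) (\<mu> a) = 0"
      by (simp add: poly_prod_list_zero_iff)
    then have "eigenvalue M (\<mu> a)" using eigenvalue_root_char_poly[OF M] by blast
    then show ?thesis using M unfolding eigenvalue_def eigenvector_def by auto
  qed
  then obtain v where v: "\<And>a. a < n \<Longrightarrow> v a \<in> carrier_vec n" "\<And>a. a < n \<Longrightarrow> v a \<noteq> 0\<^sub>v n"
    "\<And>a. a < n \<Longrightarrow> M *\<^sub>v v a = \<mu> a \<cdot>\<^sub>v v a" by metis
  have Mv: "(\<Sum>l<n. M $$ (j, l) * v a $ l) = \<mu> a * v a $ j" if "j < n" "a < n" for j a
  proof -
    have "(M *\<^sub>v v a) $ j = (\<Sum>l<n. M $$ (j, l) * v a $ l)"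
      using that M v(1)[OF that(2)] by (simp add: scalar_prod_def lessThan_atLeast0)
    then show ?thesis using v(3)[OF that(2)] v(1)[OF that(2)] that by simp
  qed
  define W where "W = mat n n (\<lambda>(j, a). v a $ j)"
  have W: "W \<in> carrier_mat n n" by (simp add: W_def)
  have "det W \<noteq> 0"
  proof
    assume "det W = 0"
    then obtain c where c: "c \<in> carrier_vec n" "c \<noteq> 0\<^sub>v n" "W *\<^sub>v c = 0\<^sub>v n"
      using det_0_iff_vec_prod_zero[OF W] by blast
    \<comment> \<open>Applying powers of M to a relation among the eigenvectors yields one
      Vandermonde system for each coordinate \<open>j\<close>.\<close>
    have s: "(\<Sum>a<n. \<mu> a ^ k * (c $ a * v a $ j)) = 0" if "j < n" for j k
      using that
    proof (induction k arbitrary: j)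
      case 0
      have "(\<Sum>a<n. c $ a * v a $ j) = (W *\<^sub>v c) $ j"
        using 0 c(1) by (simp add: W_def scalar_prod_def lessThan_atLeast0 mult.commute)
      then show ?case using c(3) 0 by simp
    next
      case (Suc k)
      have "(\<Sum>a<n. \<mu> a ^ Suc k * (c $ a * v a $ j)) = (\<Sum>a<n. \<mu> a ^ k * c $ a * (\<mu> a * v a $ j))"
        by (rule sum.cong) (simp_all add: mult_ac)
      also have "\<dots> = (\<Sum>a<n. \<Sum>l<n. M $$ (j, l) * (\<mu> a ^ k * (c $ a * v a $ l)))"
        by (rule sum.cong) (simp_all add: Mv[OF Suc.prems, symmetric] sum_distrib_left mult_ac)
      also have "\<dots> = (\<Sum>l<n. M $$ (j, l) * (\<Sum>a<n. \<mu> a ^ k * (c $ a * v a $ l)))"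
        by (subst sum.swap) (simp add: sum_distrib_left)
      also have "\<dots> = 0" by (rule sum.neutral) (use Suc.IH in simp)
      finally show ?case .
    qed
    have cv: "c $ a * v a $ j = 0" if a: "a < n" and j: "j < n" for a j
    proof -
      define y where "y = vec n (\<lambda>a. c $ a * v a $ j)"
      have y: "y \<in> carrier_vec n" by (simp add: y_def)
      have "transpose_mat V *\<^sub>v y = 0\<^sub>v n"
      proof (rule eq_vecI)
        fix k assume "k < dim_vec (0\<^sub>v n :: complex vec)"
        then have k: "k < n" by simp
        have "(transpose_mat V *\<^sub>v y) $ k = (\<Sum>a<n. \<mu> a ^ k * (c $ a * v a $ j))"
          using k by (simp add: V_def vandermonde_def y_def scalar_prod_def lessThan_atLeast0)
        then show "(transpose_mat V *\<^sub>v y) $ k = 0\<^sub>v n $ k" using s[OF j] k by simp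
      qed (use V in simp)
      moreover have "det (transpose_mat V) \<noteq> 0" using detV det_transpose[OF V] by simp
      ultimately have "y = 0\<^sub>v n"
        using det_0_iff_vec_prod_zero[of "transpose_mat V" n] V y by auto
      then have "y $ a = 0" using a by simp
      then show ?thesis using a by (simp add: y_def)
    qed
    have "c $ a = 0" if a: "a < n" for a
    proof -
      obtain j where "j < n" "v a $ j \<noteq> 0"
        using v(1,2)[OF a] by (metis carrier_vecD eq_vecI index_zero_vec)
      then show ?thesis using cv[OF a] by auto
    qed
    then show False using c(1,2) by (metis carrier_vecD eq_vecI index_zero_vec)
  qed
  then obtain W' where W': "W' \<in> carrier_mat n n" "W * W' = 1\<^sub>m n" "W' * W = 1\<^sub>m n"
    using det_nonzero_inverse[OF W] by blast
  have "M * W = W * mat n n (\<lambda>(i, j). if i = j then \<mu> i else 0)"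
  proof (rule eq_matI)
    fix i j assume "i < dim_row (W * mat n n (\<lambda>(i, j). if i = j then \<mu> i else 0))"
      "j < dim_col (W * mat n n (\<lambda>(i, j). if i = j then \<mu> i else 0))"
    then have ij: "i < n" "j < n" using W by simp_all
    have "(M * W) $$ (i, j) = \<mu> j * v j $ i"
      using ij M Mv[OF ij] by (simp add: W_def scalar_prod_def lessThan_atLeast0)
    moreover have "(W * mat n n (\<lambda>(i, j). if i = j then \<mu> i else 0)) $$ (i, j) =
        (\<Sum>l<n. W $$ (i, l) * (if l = j then \<mu> l else 0))"
      unfolding mult_mat_index[OF W ij] prod.case ..
    moreover have "\<dots> = (\<Sum>l<n. if l = j then W $$ (i, l) * \<mu> l else 0)"
      by (rule sum.cong) simp_all
    ultimately show "(M * W) $$ (i, j) = (W * mat n n (\<lambda>(i, j). if i = j then \<mu> i else 0)) $$ (i, j)"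
      using ij by (simp add: W_def)
  qed (use M W in simp_all)
  moreover have "inj_on \<mu> {..<n}" using detV unfolding V_def by (rule vandermonde_det_distinct)
  ultimately show thesis using that W W' by blast
qed

section \<open>The diagonal pencil on symmetric forms\<close>

definition diagonal_mat_of :: "nat \<Rightarrow> (nat \<Rightarrow> complex) \<Rightarrow> complex mat" where
  "diagonal_mat_of n \<mu> = mat n n (\<lambda>(i, j). if i = j then \<mu> i else 0)"

lemma diagonal_mat_of_carrier: "diagonal_mat_of n \<mu> \<in> carrier_mat n n"
  by (simp add: diagonal_mat_of_def)

text \<open>Distinctness gives each block an eigenvalue of its own; a repeated value would merge two
  sizes into one multiset.\<close>

lemma type_of_regular_blocks:
  assumes "distinct cs"
  shows "type_of_blocks (map (\<lambda>c. Jordan_block (Finite_ev c) 1) cs @ map Vertical_block vs) =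
     \<lparr> jordan_sizes = replicate_mset (length cs) {#1#}, horizontal_indices = {#}, vertical_indices = mset vs \<rparr>"
proof -
  let ?J = "map (\<lambda>c. Jordan_block (Finite_ev c) 1) cs"
  let ?bs = "?J @ map Vertical_block vs"
  have V: "[h. Horizontal_block h \<leftarrow> map Vertical_block vs] = []"
    "[k. Jordan_block e' k \<leftarrow> map Vertical_block vs, e' = e] = []"
    "[v. Vertical_block v \<leftarrow> map Vertical_block vs] = vs" for e
    by (induction vs) auto
  have Jh: "[h. Horizontal_block h \<leftarrow> ?J] = []" "[v. Vertical_block v \<leftarrow> ?J] = []"
    by (induction cs) auto
  have Jj: "mset [k. Jordan_block e' k \<leftarrow> ?J, e' = Finite_ev c] = {#1#}" if "c \<in> set cs" for c
    using assms that
  proof (induction cs)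
    case (Cons a cs)
    have none: "[k. Jordan_block e' k \<leftarrow> map (\<lambda>c. Jordan_block (Finite_ev c) 1) cs, e' = Finite_ev c] = []"
      if "c \<notin> set cs" for c using that by (induction cs) auto
    show ?case using Cons none by (cases "a = c") auto
  qed simp
  have ev: "{e. \<exists>k. Jordan_block e k \<in> set ?bs} = Finite_ev ` set cs" by auto
  have "image_mset (\<lambda>e. mset [k. Jordan_block e' k \<leftarrow> ?bs, e' = e]) (mset_set {e. \<exists>k. Jordan_block e k \<in> set ?bs})
     = replicate_mset (card (Finite_ev ` set cs)) {#1#}"
    unfolding ev by (rule image_mset_constant_on) (use V(2) Jj in auto)
  moreover have "card (Finite_ev ` set cs) = length cs"
    using distinct_card[OF assms] by (subst card_image) (auto simp: inj_on_def)
  ultimately show ?thesis unfolding type_of_blocks_def using V Jh by simp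
qed

lemma matrix_rel_jordan_one:
  assumes "A x = fscale c y" "B x = y"
  shows "matrix_rel [x] [y] A (fst (block_pair (Jordan_block (Finite_ev c) 1)))"
    and "matrix_rel [x] [y] B (snd (block_pair (Jordan_block (Finite_ev c) 1)))"
proof -
  have len: "length [x] = 1" "length [y] = 1" by simp_all
  have gen: "matrix_rel [x] [y] f M" if "M \<in> carrier_mat 1 1" "f x = fscale (M $$ (0, 0)) y" for f M
    unfolding matrix_rel_def len less_one
  proof (intro conjI that(1) allI impI)
    fix j :: nat assume j: "j = 0"
    have "(\<Sum>i<1. fscale (M $$ (i, j)) ([y] ! i)) = fscale (M $$ (0, 0)) y" unfolding j by simp
    moreover have "f ([x] ! j) = f x" unfolding j by simp
    ultimately show "f ([x] ! j) = (\<Sum>i<1. fscale (M $$ (i, j)) ([y] ! i))" by (metis that(2))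
  qed
  show "matrix_rel [x] [y] A (fst (block_pair (Jordan_block (Finite_ev c) 1)))"
    by (rule gen) (use assms(1) in \<open>simp_all add: jordan_block_def\<close>)
  show "matrix_rel [x] [y] B (snd (block_pair (Jordan_block (Finite_ev c) 1)))"
    by (rule gen) (use assms(2) in simp_all)
qed

text \<open>The first map scales the k-th diagonal unit by \<open>\<mu> k\<close> and the second
  fixes it, so these units are sources and targets of the Jordan blocks at once. A relation Z = - Y
  D between symmetric forms makes Y and Z diagonal, since the entries of D are distinct.\<close>

lemma diagonal_pencil_kronecker_form:
  assumes inj: "inj_on \<mu> {..<n}"
  shows "kronecker_realizable (right_mult n n (diagonal_mat_of n \<mu>)) (right_mult n n (1\<^sub>m n)) (form_space n 1) (mat_space n n)
     (map (\<lambda>c. Jordan_block (Finite_ev c) 1) (map \<mu> [0..<n]) @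
        map Vertical_block (replicate (n * (n - 1) div 2) 2))"
proof -
  let ?A = "right_mult n n (diagonal_mat_of n \<mu>)" and ?B = "right_mult n n (1\<^sub>m n)"
  have car: "diagonal_mat_of n \<mu> \<in> carrier_mat n n" "1\<^sub>m n \<in> carrier_mat n n"
    by (simp_all add: diagonal_mat_of_def)
  have A: "?A f (p, k) = f (p, k) * \<mu> k" if "p < n" "k < n" for f p k
  proof -
    have "?A f (p, k) = (\<Sum>j<n. f (p, j) * diagonal_mat_of n \<mu> $$ (j, k))"
      unfolding right_mult_apply[OF car(1)] using that by simp
    also have "\<dots> = (\<Sum>j<n. if j = k then f (p, j) * \<mu> j else 0)"
      by (rule sum.cong) (use that in \<open>simp_all add: diagonal_mat_of_def\<close>)
    finally show ?thesis using that by simp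
  qed
  have B: "?B f = f" if "f \<in> mat_space n n" for f
    unfolding right_mult_def using entries_mat[OF that] right_mult_one_mat[of "mat n n f" n n] by simp
  have Az: "?A f (p, k) = 0" if "\<not> (p < n \<and> k < n)" for f p k
    using right_mult_in_mat_space[OF car(1), of f] that unfolding mat_space_def by blast
  obtain BG where BG: "finite BG" "fs.independent BG" "fs.span BG = form_space n 1"
    "2 * int (card BG) = int n * (int n + 1)"
    using form_space_basis[of 1 n] by blast
  obtain BV where BV: "finite BV" "fs.independent BV" "fs.span BV = mat_space n n" "card BV = n * n"
    using mat_space_basis by blast
  define e :: "nat \<Rightarrow> nat \<times> nat \<Rightarrow> complex" where "e k = (\<lambda>y. if y = (k, k) then 1 else 0)" for k
  have e_form: "e k \<in> form_space n 1" if "k < n" for k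
  proof (rule form_spaceI)
    show "e k \<in> mat_space n n" using that unfolding mat_space_def e_def by auto
    show "e k (j, i) = of_int 1 * e k (i, j)" for i j unfolding e_def by auto
  qed
  define xs where "xs = map e [0..<n]"
  have dual: "inj_on e {..<n}" "fs.independent (e ` {..<n})"
    by (rule dual_family_independent[where pos = "\<lambda>k. (k, k)"]; simp add: e_def)+
  have setxs: "set xs = e ` {..<n}" by (simp add: xs_def lessThan_atLeast0)
  have xs: "distinct xs" "fs.independent (set xs)" "set xs \<subseteq> form_space n 1"
    unfolding setxs using dual e_form by (auto simp: xs_def distinct_map lessThan_atLeast0)
  have rel: "block_rel ?A ?B xs xs (map (\<lambda>c. Jordan_block (Finite_ev c) 1) (map \<mu> [0..<n]))"
  proof -
    have Ae: "?A (e k) = fscale (\<mu> k) (e k)" if k: "k < n" for k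
    proof (rule ext)
      fix y :: "nat \<times> nat"
      obtain i j where y: "y = (i, j)" by (cases y)
      show "?A (e k) y = fscale (\<mu> k) (e k) y"
      proof (cases "i < n \<and> j < n")
        case True
        then show ?thesis unfolding y using A[of i j "e k"] by (simp add: e_def)
      next
        case False
        then have "(i, j) \<noteq> (k, k)" using k by auto
        then have "e k (i, j) = 0" unfolding e_def by (rule if_not_P)
        then show ?thesis unfolding y Az[OF False] fscale_apply by simp
      qed
    qed
    have Be: "?B (e k) = e k" if "k < n" for k
      using B e_form[OF that] form_space_subset by blast
    have "block_rel ?A ?B (concat (map (\<lambda>k. [e k]) [0..<n])) (concat (map (\<lambda>k. [e k]) [0..<n]))
        (map (\<lambda>k. Jordan_block (Finite_ev (\<mu> k)) 1) [0..<n])"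
    proof (rule block_rel_concat)
      fix k assume "k \<in> set [0..<n]"
      then have k: "k < n" by simp
      show "matrix_rel [e k] [e k] ?A (fst (block_pair (Jordan_block (Finite_ev (\<mu> k)) 1)))"
        "matrix_rel [e k] [e k] ?B (snd (block_pair (Jordan_block (Finite_ev (\<mu> k)) 1)))"
        by (rule matrix_rel_jordan_one[where A = ?A and B = ?B, OF Ae[OF k] Be[OF k]])+
    qed
    moreover have "concat (map (\<lambda>k. [e k]) [0..<n]) = xs" unfolding xs_def by (rule concat_map_singleton)
    ultimately show ?thesis by (simp add: comp_def)
  qed
  have ysH: "\<exists>h\<in>fs.span (set xs). \<exists>h'\<in>fs.span (set xs). y = ?A h + ?B h'" if y: "y \<in> set xs" for y
  proof -
    have "?A 0 = 0"
    proof (rule ext)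
      fix y :: "nat \<times> nat"
      obtain i j where y: "y = (i, j)" by (cases y)
      show "?A 0 y = 0 y" unfolding y using A[of i j 0] Az[of i j 0] by (cases "i < n \<and> j < n") simp_all
    qed
    moreover have "?B y = y" using B y xs(3) form_space_subset by blast
    ultimately have "y = ?A 0 + ?B y" by simp
    then show ?thesis using fs.span_zero fs.span_base[OF y] by blast
  qed
  have diag_span: "f \<in> fs.span (set xs)"
    if f: "f \<in> form_space n 1" and off: "\<And>p k. p < n \<Longrightarrow> k < n \<Longrightarrow> p \<noteq> k \<Longrightarrow> f (p, k) = 0" for f
  proof -
    have "f = (\<Sum>k<n. fscale (f (k, k)) (e k))"
    proof (rule ext)
      fix y :: "nat \<times> nat"
      obtain i j where y: "y = (i, j)" by (cases y)
      have "(\<Sum>k<n. fscale (f (k, k)) (e k)) y = (\<Sum>k<n. if k = i then if i = j then f (i, i) else 0 else 0)"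
        unfolding sum_fun_apply y by (rule sum.cong) (auto simp: e_def)
      also have "\<dots> = f y"
      proof (cases "i < n \<and> j < n")
        case True
        then show ?thesis unfolding y using off[of i j] by auto
      next
        case False
        then have "f (i, j) = 0" using f form_space_subset unfolding mat_space_def by blast
        then show ?thesis unfolding y using False by auto
      qed
      finally show "f y = (\<Sum>k<n. fscale (f (k, k)) (e k)) y" ..
    qed
    also have "\<dots> \<in> fs.span (set xs)"
      unfolding setxs by (intro fs.span_sum fs.span_scale fs.span_base imageI)
    finally show ?thesis .
  qed
  have key: "Y \<in> fs.span (set xs) \<and> Z \<in> fs.span (set xs)"
    if Y: "Y \<in> form_space n 1" and Z: "Z \<in> form_space n 1" and 0: "?A Y + ?B Z = 0" for Y Z
  proof -
    have BZ: "?B Z = Z" using B Z form_space_subset by blast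
    have rel: "Z (p, k) = - (Y (p, k) * \<mu> k)" if pk: "p < n" "k < n" for p k
    proof -
      have "(?A Y + Z) (p, k) = 0" using 0 unfolding BZ by simp
      then have "Y (p, k) * \<mu> k + Z (p, k) = 0" unfolding plus_fun_apply A[OF pk] .
      then show ?thesis by (rule iffD1[OF add_eq_0_iff])
    qed
    have Yoff: "Y (p, k) = 0" if pk: "p < n" "k < n" "p \<noteq> k" for p k
    proof -
      have Ys: "Y (k, p) = Y (p, k)" and Zs: "Z (k, p) = Z (p, k)"
        using form_space_sym[OF Y, of k p] form_space_sym[OF Z, of k p] by simp_all
      have "- (Y (p, k) * \<mu> k) = - (Y (p, k) * \<mu> p)"
        using trans[OF rel[OF pk(1,2), symmetric] trans[OF Zs[symmetric] rel[OF pk(2,1)]]] unfolding Ys .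
      then have eq: "Y (p, k) * \<mu> k = Y (p, k) * \<mu> p" by (rule iffD1[OF neg_equal_iff_equal])
      have "Y (p, k) * (\<mu> k - \<mu> p) = 0" unfolding right_diff_distrib eq by (rule diff_self)
      moreover have "\<mu> k \<noteq> \<mu> p" using inj pk by (auto simp: inj_on_def)
      ultimately show ?thesis by simp
    qed
    have Zoff: "Z (p, k) = 0" if pk: "p < n" "k < n" "p \<noteq> k" for p k
      using rel[OF pk(1,2)] Yoff[OF pk] by simp
    show ?thesis using diag_span[OF Y Yoff] diag_span[OF Z Zoff] by blast
  qed
  have len: "length xs = n" by (simp add: xs_def)
  have "even (n * (n - 1))" by (cases "even n") simp_all
  then obtain h where h: "n * (n - 1) = 2 * h" by (rule evenE)
  have nn: "int n * int n = int n + 2 * int h"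
  proof (cases n)
    case (Suc l)
    have "int (n * (n - 1)) = 2 * int h" unfolding h by simp
    then show ?thesis using Suc by (simp add: algebra_simps)
  qed (use h in simp)
  have c: "card BG - length xs = h"
  proof -
    have "2 * int (card BG) = 2 * int n + 2 * int h" using BG(4) nn by (simp add: distrib_left)
    then show ?thesis unfolding len by linarith
  qed
  have "int (card BV) = int n + 2 * int h" unfolding BV(4) of_nat_mult nn ..
  \<comment> \<open>The target is exhausted, n * n = n + n (n - 1), so there is no vertical index
    1.\<close>
  then have rest: "card BV - length xs - 2 * (card BG - length xs) = 0" unfolding c unfolding len by linarith
  have h': "n * (n - 1) div 2 = h" unfolding h by simp
  have maps: "?A ` form_space n 1 \<subseteq> mat_space n n" "?B ` form_space n 1 \<subseteq> mat_space n n"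
    using right_mult_in_mat_space[OF car(1)] right_mult_in_mat_space[OF car(2)] by blast+
  let ?bs = "map (\<lambda>c. Jordan_block (Finite_ev c) 1) (map \<mu> [0..<n])"
  have "kronecker_realizable ?A ?B (form_space n 1) (mat_space n n)
     (?bs @ replicate (card BG - length xs) (Vertical_block 2) @
        replicate (card BV - length xs - 2 * (card BG - length xs)) (Vertical_block 1))"
    by (rule kronecker_decomposition[where A = ?A and B = ?B and BG = BG and BV = BV and xs = xs
          and ys = xs and bs = ?bs])
      (fact linear_right_mult[OF car(1)] linear_right_mult[OF car(2)] BG(1-3) BV(1-3) maps xs rel | erule ysH | erule (2) key)+
  then show ?thesis unfolding rest unfolding c h' map_replicate replicate_0 append_Nil2 .
qed

section \<open>Genericity of the diagonal pencil\<close>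

lemma polynomial_functions_pow_mat:
  assumes M: "\<And>x. M x \<in> carrier_mat n n"
    and poly: "\<And>i j. i < n \<Longrightarrow> j < n \<Longrightarrow> (\<lambda>x. M x $$ (i, j)) \<in> polynomial_functions W"
  shows "i < n \<Longrightarrow> j < n \<Longrightarrow> (\<lambda>x. (M x ^\<^sub>m k) $$ (i, j)) \<in> polynomial_functions W"
proof (induction k arbitrary: i j)
  case 0
  have "(M x ^\<^sub>m 0) $$ (i, j) = (if i = j then 1 else 0)" for x
    using M[of x] 0 by simp
  then show ?case by (simp add: polynomial_functions.const)
next
  case (Suc k)
  have "(M x ^\<^sub>m Suc k) $$ (i, j) = (\<Sum>l<n. (M x ^\<^sub>m k) $$ (i, l) * M x $$ (l, j))" for x
  proof -
    have "M x ^\<^sub>m k \<in> carrier_mat n n" using M[of x] by simp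
    then show ?thesis using M[of x] Suc.prems by (simp add: scalar_prod_def lessThan_atLeast0)
  qed
  moreover have "(\<lambda>x. \<Sum>l<n. (M x ^\<^sub>m k) $$ (i, l) * M x $$ (l, j)) \<in> polynomial_functions W"
    by (intro polynomial_functions_sum polynomial_functions.mult Suc.IH poly) (use Suc.prems in auto)
  ultimately show ?case by presburger
qed

text \<open>The adjugate replaces the inverse to stay polynomial: for invertible B the eigenvalues
  of M = adj(B) A are those of B^(-1) A times det B, so they are distinct together. The polynomial
  is det B times the discriminant of M, non-zero at the pair of diag(0, ..., n - 1) and 1.\<close>

lemma generic_pair_diagonal_form:
  obtains p x0 where "p \<in> polynomial_functions (pair_space n n)" "x0 \<in> carrier (pair_space n n)" "p x0 \<noteq> 0"
    and "\<And>A B. A \<in> carrier_mat n n \<Longrightarrow> B \<in> carrier_mat n n \<Longrightarrow> p (A, B) \<noteq> 0 \<Longrightarrow>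
      \<exists>\<mu>. inj_on \<mu> {..<n} \<and> strictly_equivalent n n A B (diagonal_mat_of n \<mu>) (1\<^sub>m n)"
proof -
  \<comment> \<open>Rebuilding the two matrices fixes their dimensions for every \<open>x\<close>,
    as the closure lemmas demand, and changes nothing on the carrier.\<close>
  define MA MB :: "complex mat \<times> complex mat \<Rightarrow> complex mat"
    where "MA x = mat n n (\<lambda>e. fst x $$ e)" and "MB x = mat n n (\<lambda>e. snd x $$ e)" for x
  have MA: "MA x \<in> carrier_mat n n" and MB: "MB x \<in> carrier_mat n n" for x
    by (simp_all add: MA_def MB_def)
  have polyA: "(\<lambda>x. MA x $$ (i, j)) \<in> polynomial_functions (pair_space n n)"
    and polyB: "(\<lambda>x. MB x $$ (i, j)) \<in> polynomial_functions (pair_space n n)" if "i < n" "j < n" for i j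
    using polynomial_functions_entry[OF that] that by (simp_all add: MA_def MB_def)
  define M where "M x = adj_mat (MB x) * MA x" for x
  have adj: "adj_mat (MB x) \<in> carrier_mat n n" for x by (rule adj_mat(1)[OF MB])
  have M: "M x \<in> carrier_mat n n" for x unfolding M_def using adj MA by (rule mult_carrier_mat)
  have polyM: "(\<lambda>x. M x $$ (i, j)) \<in> polynomial_functions (pair_space n n)" if ij: "i < n" "j < n" for i j
  proof -
    have "M x $$ (i, j) = (\<Sum>l<n. adj_mat (MB x) $$ (i, l) * MA x $$ (l, j))" for x
      unfolding M_def using ij adj[of x] MA[of x] by (simp add: scalar_prod_def lessThan_atLeast0)
    moreover have "(\<lambda>x. \<Sum>l<n. adj_mat (MB x) $$ (i, l) * MA x $$ (l, j)) \<in> polynomial_functions (pair_space n n)"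
      by (intro polynomial_functions_sum polynomial_functions.mult polyA
          polynomial_functions_adj_mat[where N = n and M = MB, OF MB polyB]) (use ij in auto)
    ultimately show ?thesis by presburger
  qed
  define p where "p x = det (MB x) * det (moment_matrix n (M x))" for x
  define x0 where "x0 = (diagonal_mat_of n of_nat, 1\<^sub>m n :: complex mat)"
  have moment: "moment_matrix n X \<in> carrier_mat n n" for X by (simp add: moment_matrix_def)
  have poly: "p \<in> polynomial_functions (pair_space n n)"
  proof -
    have "(\<lambda>x. moment_matrix n (M x) $$ (i, j)) \<in> polynomial_functions (pair_space n n)" if "i < n" "j < n" for i j
    proof -
      have "moment_matrix n (M x) $$ (i, j) = (\<Sum>l<n. (M x ^\<^sub>m (i + j)) $$ (l, l))" for x
      proof -
        have "M x ^\<^sub>m (i + j) \<in> carrier_mat n n" using M[of x] by simp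
        from carrier_matD(1)[OF this] show ?thesis using that by (simp add: moment_matrix_def mtrace_def)
      qed
      moreover have "(\<lambda>x. \<Sum>l<n. (M x ^\<^sub>m (i + j)) $$ (l, l)) \<in> polynomial_functions (pair_space n n)"
        by (intro polynomial_functions_sum polynomial_functions_pow_mat[OF M polyM]) auto
      ultimately show ?thesis by presburger
    qed
    then show ?thesis
      unfolding p_def
      by (intro polynomial_functions.mult polynomial_functions_det[OF MB polyB] polynomial_functions_det[OF moment])
  qed
  have D: "diagonal_mat_of n of_nat \<in> carrier_mat n n" by (rule diagonal_mat_of_carrier)
  have x0: "x0 \<in> carrier (pair_space n n)"
    unfolding x0_def carrier_pair_space using D by simp
  have MB0: "MB x0 = 1\<^sub>m n" unfolding MB_def x0_def by (intro eq_matI) auto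
  have MA0: "MA x0 = diagonal_mat_of n of_nat" unfolding MA_def x0_def diagonal_mat_of_def by (intro eq_matI) auto
  have "adj_mat (1\<^sub>m n :: complex mat) = 1\<^sub>m n"
  proof -
    have "adj_mat (1\<^sub>m n :: complex mat) = 1\<^sub>m n * adj_mat (1\<^sub>m n)"
      by (rule left_mult_one_mat[OF adj_mat(1)[OF one_carrier_mat], symmetric])
    also have "\<dots> = 1 \<cdot>\<^sub>m 1\<^sub>m n" unfolding adj_mat(2)[OF one_carrier_mat] by simp
    also have "\<dots> = 1\<^sub>m n" by (intro eq_matI) auto
    finally show ?thesis .
  qed
  then have M0: "M x0 = diagonal_mat_of n of_nat"
    unfolding M_def MB0 MA0 using left_mult_one_mat[OF D] by simp
  have wit: "similar_mat_wit (M x0) (M x0) (1\<^sub>m n) (1\<^sub>m n)"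
    unfolding M0 using D by (intro similar_mat_witI[of _ _ n]) auto
  have "moment_matrix n (M x0) = transpose_mat (vandermonde n (\<lambda>a. M x0 $$ (a, a))) * vandermonde n (\<lambda>a. M x0 $$ (a, a))"
    by (rule moment_matrix_eq[OF wit M]) (unfold M0, auto simp: diagonal_mat_of_def)
  also have "vandermonde n (\<lambda>a. M x0 $$ (a, a)) = vandermonde n of_nat"
    unfolding M0 vandermonde_def diagonal_mat_of_def by (intro eq_matI) auto
  finally have mom: "moment_matrix n (M x0) = transpose_mat (vandermonde n of_nat) * vandermonde n of_nat" .
  have V: "vandermonde n of_nat \<in> carrier_mat n n" by (simp add: vandermonde_def)
  have "det (vandermonde n of_nat) \<noteq> 0" by (rule vandermonde_det_nonzero) (simp add: inj_on_def)
  moreover have "det (moment_matrix n (M x0)) = det (vandermonde n of_nat) * det (vandermonde n of_nat)"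
    unfolding mom using det_mult[of "transpose_mat (vandermonde n of_nat)" n "vandermonde n of_nat"] V det_transpose[OF V] by simp
  ultimately have p0: "p x0 \<noteq> 0" unfolding p_def MB0 by simp
  show thesis
  proof (rule that[OF poly x0 p0])
    fix A B :: "complex mat"
    assume A: "A \<in> carrier_mat n n" and B: "B \<in> carrier_mat n n" and pAB: "p (A, B) \<noteq> 0"
    have AB: "MA (A, B) = A" "MB (A, B) = B"
      using A B unfolding MA_def MB_def by (auto intro!: eq_matI)
    have detB: "det B \<noteq> 0" and det: "det (moment_matrix n (M (A, B))) \<noteq> 0"
      using pAB unfolding p_def AB by auto
    obtain W W' \<mu> where W: "W \<in> carrier_mat n n" "W' \<in> carrier_mat n n" "W * W' = 1\<^sub>m n" "W' * W = 1\<^sub>m n"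
      and inj: "inj_on \<mu> {..<n}" and MW: "M (A, B) * W = W * diagonal_mat_of n \<mu>"
      using diagonalisation_of_moment_matrix[OF M det] unfolding diagonal_mat_of_def by blast
    obtain B' where B': "B' \<in> carrier_mat n n" "B * B' = 1\<^sub>m n" "B' * B = 1\<^sub>m n"
      using det_nonzero_inverse[OF B detB] by blast
    \<comment> \<open>Undoes the factor det B introduced by the adjugate.\<close>
    define \<nu> where "\<nu> i = \<mu> i / det B" for i
    have inj': "inj_on \<nu> {..<n}" using inj detB by (auto simp: inj_on_def \<nu>_def)
    define U where "U = B * W"
    define U' where "U' = W' * B'"
    have U: "U \<in> carrier_mat n n" "U' \<in> carrier_mat n n" unfolding U_def U'_def using B B' W by auto
    have UU': "U * U' = 1\<^sub>m n"
    proof -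
      have "U * U' = B * (W * (W' * B'))"
        unfolding U_def U'_def by (rule assoc_mult_mat[OF B W(1)]) (use W B' in auto)
      also have "W * (W' * B') = W * W' * B'" by (rule assoc_mult_mat[OF W(1,2) B'(1), symmetric])
      also have "\<dots> = B'" unfolding W(3) by (rule left_mult_one_mat[OF B'(1)])
      finally show ?thesis unfolding B'(2) .
    qed
    have U'U: "U' * U = 1\<^sub>m n" by (rule mat_mult_left_right_inverse[OF U UU'])
    have D\<mu>: "diagonal_mat_of n \<mu> = det B \<cdot>\<^sub>m diagonal_mat_of n \<nu>"
      unfolding diagonal_mat_of_def \<nu>_def using detB by (intro eq_matI) auto
    note Dc = diagonal_mat_of_carrier[of n]
    have "det B \<cdot>\<^sub>m (A * W) = det B \<cdot>\<^sub>m (U * diagonal_mat_of n \<nu>)"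
    proof -
      have "B * (M (A, B) * W) = B * (adj_mat B * A) * W"
        unfolding M_def AB using assoc_mult_mat[OF B, of "adj_mat B * A" n W n] adj_mat(1)[OF B] A W(1) by simp
      also have "B * (adj_mat B * A) = B * adj_mat B * A"
        by (rule assoc_mult_mat[OF B adj_mat(1)[OF B] A, symmetric])
      also have "\<dots> = det B \<cdot>\<^sub>m A"
        unfolding adj_mat(2)[OF B] using mult_smult_assoc_mat[of "1\<^sub>m n" n n A n "det B"] A by simp
      also have "det B \<cdot>\<^sub>m A * W = det B \<cdot>\<^sub>m (A * W)" by (rule mult_smult_assoc_mat[OF A W(1)])
      finally have 1: "B * (M (A, B) * W) = det B \<cdot>\<^sub>m (A * W)" .
      have "B * (W * diagonal_mat_of n \<mu>) = U * diagonal_mat_of n \<mu>"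
        unfolding U_def by (rule assoc_mult_mat[OF B W(1) Dc, symmetric])
      also have "\<dots> = det B \<cdot>\<^sub>m (U * diagonal_mat_of n \<nu>)"
        unfolding D\<mu> by (rule mult_smult_distrib[OF U(1) Dc])
      finally show ?thesis unfolding 1[symmetric] MW .
    qed
    then have "inverse (det B) \<cdot>\<^sub>m (det B \<cdot>\<^sub>m (A * W)) = inverse (det B) \<cdot>\<^sub>m (det B \<cdot>\<^sub>m (U * diagonal_mat_of n \<nu>))"
      by simp
    moreover have "inverse (det B) \<cdot>\<^sub>m (det B \<cdot>\<^sub>m X) = X" for X :: "complex mat"
      using detB by (intro eq_matI) auto
    ultimately have AW: "A * W = U * diagonal_mat_of n \<nu>" by simp
    have BW: "B * W = U * 1\<^sub>m n" using right_mult_one_mat[OF U(1)] unfolding U_def by simp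
    show "\<exists>\<mu>. inj_on \<mu> {..<n} \<and> strictly_equivalent n n A B (diagonal_mat_of n \<mu>) (1\<^sub>m n)"
      unfolding strictly_equivalent_def
      by (rule exI[of _ \<nu>], rule conjI[OF inj'], rule exI[of _ U], rule exI[of _ U'], rule exI[of _ W],
          rule exI[of _ W']) (intro conjI U UU' U'U W AW BW)
  qed
qed

lemma standard_sum_invariants_equal:
  assumes J: "J \<in> carrier_mat n n" "J' \<in> carrier_mat n n" "J * J' = 1\<^sub>m n" "J' * J = 1\<^sub>m n"
  shows "standard_sum_has_JK_invariants (form_algebra J n 1) n n
    \<lparr> jordan_sizes = replicate_mset n {#1#}, horizontal_indices = {#},
      vertical_indices = replicate_mset (n * (n - 1) div 2) 2 \<rparr>"
    (is "standard_sum_has_JK_invariants _ _ _ ?T")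
proof -
  obtain p x0 where p: "p \<in> polynomial_functions (pair_space n n)" "x0 \<in> carrier (pair_space n n)" "p x0 \<noteq> 0"
    "\<And>A B. A \<in> carrier_mat n n \<Longrightarrow> B \<in> carrier_mat n n \<Longrightarrow> p (A, B) \<noteq> 0 \<Longrightarrow>
      \<exists>\<mu>. inj_on \<mu> {..<n} \<and> strictly_equivalent n n A B (diagonal_mat_of n \<mu>) (1\<^sub>m n)"
    by (rule generic_pair_diagonal_form[of n]) (rule that)
  show ?thesis
    unfolding standard_sum_has_JK_invariants_def
  proof (rule has_JK_invariantsI[OF p(1-3)])
    fix A B assume "A \<in> carrier (module_mat TYPE(complex) n n)" "B \<in> carrier (module_mat TYPE(complex) n n)"
      and p0: "p (A, B) \<noteq> 0"
    then have AB: "A \<in> carrier_mat n n" "B \<in> carrier_mat n n" by (simp_all add: module_mat_simps)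
    obtain \<mu> where inj: "inj_on \<mu> {..<n}" and equiv: "strictly_equivalent n n A B (diagonal_mat_of n \<mu>) (1\<^sub>m n)"
    proof -
      from p(4)[OF AB p0] show thesis by (rule exE) (erule conjE, rule that)
    qed
    define bs where "bs = map (\<lambda>c. Jordan_block (Finite_ev c) 1) (map \<mu> [0..<n]) @
        map Vertical_block (replicate (n * (n - 1) div 2) 2)"
    have "distinct (map \<mu> [0..<n])" using inj by (simp add: distinct_map lessThan_atLeast0)
    note type_of_regular_blocks[OF this, of "replicate (n * (n - 1) div 2) 2", folded bs_def]
    then have type: "type_of_blocks bs = ?T"
      unfolding mset_replicate length_map length_upt diff_zero .
    have pos: "block_size b \<ge> 1" if "b \<in> set bs" for b
      using that unfolding bs_def by auto
    show "has_algebraic_type ((module_mat TYPE(complex) n n)\<lparr>carrier := form_algebra J n 1\<rparr>)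
       (module_mat TYPE(complex) n n) (\<lambda>Y. Y * A) (\<lambda>Y. Y * B) ?T"
      by (rule form_algebra_pencil_type[OF J equiv AB diagonal_mat_of_carrier one_carrier_mat
            diagonal_pencil_kronecker_form[OF inj, folded bs_def] pos type])
  qed
qed

section \<open>The invariants\<close>

lemma form_algebra_exists:
  assumes "(\<gg> = so_algebra n \<and> \<epsilon> = -1) \<or> (even n \<and> \<gg> = sp_algebra n \<and> \<epsilon> = 1)"
  obtains J J' where "J \<in> carrier_mat n n" "J' \<in> carrier_mat n n" "J * J' = 1\<^sub>m n" "J' * J = 1\<^sub>m n"
    and "\<gg> = form_algebra J n \<epsilon>"
  using assms
proof (elim disjE conjE)
  assume "\<gg> = so_algebra n" "\<epsilon> = -1"
  then show thesis
    using so_algebra_eq[of n] by (intro that[of "1\<^sub>m n" "1\<^sub>m n"]) simp_all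
next
  assume n: "even n" and g: "\<gg> = sp_algebra n" "\<epsilon> = 1"
  note S = symplectic_form_props[OF n]
  have neg: "- symplectic_form n \<in> carrier_mat n n" using S(1) by simp
  have inv: "- symplectic_form n * symplectic_form n = 1\<^sub>m n"
    by (rule mat_mult_left_right_inverse[OF S(1) neg S(3)])
  show thesis
    by (rule that[OF S(1) neg S(3) inv]) (simp only: g sp_algebra_eq[OF n])
qed

lemma triangle_count:
  assumes "\<epsilon> = 1 \<or> \<epsilon> = -1"
  shows "card (triangle k \<epsilon>) = nat (int k * (int k + \<epsilon>) div 2)"
  using card_triangle[OF assms, of k] by linarith

theorem theorem3p21:
  fixes m n :: nat and \<epsilon> :: int and \<gg> :: "complex mat set"
  assumes "0 < m" and "0 < n"
    and "(\<gg> = so_algebra n \<and> \<epsilon> = -1) \<or> (even n \<and> \<gg> = sp_algebra n \<and> \<epsilon> = 1)"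
  shows
    "(m < n \<longrightarrow>
       (\<forall>q r d :: int. d = int n - int m \<and> int m = q * d + r \<and> 0 \<le> r \<and> r < d \<longrightarrow>
         (let H = replicate_mset (nat ((d - r) * (d - r + \<epsilon>) div 2)) (nat (2 * q + 1))
                + replicate_mset (nat ((d - r) * r)) (nat (2 * q + 2))
                + replicate_mset (nat (r * (r + \<epsilon>) div 2)) (nat (2 * q + 3));
              V = replicate_mset (nat (int m * (int m - \<epsilon>) div 2)) 2
          in int (size H) = d * (d + \<epsilon>) div 2 \<and>
             standard_sum_has_JK_invariants \<gg> n m
               \<lparr> jordan_sizes = {#}, horizontal_indices = H, vertical_indices = V \<rparr>))) \<and>
     (m = n \<and> \<epsilon> = -1 \<longrightarrow>
       (let V = replicate_mset n 1 + replicate_mset (n * (n - 1) div 2) 2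
        in size V = n * (n + 1) div 2 \<and>
           standard_sum_has_JK_invariants \<gg> n m
             \<lparr> jordan_sizes = {#}, horizontal_indices = {#}, vertical_indices = V \<rparr>)) \<and>
     (m = n \<and> \<epsilon> = 1 \<longrightarrow>
       standard_sum_has_JK_invariants \<gg> n m
         \<lparr> jordan_sizes = replicate_mset n {#1#}, horizontal_indices = {#},
           vertical_indices = replicate_mset (n * (n - 1) div 2) 2 \<rparr>) \<and>
     (m > n \<longrightarrow>
       (let V = replicate_mset (nat ((int m - int n - \<epsilon>) * int n)) 1
              + replicate_mset (nat (int n * (int n + \<epsilon>) div 2)) 2
        in int (size V) = int n * (int m - int n) + int n * (int n - \<epsilon>) div 2 \<and>
           standard_sum_has_JK_invariants \<gg> n m
             \<lparr> jordan_sizes = {#}, horizontal_indices = {#}, vertical_indices = V \<rparr>))"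
proof -
  have \<epsilon>: "\<epsilon> = 1 \<or> \<epsilon> = -1" using assms(3) by blast
  obtain J J' where J: "J \<in> carrier_mat n n" "J' \<in> carrier_mat n n" "J * J' = 1\<^sub>m n" "J' * J = 1\<^sub>m n"
    and \<gg>: "\<gg> = form_algebra J n \<epsilon>"
    by (rule form_algebra_exists[OF assms(3)])
  note tri = card_triangle[OF \<epsilon>]
  have less: "let H = replicate_mset (nat ((d - r) * (d - r + \<epsilon>) div 2)) (nat (2 * q + 1))
                + replicate_mset (nat ((d - r) * r)) (nat (2 * q + 2))
                + replicate_mset (nat (r * (r + \<epsilon>) div 2)) (nat (2 * q + 3));
              V = replicate_mset (nat (int m * (int m - \<epsilon>) div 2)) 2
          in int (size H) = d * (d + \<epsilon>) div 2 \<and>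
             standard_sum_has_JK_invariants \<gg> n m
               \<lparr> jordan_sizes = {#}, horizontal_indices = H, vertical_indices = V \<rparr>"
    if d: "d = int n - int m" and m: "int m = q * d + r" and r: "0 \<le> r" "r < d" for q r d
  proof -
    \<comment> \<open>The quotient is an arbitrary integer; a negative one would make m negative
      because r < d.\<close>
    have "0 \<le> q"
    proof (rule ccontr)
      assume "\<not> 0 \<le> q"
      then have "q * d \<le> (- 1) * d" using r by (intro mult_right_mono) auto
      then show False using m r by linarith
    qed
    then obtain q' where q: "q = int q'" by (metis nonneg_int_cases)
    obtain r' where r': "r = int r'" using r(1) by (metis nonneg_int_cases)
    obtain d' where d': "d = int d'" using r by (metis nonneg_int_cases order.trans order_less_imp_le)
    have rd: "r' < d'" using r(2) unfolding r' d' by simp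
    have m': "m = q' * d' + r'" using m unfolding q r' d' by (metis of_nat_add of_nat_eq_iff of_nat_mult)
    have n': "n = m + d'" using d unfolding d' by linarith
    have dr: "d - int r' = int (d' - r')" using rd unfolding d' by (simp add: of_nat_diff)
    have H: "replicate_mset (nat ((d - r) * (d - r + \<epsilon>) div 2)) (nat (2 * q + 1))
                + replicate_mset (nat ((d - r) * r)) (nat (2 * q + 2))
                + replicate_mset (nat (r * (r + \<epsilon>) div 2)) (nat (2 * q + 3)) =
        replicate_mset (card (triangle (d' - r') \<epsilon>)) (2 * q' + 1) +
        replicate_mset ((d' - r') * r') (2 * q' + 2) + replicate_mset (card (triangle r' \<epsilon>)) (2 * q' + 3)"
    proof -
      have "nat (2 * q + 1) = 2 * q' + 1" "nat (2 * q + 2) = 2 * q' + 2" "nat (2 * q + 3) = 2 * q' + 3"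
        unfolding q by (simp_all add: nat_add_distrib nat_mult_distrib)
      moreover have "nat ((d - r) * r) = (d' - r') * r'"
        unfolding r' dr of_nat_mult[symmetric] by (rule nat_int)
      ultimately show ?thesis unfolding r' dr triangle_count[OF \<epsilon>] by metis
    qed
    \<comment> \<open>Pairs from d residues, of which r are marked, are counted by the number of
      marked members.\<close>
    have size: "int (card (triangle (d' - r') \<epsilon>) + (d' - r') * r' + card (triangle r' \<epsilon>)) = d * (d + \<epsilon>) div 2"
    proof -
      have "2 * int (card (triangle (d' - r') \<epsilon>) + (d' - r') * r' + card (triangle r' \<epsilon>)) =
         2 * int (card (triangle (d' - r') \<epsilon>)) + 2 * (int (d' - r') * int r') + 2 * int (card (triangle r' \<epsilon>))"
        by simp
      also have "\<dots> = d * (d + \<epsilon>)"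
        unfolding tri dr[symmetric] by (simp add: algebra_simps)
      finally have eq: "d * (d + \<epsilon>) = 2 * int (card (triangle (d' - r') \<epsilon>) + (d' - r') * r' + card (triangle r' \<epsilon>))" ..
      show ?thesis unfolding eq by (rule nonzero_mult_div_cancel_left[symmetric]) simp
    qed
    show ?thesis
      unfolding H Let_def size_union size_replicate_mset
    proof (intro conjI size)
      show "standard_sum_has_JK_invariants \<gg> n m
         \<lparr> jordan_sizes = {#},
           horizontal_indices = replicate_mset (card (triangle (d' - r') \<epsilon>)) (2 * q' + 1) +
             replicate_mset ((d' - r') * r') (2 * q' + 2) + replicate_mset (card (triangle r' \<epsilon>)) (2 * q' + 3),
           vertical_indices = replicate_mset (nat (int m * (int m - \<epsilon>) div 2)) 2 \<rparr>"
        unfolding \<gg> by (rule standard_sum_invariants_less[OF rd \<epsilon> m' n' J])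
    qed
  qed
  have equal_so: "let V = replicate_mset n 1 + replicate_mset (n * (n - 1) div 2) 2
        in size V = n * (n + 1) div 2 \<and>
           standard_sum_has_JK_invariants \<gg> n m
             \<lparr> jordan_sizes = {#}, horizontal_indices = {#}, vertical_indices = V \<rparr>"
    if mn: "m = n" and e: "\<epsilon> = -1"
  proof -
    define K where "K = n * (n - 1) div 2"
    have K2: "2 * K = n * (n - 1)" unfolding K_def by (cases "even n") simp_all
    have nn: "n * n = n + n * (n - 1)" using assms(2) by (cases n) simp_all
    have n2: "n * n = n + 2 * K" unfolding K2 by (rule nn)
    have "int n * int n = int n + 2 * int K" using arg_cong[OF n2, of int] by simp
    then have K: "2 * int K = int n * (int n + \<epsilon>)" unfolding e by (simp add: algebra_simps)
    have L: "n * m - 2 * K = n" unfolding mn n2 by (rule diff_add_inverse2)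
    have "standard_sum_has_JK_invariants \<gg> n m
       \<lparr> jordan_sizes = {#}, horizontal_indices = {#},
         vertical_indices = replicate_mset (n * m - 2 * K) 1 + replicate_mset K 2 \<rparr>"
      unfolding \<gg> by (rule standard_sum_invariants_greater[OF \<epsilon> _ K J]) (use mn e in blast)
    moreover have "n + K = n * (n + 1) div 2"
    proof -
      have eq: "n * (n + 1) = 2 * (n + K)" using n2 by (simp add: distrib_left)
      show ?thesis unfolding eq by (rule nonzero_mult_div_cancel_left[symmetric]) simp
    qed
    ultimately show ?thesis unfolding Let_def size_union size_replicate_mset L K_def[symmetric] by blast
  qed
  have equal_sp: "standard_sum_has_JK_invariants \<gg> n m
         \<lparr> jordan_sizes = replicate_mset n {#1#}, horizontal_indices = {#},
           vertical_indices = replicate_mset (n * (n - 1) div 2) 2 \<rparr>"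
    if "m = n" "\<epsilon> = 1"
    using standard_sum_invariants_equal[OF J] unfolding \<gg> that .
  have greater: "let V = replicate_mset (nat ((int m - int n - \<epsilon>) * int n)) 1
              + replicate_mset (nat (int n * (int n + \<epsilon>) div 2)) 2
        in int (size V) = int n * (int m - int n) + int n * (int n - \<epsilon>) div 2 \<and>
           standard_sum_has_JK_invariants \<gg> n m
             \<lparr> jordan_sizes = {#}, horizontal_indices = {#}, vertical_indices = V \<rparr>"
    if mn: "m > n"
  proof -
    define K where "K = card (triangle n \<epsilon>)"
    have K: "2 * int K = int n * (int n + \<epsilon>)" unfolding K_def by (rule tri)
    have nK: "nat (int n * (int n + \<epsilon>) div 2) = K" unfolding K_def triangle_count[OF \<epsilon>] ..
    have L: "(int m - int n - \<epsilon>) * int n = int n * int m - 2 * int K"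
      unfolding K by (simp add: algebra_simps)
    \<comment> \<open>For \<epsilon> = 1 this uses m - n \<ge> 1. It says that twice the dimension
      of the forms does not exceed n * m, so the subtraction in the number of vertical indices 1 is
      not truncated.\<close>
    have pos: "0 \<le> (int m - int n - \<epsilon>) * int n" using mn \<epsilon> by (intro mult_nonneg_nonneg) auto
    then have "int (2 * K) \<le> int (n * m)" unfolding L by simp
    then have ge: "2 * K \<le> n * m" by (rule of_nat_le_iff[THEN iffD1])
    have "int n * int m - 2 * int K = int (n * m - 2 * K)" using ge by (simp add: of_nat_diff)
    then have nL: "nat ((int m - int n - \<epsilon>) * int n) = n * m - 2 * K" unfolding L by (simp only: nat_int)
    have "standard_sum_has_JK_invariants \<gg> n m
       \<lparr> jordan_sizes = {#}, horizontal_indices = {#},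
         vertical_indices = replicate_mset (n * m - 2 * K) 1 + replicate_mset K 2 \<rparr>"
      unfolding \<gg> by (rule standard_sum_invariants_greater[OF \<epsilon> _ K J]) (use mn in blast)
    moreover have "int (n * m - 2 * K + K) = int n * (int m - int n) + int n * (int n - \<epsilon>) div 2"
    proof -
      have "int (n * m - 2 * K + K) = int n * int m - int K" using ge by (simp add: of_nat_diff)
      moreover have eq: "int n * (int n - \<epsilon>) = 2 * (int n * int n - int K)"
        using K by (simp add: right_diff_distrib distrib_left)
      moreover have "int n * (int n - \<epsilon>) div 2 = int n * int n - int K"
        unfolding eq by (rule nonzero_mult_div_cancel_left) simp
      ultimately show ?thesis by (simp add: right_diff_distrib)
    qed
    ultimately show ?thesis unfolding Let_def nK nL size_union size_replicate_mset by blast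
  qed
  show ?thesis
    by (intro conjI impI allI; (elim conjE)?; (rule less equal_so equal_sp greater; assumption))
qed

end
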